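(* For every $n\in\mathbb N$ let $U_n:G_n\cap D\to\mathbb R$ be a solution of the discrete system (S$_n$) defined in the context, and let $u_n:\mathbb R^2\to\mathbb R$ be the associated convex function defined in the context. Assume that $$\lim_{n\to+\infty}\ \sup_{x\in \overline X\cap G_n}\ \sup_{y\in\partial u_n(x)}\bigl|\nabla_n U_n[x]-y\bigr|=0 .$$ Then, as $n\to+\infty$, the functions $u_n$ converge uniformly on compact subsets of $\mathbb R^2$ to the unique minimal Brenier solution $\tilde u$ (for the transport of $\mu$ to $\nu$) which satisfies $\tilde u(0)=0$.
   Context: **Data.** $X\subset\mathbb R^2$ is a nonempty bounded open set with $0\in X$; $Y\subset\mathbb R^2$ is a nonempty bounded open convex set. $f$ is a (Lebesgue integrable) probability density on $X$, extended by $0$ outside $X$, with $m_f\le f\le M_f$ on $X$; $g:\mathbb R^2\to\mathbb R$ is continuous with $m_g\le g\le M_g$ and $\int_Y g=1$; here $m_f,M_f,m_g,M_g\in(0,+\infty)$. Put $\mu=f\,dx$ and $\nu=g\mathbf 1_Y\,dx$. $\sigma(z)=\sup_{y\in\overline Y}\langle y,z\rangle$ is the support function of $\overline Y$. $\partial u(x)$ is the convex subdifferential of $u$ at $x$, and $\partial u(E)=\bigcup_{x\in E}\partial u(x)$. **Minimal Brenier solution.** A convex lower semicontinuous function $u:\mathbb R^2\to\mathbb R\cup\{+\infty\}$ such that $(\nabla u)_\sharp\mu=\nu$ and $\partial u(\mathbb R^2)=\overline Y$ (such a function is unique up to an additive constant). **Grid and directions.** $h_n>0$ decreases to $0$, $G_n=h_n\mathbb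 Z^2$, $D=[-1,1]^2$ contains $\overline X$ in its interior. A vector of $\mathbb Z^2$ is irreducible if its coordinates are coprime. $\mathcal V_n\subset\mathbb Z^2\setminus\{0\}$ are finite sets of irreducible vectors, and $Y_n=\{y\in\mathbb R^2:\langle y,e\rangle\le\sigma(e)\ \forall e\in\mathcal V_n\}$. It is assumed that: (1) $\{(\pm1,0),(0,\pm1)\}\subset\mathcal V_n$; (2) $\mathcal V_n\subset\mathcal V_{n'}$ for $n'\ge n$; (3) $\bigcap_n Y_n=\overline Y$; (4) $\overline X+h_n\mathcal V_n\subset D$ (discarding finitely many $n$). **Scheme.** For $U:G_n\cap D\to\mathbb R$ let $\delta_eU[x]=U[x+h_ne]-U[x]$, $\Delta_eU[x]=\delta_eU[x]+\delta_{-e}U[x]$ and $\Delta_e^+=\max(\Delta_e,0)$. A superbase is a triple $(e,e',e'')\in(\mathbb Z^2)^3$ with $e+e'+e''=0$ and $|\det(e',e'')|=1$. Define $$\mathrm{MA}(U)[x]=\frac1{h_n^4}\min_{(e,e',e'')}H\bigl(\Delta_e^+U[x],\Delta_{e'}^+U[x],\Delta_{e''}^+U[x]\bigr),$$ the minimum being over superbases with $x\pm h_ne,\ x\pm h_ne',\ x\pm h_ne''\in D$, where for $a,b,c\ge0$: $H(a,b,c)=bc$ if $a\ge b+c$ (and likewise permuting $a,b,c$), and $H(a,b,c)=\frac12(ab+bc+ca)-\frac14(a^2+b^2+c^2)$ otherwise. Let $\tilde\delta_eU[x]=U[x+h_ne]-U[x]$ if $x+h_ne\in D$ and $\tilde\delta_eU[x]=\sigma(h_ne)$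 otherwise; $\tilde\Delta_e=\tilde\delta_e+\tilde\delta_{-e}$; and $\widetilde{\mathrm{MA}}^0(U)[x]=\min_{e\in V(x)\cup\mathcal V_n}\tilde\Delta_eU[x]$, where $V(x)$ is the set of irreducible $e\in\mathbb Z^2\setminus\{0\}$ with $x\pm h_ne\in D$. Let $\bar f_n[x]=h_n^{-2}\int_{[-h_n/2,h_n/2]^2}f(x+t)\,dt$. $\nabla_n$ is a given discrete gradient, assigning to a grid function $U$ and $x\in G_n\cap\overline X$ a vector $\nabla_nU[x]\in\mathbb R^2$. A solution of (S$_n$) is a function $U_n:G_n\cap D\to\mathbb R$ such that $\mathrm{MA}(U_n)[x]=\bar f_n[x]/g(\nabla_nU_n[x])$ for $x\in G_n\cap X$, $\widetilde{\mathrm{MA}}^0(U_n)[x]=0$ for $x\in G_n\cap(D\setminus X)$, and $U_n[0]=0$. **Convex function $u_n$.** For $x\in\mathbb R^2$, $$u_n(x)=\sup_{y\in Y_n}\bigl(\langle x,y\rangle-U_n^*(y)\bigr),\qquad U_n^*(y)=\max_{x'\in G_n\cap D}\bigl(\langle y,x'\rangle-U_n[x']\bigr).$$ *)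

theory Defs
  imports "HOL-Analysis.Analysis"
begin

section \<open>Convex analysis\<close>

text \<open>Functions from the plane to the extended reals. The condition \<open>u x \<noteq> -\<infinity>\<close> encodes that
  the values lie in \<open>\<real> \<union> {+\<infinity>}\<close>; convexity is convexity of the epigraph (\<^const>\<open>convex_on\<close> does
  not apply to \<^typ>\<open>ereal\<close>-valued functions).\<close>

definition convex_lsc :: "(real^2 \<Rightarrow> ereal) \<Rightarrow> bool" where
  "convex_lsc u \<longleftrightarrow>
     (\<forall>x. u x \<noteq> -\<infinity>) \<and>
     convex {(x, r :: real). u x \<le> ereal r} \<and>
     (\<forall>x. u x \<le> Liminf (at x) u)"

text \<open>As usual, the subdifferential is empty at points where \<open>u\<close> is infinite.\<close>

definition subdifferential :: "(real^2 \<Rightarrow> ereal) \<Rightarrow> real^2 \<Rightarrow> (real^2) set" where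
  "subdifferential u x =
     {y. \<bar>u x\<bar> \<noteq> \<infinity> \<and> (\<forall>z. u x + ereal (y \<bullet> (z - x)) \<le> u z)}"

definition has_gradient :: "(real^2 \<Rightarrow> ereal) \<Rightarrow> real^2 \<Rightarrow> real^2 \<Rightarrow> bool" where
  "has_gradient u x p \<longleftrightarrow>
     (\<forall>\<^sub>F z in nhds x. \<bar>u z\<bar> \<noteq> \<infinity>) \<and> gderiv (\<lambda>z. real_of_ereal (u z)) x p"

definition gradient :: "(real^2 \<Rightarrow> ereal) \<Rightarrow> real^2 \<Rightarrow> real^2" where
  "gradient u x = (if \<exists>p. has_gradient u x p then (THE p. has_gradient u x p) else 0)"

definition support_fun :: "(real^2) set \<Rightarrow> real^2 \<Rightarrow> real" where
  "support_fun Y z = (SUP y\<in>closure Y. y \<bullet> z)"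


section \<open>Minimal Brenier solutions\<close>

definition source_measure :: "(real^2 \<Rightarrow> real) \<Rightarrow> (real^2) measure" where
  "source_measure f = density lebesgue (\<lambda>x. ennreal (f x))"

definition target_measure :: "(real^2) set \<Rightarrow> (real^2 \<Rightarrow> real) \<Rightarrow> (real^2) measure" where
  "target_measure Y g = density lborel (\<lambda>y. ennreal (g y * indicator Y y))"

text \<open>The gradient only needs to exist almost everywhere for the source measure, so that the value
  \<open>0\<close> chosen by \<^const>\<open>gradient\<close> elsewhere is irrelevant. Measurability is required explicitly
  because \<^const>\<open>distr\<close> is only meaningful for measurable maps.\<close>

definition minimal_brenier ::
    "(real^2) measure \<Rightarrow> (real^2) measure \<Rightarrow> (real^2) set \<Rightarrow> (real^2 \<Rightarrow> ereal) \<Rightarrow> bool" where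
  "minimal_brenier \<mu> \<nu> Y u \<longleftrightarrow>
     convex_lsc u \<and>
     (AE x in \<mu>. \<exists>p. has_gradient u x p) \<and>
     gradient u \<in> measurable \<mu> borel \<and>
     distr \<mu> borel (gradient u) = \<nu> \<and>
     (\<Union>x. subdifferential u x) = closure Y"


section \<open>Grid and directions\<close>

definition of_int_vec :: "int^2 \<Rightarrow> real^2" where
  "of_int_vec e = (\<chi> i. of_int (e $ i))"

definition grid :: "real \<Rightarrow> (real^2) set" where
  "grid h = range (\<lambda>e. h *\<^sub>R of_int_vec e)"

definition square :: "(real^2) set" where
  "square = cbox (vec (- 1)) (vec 1)"

definition irreducible_vec :: "int^2 \<Rightarrow> bool" where
  "irreducible_vec e \<longleftrightarrow> coprime (e $ 1) (e $ 2)"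

definition outer_polygon :: "(real^2) set \<Rightarrow> (int^2) set \<Rightarrow> (real^2) set" where
  "outer_polygon Y V = {y. \<forall>e\<in>V. y \<bullet> of_int_vec e \<le> support_fun Y (of_int_vec e)}"


section \<open>The scheme\<close>

text \<open>A grid function is an element of \<open>grid h \<inter> square \<rightarrow>\<^sub>E UNIV\<close>; all operators below are only
  evaluated where they use values of it on \<open>grid h \<inter> square\<close>. The sets under \<^const>\<open>Min\<close> and
  \<^const>\<open>Max\<close> are finite, because \<^const>\<open>square\<close> is bounded.\<close>

definition delta :: "real \<Rightarrow> int^2 \<Rightarrow> (real^2 \<Rightarrow> real) \<Rightarrow> real^2 \<Rightarrow> real" where
  "delta h e U x = U (x + h *\<^sub>R of_int_vec e) - U x"

definition Delta :: "real \<Rightarrow> int^2 \<Rightarrow> (real^2 \<Rightarrow> real) \<Rightarrow> real^2 \<Rightarrow> real" where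
  "Delta h e U x = delta h e U x + delta h (- e) U x"

definition Delta_plus :: "real \<Rightarrow> int^2 \<Rightarrow> (real^2 \<Rightarrow> real) \<Rightarrow> real^2 \<Rightarrow> real" where
  "Delta_plus h e U x = max (Delta h e U x) 0"

definition superbase :: "int^2 \<Rightarrow> int^2 \<Rightarrow> int^2 \<Rightarrow> bool" where
  "superbase e e' e'' \<longleftrightarrow> e + e' + e'' = 0 \<and> \<bar>det (vector [e', e''] :: int^2^2)\<bar> = 1"

definition in_stencil :: "real \<Rightarrow> real^2 \<Rightarrow> int^2 \<Rightarrow> bool" where
  "in_stencil h x e \<longleftrightarrow> x + h *\<^sub>R of_int_vec e \<in> square \<and> x - h *\<^sub>R of_int_vec e \<in> square"

definition H :: "real \<Rightarrow> real \<Rightarrow> real \<Rightarrow> real" where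
  "H a b c =
     (if a \<ge> b + c then b * c
      else if b \<ge> a + c then a * c
      else if c \<ge> a + b then a * b
      else (a * b + b * c + c * a) / 2 - (a\<^sup>2 + b\<^sup>2 + c\<^sup>2) / 4)"

definition MA :: "real \<Rightarrow> (real^2 \<Rightarrow> real) \<Rightarrow> real^2 \<Rightarrow> real" where
  "MA h U x = 1 / h ^ 4 *
     Min {H (Delta_plus h e U x) (Delta_plus h e' U x) (Delta_plus h e'' U x) | e e' e''.
            superbase e e' e'' \<and> in_stencil h x e \<and> in_stencil h x e' \<and> in_stencil h x e''}"

definition delta_ext ::
    "(real^2) set \<Rightarrow> real \<Rightarrow> int^2 \<Rightarrow> (real^2 \<Rightarrow> real) \<Rightarrow> real^2 \<Rightarrow> real" where
  "delta_ext Y h e U x =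
     (if x + h *\<^sub>R of_int_vec e \<in> square then U (x + h *\<^sub>R of_int_vec e) - U x
      else support_fun Y (h *\<^sub>R of_int_vec e))"

definition Delta_ext ::
    "(real^2) set \<Rightarrow> real \<Rightarrow> int^2 \<Rightarrow> (real^2 \<Rightarrow> real) \<Rightarrow> real^2 \<Rightarrow> real" where
  "Delta_ext Y h e U x = delta_ext Y h e U x + delta_ext Y h (- e) U x"

definition MA0 ::
    "(real^2) set \<Rightarrow> (int^2) set \<Rightarrow> real \<Rightarrow> (real^2 \<Rightarrow> real) \<Rightarrow> real^2 \<Rightarrow> real" where
  "MA0 Y V h U x =
     Min ((\<lambda>e. Delta_ext Y h e U x) ` ({e. e \<noteq> 0 \<and> irreducible_vec e \<and> in_stencil h x e} \<union> V))"

definition cell_average :: "real \<Rightarrow> (real^2 \<Rightarrow> real) \<Rightarrow> real^2 \<Rightarrow> real" where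
  "cell_average h f x =
     (LINT t : cbox (vec (- h / 2)) (vec (h / 2)) | lebesgue. f (x + t)) / h\<^sup>2"

text \<open>The argument \<open>G\<close> is the discrete gradient.\<close>

definition scheme_solution ::
    "(real^2) set \<Rightarrow> (real^2 \<Rightarrow> real) \<Rightarrow> (real^2) set \<Rightarrow> (real^2 \<Rightarrow> real) \<Rightarrow> real \<Rightarrow> (int^2) set \<Rightarrow>
     ((real^2 \<Rightarrow> real) \<Rightarrow> real^2 \<Rightarrow> real^2) \<Rightarrow> (real^2 \<Rightarrow> real) \<Rightarrow> bool" where
  "scheme_solution X f Y g h V G U \<longleftrightarrow>
     U \<in> grid h \<inter> square \<rightarrow>\<^sub>E UNIV \<and>
     (\<forall>x\<in>grid h \<inter> X. MA h U x = cell_average h f x / g (G U x)) \<and>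
     (\<forall>x\<in>grid h \<inter> (square - X). MA0 Y V h U x = 0) \<and>
     U 0 = 0"


section \<open>The convex function associated with a grid function\<close>

definition grid_conjugate :: "real \<Rightarrow> (real^2 \<Rightarrow> real) \<Rightarrow> real^2 \<Rightarrow> real" where
  "grid_conjugate h U y = Max ((\<lambda>x. y \<bullet> x - U x) ` (grid h \<inter> square))"

definition convex_extension ::
    "(real^2) set \<Rightarrow> (int^2) set \<Rightarrow> real \<Rightarrow> (real^2 \<Rightarrow> real) \<Rightarrow> real^2 \<Rightarrow> real" where
  "convex_extension Y V h U x = (SUP y\<in>outer_polygon Y V. x \<bullet> y - grid_conjugate h U y)"

end

theory Submission
  imports Defs "HOL-Complex_Analysis.Great_Picard"
begin

text \<open>
  Write \<open>U\<^sup>*\<close> for the grid conjugate of \<open>U\<close>. For a grid node \<open>x\<close> let \<open>A x\<close> be the set of all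
  \<open>y\<close> in the closure of \<open>Y\<close> for which the maximum in \<open>U\<^sup>* y\<close> is attained at \<open>x\<close>; this is the contact
  cell below. The contact cells cover the closure of \<open>Y\<close> and consist of subgradients of \<open>u\<close> at \<open>x\<close>,
  and the scheme bounds the mass of each one. At a node in \<open>X\<close> every superbase encloses \<open>A x\<close> in
  three strips, whose intersection is a hexagon of area at most \<open>H / h\<^sup>2\<close>
  (\<open>measure_superbase_cell\<close>); the equation for the minimum over the superbases and the consistency
  of the discrete gradient then give \<open>\<nu> (A x) \<le> (1 + \<epsilon>) * \<mu> Q\<close>, where \<open>Q\<close> is the open grid square
  around \<open>x\<close>. At the other nodes the boundary equation places \<open>A x\<close> on a line, which is null.
  Summation yields \<open>\<nu> C \<le> (1 + \<epsilon>) * \<mu> (\<dots>)\<close> for every closed \<open>C\<close>, the argument being the union of the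
  grid squares around the nodes whose contact cell meets \<open>C\<close> (\<open>target_le_source\<close>).

  This one-sided estimate is all that the limit requires, because both measures have mass \<open>1\<close>. It
  passes to every pointwise limit \<open>w\<close> of the functions \<open>u\<close> and becomes
  \<open>\<nu> C \<le> \<mu> {x. \<partial>w x \<inter> C \<noteq> {}}\<close>. A convex function is differentiable almost everywhere
  (\<open>AE_subgrads_single\<close>), so the right-hand side is the mass of \<open>C\<close> under the image measure of \<open>\<mu>\<close>
  by \<open>\<nabla>w\<close>. Two probability measures that are ordered on compact sets agree
  (\<open>measure_eq_if_le_on_compact\<close>), and therefore \<open>\<nabla>w\<close> transports \<open>\<mu>\<close> to \<open>\<nu>\<close>. The range of \<open>\<partial>w\<close> is
  the closure of \<open>Y\<close>: every \<open>y\<close> in this closure is a subgradient of \<open>u\<close> at some point of the compact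
  square, and conversely the growth of \<open>w\<close> in each of the directions \<open>e\<close> is at most the support function.

  Limits exist along subsequences, because all slopes lie in one ball and \<open>u 0\<close> tends to \<open>0\<close>. For the
  latter, the equations make \<open>U\<close> Lipschitz along the axes; if there were no contact node near the
  origin, then the mass of \<open>\<mu>\<close> there would be missing from the estimate for \<open>C = UNIV\<close>.

  The whole sequence converges because the minimal Brenier solution is unique
  (\<open>minimal_brenier_unique\<close>). Kantorovich duality shows that two solutions share a subgradient
  almost everywhere. Transport to \<open>\<nu>\<close> makes the shared slopes dense in \<open>Y\<close>, and closedness extends
  them to all of \<open>Y\<close>. Since \<open>Y\<close> is convex, any two slopes are joined by a segment of shared slopes,
  along which the difference of the two functions telescopes to a constant. It is the convexity of
  \<open>Y\<close> that matters here: \<open>X\<close> may be disconnected.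
\<close>

section \<open>Subgradients\<close>

definition subgrads :: "('a::euclidean_space \<Rightarrow> real) \<Rightarrow> 'a \<Rightarrow> 'a set" where
  "subgrads u x = {y. \<forall>z. u x + y \<bullet> (z - x) \<le> u z}"

text \<open>This is how finite convex functions enter below. A real function with a subgradient at every point
  is convex, and a bound \<open>K\<close> on the subgradients makes it Lipschitz.\<close>

definition has_slopes_in :: "('a::euclidean_space \<Rightarrow> real) \<Rightarrow> 'a set \<Rightarrow> bool" where
  "has_slopes_in u K \<longleftrightarrow> (\<forall>x. subgrads u x \<noteq> {} \<and> subgrads u x \<subseteq> K)"

lemma subdifferential_ereal: "subdifferential (\<lambda>z. ereal (u z)) x = subgrads u x"
  by (simp add: subdifferential_def subgrads_def)

lemma subgradsD: "y \<in> subgrads u x \<Longrightarrow> u x + y \<bullet> (z - x) \<le> u z"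
  by (simp add: subgrads_def)

lemma subgrads_monotone:
  assumes "p \<in> subgrads u x" "q \<in> subgrads u z"
  shows "0 \<le> (p - q) \<bullet> (x - z)"
  using subgradsD[OF assms(1), of z] subgradsD[OF assms(2), of x]
  by (simp add: algebra_simps)

lemma subgrads_limit:
  fixes w :: "'a::euclidean_space \<Rightarrow> real"
  assumes lim: "\<And>z. (\<lambda>n. u n z) \<longlonglongrightarrow> w z"
    and lip: "\<And>n x z. \<bar>u n x - u n z\<bar> \<le> R * norm (x - z)"
    and xs: "xs \<longlonglongrightarrow> x" and ys: "ys \<longlonglongrightarrow> y"
    and sub: "\<And>n. ys n \<in> subgrads (u n) (xs n)"
  shows "y \<in> subgrads w x"
proof -
  have "(\<lambda>n. u n (xs n) - u n x) \<longlonglongrightarrow> 0"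
  proof (rule Lim_null_comparison)
    show "\<forall>\<^sub>F n in sequentially. norm (u n (xs n) - u n x) \<le> R * norm (xs n - x)"
      using lip by simp
    show "(\<lambda>n. R * norm (xs n - x)) \<longlonglongrightarrow> 0"
      using xs by (intro tendsto_mult_right_zero tendsto_norm_zero) (simp add: LIM_zero_iff)
  qed
  from tendsto_add[OF this lim[of x]] have ux: "(\<lambda>n. u n (xs n)) \<longlonglongrightarrow> w x" by simp
  show ?thesis
    unfolding subgrads_def
  proof (intro CollectI allI)
    fix z
    have "(\<lambda>n. u n (xs n) + ys n \<bullet> (z - xs n)) \<longlonglongrightarrow> w x + y \<bullet> (z - x)"
      by (intro tendsto_intros ux ys xs)
    from LIMSEQ_le[OF this lim[of z]] subgradsD[OF sub] show "w x + y \<bullet> (z - x) \<le> w z"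
      by blast
  qed
qed

lemma has_slopes_in_lipschitz:
  assumes "has_slopes_in u K" "K \<subseteq> cball 0 R"
  shows "\<bar>u x - u z\<bar> \<le> R * norm (x - z)"
proof -
  have *: "u a - u b \<le> R * norm (a - b)" for a b
  proof -
    obtain p where p: "p \<in> subgrads u a" "norm p \<le> R"
      using assms unfolding has_slopes_in_def by (metis equals0I mem_cball_0 subsetD)
    have "u a - u b \<le> p \<bullet> (a - b)"
      using subgradsD[OF p(1), of b] by (simp add: algebra_simps)
    also have "\<dots> \<le> norm p * norm (a - b)" by (rule norm_cauchy_schwarz)
    also have "\<dots> \<le> R * norm (a - b)" by (intro mult_right_mono p(2)) simp
    finally show ?thesis .
  qed
  show ?thesis using *[of x z] *[of z x] by (simp add: norm_minus_commute)
qed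

lemma compact_norm_bound:
  assumes "compact (K :: 'a::real_normed_vector set)"
  obtains R where "K \<subseteq> cball 0 R" "R > 0"
proof -
  from compact_imp_bounded[OF assms] obtain R where "R > 0" "\<forall>x\<in>K. norm x \<le> R"
    using bounded_pos by blast
  then have "K \<subseteq> cball 0 R" by auto
  then show thesis using that \<open>R > 0\<close> by blast
qed

lemma has_slopes_in_continuous:
  assumes "has_slopes_in u K" "compact K"
  shows "continuous_on A u"
proof -
  obtain R where R: "K \<subseteq> cball 0 R" "R > 0" by (rule compact_norm_bound[OF assms(2)])
  have "R-lipschitz_on A u"
    using has_slopes_in_lipschitz[OF assms(1) R(1)] R(2)
    by (intro lipschitz_onI) (auto simp: dist_norm)
  then show ?thesis by (rule lipschitz_on_continuous_on)
qed

lemma subgrads_closed_graph: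
  assumes u: "has_slopes_in u K" "compact K"
    and "xs \<longlonglongrightarrow> x" "ys \<longlonglongrightarrow> y" "\<And>n. ys n \<in> subgrads u (xs n)"
  shows "y \<in> subgrads u x"
proof -
  obtain R where R: "K \<subseteq> cball 0 R" "R > 0" by (rule compact_norm_bound[OF assms(2)])
  show ?thesis
    by (rule subgrads_limit[of "\<lambda>_. u" u R xs x ys y])
       (use assms has_slopes_in_lipschitz[OF u(1) R(1)] in auto)
qed

text \<open>Bounded slopes let subgradients at convergent points accumulate, so a closed condition on pairs of
  subgradients defines a closed set of points. With a condition on one subgradient this gives the
  preimage of a closed set of slopes; with \<open>(p - q) \<bullet> b \<ge> c\<close> it gives the points where the slope
  jumps by \<open>c\<close> in direction \<open>b\<close>.\<close>

lemma closed_subgrads_relation: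
  assumes u: "has_slopes_in u K" "compact K" and P: "closed {(p, q). P p q}"
  shows "closed {x. \<exists>p\<in>subgrads u x. \<exists>q\<in>subgrads u x. P p q}"
  unfolding closed_sequential_limits
proof (intro allI impI, elim conjE)
  fix xs x
  assume "\<forall>n. xs n \<in> {x. \<exists>p\<in>subgrads u x. \<exists>q\<in>subgrads u x. P p q}" and xs: "xs \<longlonglongrightarrow> x"
  then obtain p q where pq: "\<And>n. p n \<in> subgrads u (xs n)" "\<And>n. q n \<in> subgrads u (xs n)"
      "\<And>n. P (p n) (q n)"
    by (simp add: Bex_def) metis
  have in_K: "(p n, q n) \<in> K \<times> K" for n
    using u(1) pq unfolding has_slopes_in_def by blast
  have "seq_compact (K \<times> K)"
    using u(2) by (simp add: compact_Times flip: compact_eq_seq_compact_metric)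
  then obtain l r where l: "strict_mono r" "((\<lambda>n. (p n, q n)) \<circ> r) \<longlonglongrightarrow> l"
    using in_K unfolding seq_compact_def by meson
  have lims: "(p \<circ> r) \<longlonglongrightarrow> fst l" "(q \<circ> r) \<longlonglongrightarrow> snd l"
    using tendsto_fst[OF l(2)] tendsto_snd[OF l(2)] by (simp_all add: o_def)
  have xr: "(xs \<circ> r) \<longlonglongrightarrow> x" using xs l(1) by (rule LIMSEQ_subseq_LIMSEQ)
  have "l \<in> {(p, q). P p q}"
    using P l(2) pq(3) unfolding closed_sequential_limits by (metis (no_types, lifting) case_prodI comp_apply mem_Collect_eq)
  moreover have "fst l \<in> subgrads u x" "snd l \<in> subgrads u x"
    using pq by (auto intro!: subgrads_closed_graph[OF u xr] lims)
  ultimately show "x \<in> {x. \<exists>p\<in>subgrads u x. \<exists>q\<in>subgrads u x. P p q}"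
    by (auto simp: case_prod_beta)
qed

lemma closed_subgrads_hit:
  assumes u: "has_slopes_in u K" "compact K" and C: "closed C"
  shows "closed {x. subgrads u x \<inter> C \<noteq> {}}"
proof -
  have "{(p, q :: 'a). p \<in> C} = C \<times> UNIV" by auto
  then have "closed {(p, q :: 'a). p \<in> C}" using C by (simp add: closed_Times)
  from closed_subgrads_relation[OF u this]
  have "closed {x. \<exists>p\<in>subgrads u x. \<exists>q\<in>subgrads u x. p \<in> C}" .
  also have "{x. \<exists>p\<in>subgrads u x. \<exists>q\<in>subgrads u x. p \<in> C} = {x. subgrads u x \<inter> C \<noteq> {}}"
    by auto
  finally show ?thesis .
qed

lemma gderiv_imp_subgrads_eq:
  assumes "GDERIV u x :> p" "y \<in> subgrads u x"
  shows "y = p"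
proof -
  have "((\<lambda>z. u z - y \<bullet> z) has_derivative (\<lambda>h. h \<bullet> p - y \<bullet> h)) (at x)"
    using assms(1) unfolding gderiv_def by (auto intro!: derivative_eq_intros)
  moreover have "u x - y \<bullet> x \<le> u z - y \<bullet> z" for z
    using subgradsD[OF assms(2), of z] by (simp add: algebra_simps)
  ultimately have "(\<lambda>h. h \<bullet> p - y \<bullet> h) = (\<lambda>h. 0)"
    by (intro has_derivative_local_min) auto
  then have "(p - y) \<bullet> (p - y) = 0"
    by (metis inner_commute inner_diff_right)
  then show ?thesis by simp
qed

text \<open>Near a point with the single subgradient \<open>p\<close> all subgradients are close to \<open>p\<close>, by the closedness
  of the subdifferential. They bound the difference quotient from above, and \<open>p\<close> itself bounds it
  from below.\<close>

lemma gderiv_if_subgrads_single: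
  assumes u: "has_slopes_in u K" "compact K" and single: "\<And>q. q \<in> subgrads u x \<Longrightarrow> q = p"
  shows "GDERIV u x :> p"
  unfolding gderiv_def has_derivative_within_alt2
proof (intro conjI allI impI)
  show "bounded_linear (\<lambda>h. h \<bullet> p)" by (rule bounded_linear_inner_left)
  fix e :: real assume e: "e > 0"
  have p: "p \<in> subgrads u x"
    using u(1) single unfolding has_slopes_in_def by blast
  have near: "\<forall>\<^sub>F z in nhds x. \<forall>q\<in>subgrads u z. norm (q - p) < e"
  proof -
    have "closed {x. subgrads u x \<inter> {q. norm (q - p) \<ge> e} \<noteq> {}}"
      by (intro closed_subgrads_hit[OF u] closed_Collect_le continuous_intros)
    moreover have "x \<notin> {x. subgrads u x \<inter> {q. norm (q - p) \<ge> e} \<noteq> {}}"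
      using single e by auto
    ultimately have "\<forall>\<^sub>F z in nhds x. z \<in> - {x. subgrads u x \<inter> {q. norm (q - p) \<ge> e} \<noteq> {}}"
      by (intro eventually_nhds_in_open) auto
    then show ?thesis by eventually_elim force
  qed
  have "norm (u z - u x - (z - x) \<bullet> p) \<le> e * norm (z - x)" if z: "\<forall>q\<in>subgrads u z. norm (q - p) < e" for z
  proof -
    obtain q where q: "q \<in> subgrads u z" using u(1) unfolding has_slopes_in_def by blast
    have "u z - u x - (z - x) \<bullet> p \<le> (q - p) \<bullet> (z - x)"
      using subgradsD[OF q, of x] by (simp add: algebra_simps inner_commute)
    also have "\<dots> \<le> norm (q - p) * norm (z - x)" by (rule norm_cauchy_schwarz)
    also have "\<dots> \<le> e * norm (z - x)"
      using z q by (intro mult_right_mono) (auto intro: less_imp_le)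
    finally have "u z - u x - (z - x) \<bullet> p \<le> e * norm (z - x)" .
    moreover have "0 \<le> u z - u x - (z - x) \<bullet> p"
      using subgradsD[OF p, of z] by (simp add: algebra_simps inner_commute)
    ultimately show ?thesis by simp
  qed
  with near have "\<forall>\<^sub>F z in nhds x. norm (u z - u x - (z - x) \<bullet> p) \<le> e * norm (z - x)"
    by (rule eventually_mono)
  then show "\<forall>\<^sub>F y in at x. norm (u y - u x - (y - x) \<bullet> p) \<le> e * norm (y - x)"
    unfolding eventually_at_filter by eventually_elim simp
qed

section \<open>Almost everywhere differentiability\<close>

text \<open>All translates \<open>E - t *\<^sub>R b\<close> have the measure of \<open>E\<close>. Averaging over \<open>t \<in> {0..1}\<close> and exchanging
  the integrals leaves the lengths of the intersections with lines, which vanish.\<close>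

lemma null_if_countable_on_lines:
  fixes E :: "'a::euclidean_space set"
  assumes E: "E \<in> sets borel" and lines: "\<And>x. countable {t. x + t *\<^sub>R b \<in> E}"
  shows "E \<in> null_sets lborel"
proof -
  define I :: "real set" where "I = {0..1}"
  let ?f = "\<lambda>t x. indicator I t * indicator E (x + t *\<^sub>R b) :: ennreal"
  have shift: "(\<integral>\<^sup>+x. indicator E (x + t *\<^sub>R b) \<partial>lborel) = emeasure lborel E" for t
  proof -
    have "emeasure lborel E = (\<integral>\<^sup>+x. indicator E x \<partial>distr lborel borel ((+) (t *\<^sub>R b)))"
      using E by (simp add: lborel_distr_plus)
    also have "\<dots> = (\<integral>\<^sup>+x. indicator E (x + t *\<^sub>R b) \<partial>lborel)"
      using E by (subst nn_integral_distr) (auto simp: add.commute)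
    finally show ?thesis ..
  qed
  have "emeasure lborel E = (\<integral>\<^sup>+t. indicator I t * emeasure lborel E \<partial>lborel)"
    by (simp add: nn_integral_multc I_def)
  also have "\<dots> = (\<integral>\<^sup>+t. \<integral>\<^sup>+x. ?f t x \<partial>lborel \<partial>lborel)"
    using E by (subst nn_integral_cmult) (auto simp: shift)
  also have "\<dots> = (\<integral>\<^sup>+x. \<integral>\<^sup>+t. ?f t x \<partial>lborel \<partial>lborel)"
  proof (rule lborel_pair.Fubini')
    show "(\<lambda>(x, t). ?f t x) \<in> borel_measurable (lborel \<Otimes>\<^sub>M lborel)"
      using E unfolding I_def by measurable
  qed
  also have "\<dots> = (\<integral>\<^sup>+x. 0 \<partial>(lborel :: 'a measure))"
  proof (intro nn_integral_cong)
    fix x :: 'a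
    have "AE t in lborel. t \<notin> {t. x + t *\<^sub>R b \<in> E}"
      using countable_imp_null_set_lborel[OF lines[of x]] by (rule AE_not_in)
    then have "(\<integral>\<^sup>+t. ?f t x \<partial>lborel) = (\<integral>\<^sup>+t. 0 \<partial>(lborel :: real measure))"
      by (intro nn_integral_cong_AE) (rule eventually_mono, auto)
    then show "(\<integral>\<^sup>+t. ?f t x \<partial>lborel) = 0" by simp
  qed
  finally show ?thesis using E by (auto intro: null_setsI)
qed


text \<open>Slopes increase along a line, so the intervals of slopes at different points have disjoint interiors,
  and each interval of positive length contains a rational number in its interior.\<close>

lemma countable_slope_jumps:
  fixes u :: "'a::euclidean_space \<Rightarrow> real"
  assumes c: "c > 0"
  shows "countable {t. x + t *\<^sub>R b \<in> {z. \<exists>p\<in>subgrads u z. \<exists>q\<in>subgrads u z. c \<le> (p - q) \<bullet> b}}"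
proof -
  define T where "T = {t. x + t *\<^sub>R b \<in> {z. \<exists>p\<in>subgrads u z. \<exists>q\<in>subgrads u z. c \<le> (p - q) \<bullet> b}}"
  have "\<exists>p q r. p \<in> subgrads u (x + t *\<^sub>R b) \<and> q \<in> subgrads u (x + t *\<^sub>R b) \<and>
          r \<in> \<rat> \<and> q \<bullet> b < r \<and> r < p \<bullet> b" if t: "t \<in> T" for t
  proof -
    obtain p q where pq: "p \<in> subgrads u (x + t *\<^sub>R b)" "q \<in> subgrads u (x + t *\<^sub>R b)"
        "c \<le> (p - q) \<bullet> b" using t unfolding T_def by blast
    then have "q \<bullet> b < p \<bullet> b" using c by (simp add: inner_diff_left)
    then obtain r where "r \<in> \<rat>" "q \<bullet> b < r" "r < p \<bullet> b" using Rats_dense_in_real by blast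
    with pq(1,2) show ?thesis by blast
  qed
  then obtain p q r where p: "\<And>t. t \<in> T \<Longrightarrow> p t \<in> subgrads u (x + t *\<^sub>R b)"
      and q: "\<And>t. t \<in> T \<Longrightarrow> q t \<in> subgrads u (x + t *\<^sub>R b)"
      and r: "\<And>t. t \<in> T \<Longrightarrow> r t \<in> \<rat> \<and> q t \<bullet> b < r t \<and> r t < p t \<bullet> b"
    by metis
  have less: "r s < r t" if st: "s \<in> T" "t \<in> T" "s < t" for s t
  proof -
    have "0 \<le> (q t - p s) \<bullet> ((x + t *\<^sub>R b) - (x + s *\<^sub>R b))"
      by (rule subgrads_monotone[OF q[OF st(2)] p[OF st(1)]])
    also have "\<dots> = (t - s) * ((q t - p s) \<bullet> b)"
      by (simp add: algebra_simps)
    finally have "0 \<le> (q t - p s) \<bullet> b"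
      using st by (simp add: zero_le_mult_iff)
    then have "p s \<bullet> b \<le> q t \<bullet> b" by (simp add: inner_diff_left)
    with r[OF st(1)] r[OF st(2)] show ?thesis by linarith
  qed
  have "inj_on r T"
    by (rule linorder_inj_onI') (metis less less_irrefl)
  moreover have "countable (r ` T)"
    by (rule countable_subset[OF _ countable_rat]) (use r in blast)
  ultimately show ?thesis unfolding T_def[symmetric] by (rule countable_image_inj_on[rotated])
qed

text \<open>Two different subgradients differ in some coordinate by at least \<open>1 / Suc k\<close> for some \<open>k\<close>; this leaves countably
  many closed sets, each of which meets lines in a coordinate direction in countable sets.\<close>

lemma AE_subgrads_single:
  fixes u :: "'a::euclidean_space \<Rightarrow> real"
  assumes u: "has_slopes_in u K" "compact K"
  shows "AE x in lborel. \<exists>p. subgrads u x = {p}"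
proof -
  define E where "E b k = {x. \<exists>p\<in>subgrads u x. \<exists>q\<in>subgrads u x. 1 / Suc k \<le> (p - q) \<bullet> b}"
    for b :: 'a and k :: nat
  have "\<And>b k. E b k \<in> null_sets lborel"
  proof (rule null_if_countable_on_lines)
    fix b :: 'a and k :: nat
    have "closed {(p, q). 1 / Suc k \<le> (p - q) \<bullet> b}"
      unfolding case_prod_beta by (intro closed_Collect_le continuous_intros)
    then have "closed (E b k)"
      unfolding E_def by (rule closed_subgrads_relation[OF u])
    then show "E b k \<in> sets borel" by simp
    show "countable {t. x + t *\<^sub>R b \<in> E b k}" for x
      unfolding E_def by (rule countable_slope_jumps) simp
  qed
  then have "(\<Union>k. E b k) \<in> null_sets lborel" for b
    by (rule null_sets_UN)
  then have "(\<Union>b\<in>Basis. \<Union>k. E b k) \<in> null_sets lborel"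
    by (rule null_sets_UN'[OF countable_finite[OF finite_Basis]])
  then have "AE x in lborel. x \<notin> (\<Union>b\<in>Basis. \<Union>k. E b k)"
    by (rule AE_not_in)
  then show ?thesis
  proof eventually_elim
    case (elim x)
    obtain p where p: "p \<in> subgrads u x" using u(1) unfolding has_slopes_in_def by blast
    have "q = p" if q: "q \<in> subgrads u x" for q
    proof -
      have le: "(p' - q') \<bullet> b \<le> 0" if "b \<in> Basis" "p' \<in> subgrads u x" "q' \<in> subgrads u x" for p' q' b
      proof (rule ccontr)
        assume "\<not> (p' - q') \<bullet> b \<le> 0"
        then have "0 < (p' - q') \<bullet> b" by simp
        then obtain k :: nat where "1 / Suc k < (p' - q') \<bullet> b"
          by (rule nat_approx_posE)
        then have "1 / Suc k \<le> (p' - q') \<bullet> b" by (rule less_imp_le)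
        with that(2,3) have "x \<in> E b k" unfolding E_def by (intro CollectI bexI)
        with that(1) elim show False by (metis UN_I UNIV_I)
      qed
      show ?thesis
      proof (rule euclidean_eqI)
        fix b :: 'a assume b: "b \<in> Basis"
        show "q \<bullet> b = p \<bullet> b" using le[OF b p q] le[OF b q p] by (simp add: inner_diff_left)
      qed
    qed
    with p show ?case by blast
  qed
qed

lemma has_gradient_ereal: "has_gradient (\<lambda>z. ereal (u z)) x p \<longleftrightarrow> (GDERIV u x :> p)"
  by (simp add: has_gradient_def)

lemma gradient_eq:
  assumes u: "has_slopes_in u K" and p: "has_gradient (\<lambda>z. ereal (u z)) x p"
  shows "gradient (\<lambda>z. ereal (u z)) x = p" "subgrads u x = {p}"
proof -
  show sub: "subgrads u x = {p}"
    using u p gderiv_imp_subgrads_eq[of u x p] unfolding has_slopes_in_def has_gradient_ereal by blast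
  have "q = p" if "has_gradient (\<lambda>z. ereal (u z)) x q" for q
    using that gderiv_imp_subgrads_eq[of u x q] sub unfolding has_gradient_ereal by blast
  then show "gradient (\<lambda>z. ereal (u z)) x = p"
    using p unfolding gradient_def by (metis (mono_tags, lifting) the_equality)
qed

lemma AE_has_gradient:
  assumes u: "has_slopes_in u K" "compact K"
  shows "AE x in lebesgue. \<exists>p. has_gradient (\<lambda>z. ereal (u z)) x p"
proof -
  have "AE x in lborel. \<exists>p. has_gradient (\<lambda>z. ereal (u z)) x p"
    using AE_subgrads_single[OF u]
    by eventually_elim (auto simp: has_gradient_ereal intro!: gderiv_if_subgrads_single[OF u])
  then show ?thesis by (rule AE_completion)
qed

text \<open>The measurability is only with respect to Lebesgue sets: off the negligible set where there is no
  gradient, the preimage of a closed set agrees with a closed set, while on that set the default value of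
  \<^const>\<open>gradient\<close> is harmless.\<close>

lemma gradient_borel_measurable:
  assumes u: "has_slopes_in u K" "compact K"
  shows "gradient (\<lambda>z. ereal (u z)) \<in> borel_measurable lebesgue"
  unfolding borel_eq_closed
proof (rule measurable_measure_of)
  let ?G = "gradient (\<lambda>z. ereal (u z))"
  let ?D = "{x. \<exists>p. has_gradient (\<lambda>z. ereal (u z)) x p}"
  fix C :: "(real^2) set" assume "C \<in> Collect closed"
  then have C: "closed C" by simp
  obtain N where N: "negligible N" "{x. \<not> (\<exists>p. has_gradient (\<lambda>z. ereal (u z)) x p)} \<subseteq> N"
    using AE_has_gradient[OF u] unfolding eventually_ae_filter_negligible by blast
  have neg: "negligible (- ?D)"
    by (rule negligible_subset[OF N(1)]) (use N(2) in auto)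
  have D: "?D \<in> sets lebesgue"
    using sets.compl_sets[OF negligible_imp_sets[OF neg]] by (simp add: Diff_eq)
  have "?G -` C = ({x. subgrads u x \<inter> C \<noteq> {}} \<inter> ?D) \<union> (?G -` C \<inter> - ?D)"
    using gradient_eq[OF u(1)] by auto
  also have "\<dots> \<in> sets lebesgue"
  proof (rule sets.Un, rule sets.Int[OF _ D])
    show "{x. subgrads u x \<inter> C \<noteq> {}} \<in> sets lebesgue"
      using closed_subgrads_hit[OF u C] by auto
    have "?G -` C \<inter> - ?D \<in> sets lebesgue"
      by (intro negligible_imp_sets negligible_subset[OF neg]) auto
    then show "?G -` C \<inter> - ?D \<in> sets lebesgue" .
  qed
  finally show "?G -` C \<inter> space lebesgue \<in> sets lebesgue" by simp
qed auto

section \<open>Measures ordered on compact sets\<close>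

text \<open>Inner regularity extends the inequality to Borel sets, and equal masses reverse it on complements.\<close>

lemma measure_eq_if_le_on_compact:
  fixes M N :: "'a::euclidean_space measure"
  assumes sets: "sets M = sets borel" "sets N = sets borel"
    and fin: "finite_measure M" "finite_measure N" and mass: "measure M UNIV = measure N UNIV"
    and le: "\<And>C. compact C \<Longrightarrow> measure M C \<le> measure N C"
  shows "M = N"
proof -
  interpret M: finite_measure M by (rule fin)
  interpret N: finite_measure N by (rule fin)
  have space: "space M = UNIV" "space N = UNIV"
    using sets_eq_imp_space_eq[OF sets(1)] sets_eq_imp_space_eq[OF sets(2)] by simp_all
  have le_borel: "measure M B \<le> measure N B" if B: "B \<in> sets borel" for B
  proof -
    have "emeasure M B = (SUP K\<in>{K. K \<subseteq> B \<and> compact K}. emeasure M K)"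
      by (rule inner_regular[OF sets(1) _ B]) simp
    also have "\<dots> \<le> emeasure N B"
    proof (intro SUP_least, clarify)
      fix K assume K: "K \<subseteq> B" "compact K"
      have "emeasure M K \<le> emeasure N K"
        using le[OF K(2)] by (simp add: M.emeasure_eq_measure N.emeasure_eq_measure)
      also have "\<dots> \<le> emeasure N B" using K B sets(2) by (intro emeasure_mono) auto
      finally show "emeasure M K \<le> emeasure N B" .
    qed
    finally show ?thesis by (simp add: M.emeasure_eq_measure N.emeasure_eq_measure)
  qed
  show ?thesis
  proof (rule measure_eqI)
    show "sets M = sets N" using sets by simp
    fix B assume "B \<in> sets M"
    then have B: "B \<in> sets borel" using sets(1) by auto
    have "measure M UNIV - measure M B \<le> measure N UNIV - measure N B"
      using le_borel[of "UNIV - B"] B sets M.finite_measure_compl[of B] N.finite_measure_compl[of B]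
      by (simp add: space sets.compl_sets[of B borel, simplified])
    then show "emeasure M B = emeasure N B"
      using mass le_borel[OF B] by (simp add: M.emeasure_eq_measure N.emeasure_eq_measure)
  qed
qed

section \<open>Finiteness of minimal Brenier solutions\<close>

lemma nonneg_if_affine_nonneg_near_0:
  fixes c d :: real
  assumes "\<And>t. 0 < t \<Longrightarrow> t \<le> 1 \<Longrightarrow> 0 \<le> c + t * d"
  shows "0 \<le> c"
proof (rule tendsto_lowerbound)
  have "((\<lambda>t. c + t * d) \<longlongrightarrow> c + 0 * d) (at_right 0)" by (intro tendsto_intros)
  then show "((\<lambda>t. c + t * d) \<longlongrightarrow> c) (at_right 0)" by simp
  have "\<forall>\<^sub>F t :: real in at_right 0. t \<in> {0<..<1}" by (rule eventually_at_right_real) simp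
  then show "\<forall>\<^sub>F t in at_right 0. 0 \<le> c + t * d" by eventually_elim (use assms in auto)
qed simp

lemma convex_lsc_closed_epigraph:
  assumes "convex_lsc v"
  shows "closed {(x, r :: real). v x \<le> ereal r}"
proof -
  have "open (- {(x, r :: real). v x \<le> ereal r})"
    unfolding open_prod_def
  proof
    fix p assume "p \<in> - {(x, r :: real). v x \<le> ereal r}"
    moreover obtain x r where p: "p = (x, r)" by (cases p)
    ultimately have "\<not> v x \<le> ereal r" by simp
    then obtain c where c: "ereal r < c" "c < v x" using dense[of "ereal r" "v x"] by (auto simp: not_le)
    then obtain c' where c': "c = ereal c'" by (cases c) auto
    have "c < Liminf (at x) v" using assms c(2) unfolding convex_lsc_def by (meson less_le_trans)
    from less_LiminfD[OF this] c(2) have "\<forall>\<^sub>F z in nhds x. c < v z"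
      by (auto simp: eventually_at_filter elim: eventually_mono)
    then obtain A where A: "open A" "x \<in> A" "\<And>z. z \<in> A \<Longrightarrow> c < v z"
      unfolding eventually_nhds by blast
    show "\<exists>A B. open A \<and> open B \<and> p \<in> A \<times> B \<and> A \<times> B \<subseteq> - {(x, r). v x \<le> ereal r}"
    proof (rule exI[of _ A], rule exI[of _ "{..<c'}"], intro conjI)
      show "A \<times> {..<c'} \<subseteq> - {(x, r). v x \<le> ereal r}"
      proof (clarify)
        fix z s assume "z \<in> A" "s < c'" "v z \<le> ereal s"
        then have "c < ereal s" using A(3)[of z] by (meson less_le_trans)
        with \<open>s < c'\<close> c' show False by simp
      qed
    qed (use A c c' p in auto)
  qed
  then show ?thesis by (simp add: closed_def)
qed

lemma subdifferential_realE:
  assumes "y \<in> subdifferential v x"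
  obtains a where "v x = ereal a" "\<And>z r. v z \<le> ereal r \<Longrightarrow> a + y \<bullet> (z - x) \<le> r"
proof -
  obtain a where a: "v x = ereal a" using assms unfolding subdifferential_def by auto
  moreover have "a + y \<bullet> (z - x) \<le> r" if "v z \<le> ereal r" for z r
  proof -
    have "ereal a + ereal (y \<bullet> (z - x)) \<le> v z" using assms a unfolding subdifferential_def by auto
    also note that
    finally show ?thesis by simp
  qed
  ultimately show thesis by (rule that)
qed

lemma norm_add_scaleR_squared:
  fixes a b :: "'a::real_inner"
  shows "(norm (a + t *\<^sub>R b))\<^sup>2 = (norm a)\<^sup>2 + 2 * t * (a \<bullet> b) + t\<^sup>2 * (norm b)\<^sup>2"
  unfolding power2_norm_eq_inner power2_eq_square[of t]
  by (simp add: inner_add_left inner_add_right inner_commute algebra_simps)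

text \<open>The point \<open>z\<close> minimises \<open>v z + k / 2 * (norm (z - x))\<^sup>2\<close>. The minimum is taken over the closed
  epigraph, so that values \<open>+\<infinity>\<close> need no separate treatment; the affine minorant from \<open>y0\<close> makes the
  relevant part of the epigraph compact.\<close>

lemma moreau_point:
  assumes v: "convex_lsc v" and y0: "y0 \<in> subdifferential v x0" and k: "k > 0"
  obtains z where "k *\<^sub>R (x - z) \<in> subdifferential v z"
proof -
  define E where "E = {(x, r :: real). v x \<le> ereal r}"
  define J where "J p = snd p + k / 2 * (norm (fst p - x))\<^sup>2" for p :: "(real^2) \<times> real"
  obtain a where a: "v x0 = ereal a" "\<And>z r. v z \<le> ereal r \<Longrightarrow> a + y0 \<bullet> (z - x0) \<le> r"
    by (rule subdifferential_realE[OF y0]) blast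
  define S where "S = {p \<in> E. J p \<le> J (x0, a)}"
  \<comment> \<open>On the sublevel set, \<open>k / 2 * d\<^sup>2 - norm y0 * d \<le> c\<close> for the distance \<open>d\<close> from \<open>x\<close>.\<close>
  define c where "c = J (x0, a) - a + norm y0 * norm (x - x0)"
  define D where "D = max 1 (2 * (norm y0 + \<bar>c\<bar> + 1) / k)"
  define lo where "lo = a - norm y0 * (D + norm (x - x0))"
  have S_bound: "norm (z - x) \<le> D \<and> lo \<le> r \<and> r \<le> J (x0, a)" if "(z, r) \<in> S" for z r
  proof -
    let ?d = "norm (z - x)"
    have r: "a + y0 \<bullet> (z - x0) \<le> r" and J: "r + k / 2 * ?d\<^sup>2 \<le> J (x0, a)"
      using that a(2) unfolding S_def E_def J_def by auto
    have "- (norm y0 * norm (z - x0)) \<le> y0 \<bullet> (z - x0)"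
      using Cauchy_Schwarz_ineq2[of y0 "z - x0"] by (simp add: abs_le_iff)
    moreover have "norm y0 * norm (z - x0) \<le> norm y0 * (?d + norm (x - x0))"
      by (intro mult_left_mono norm_diff_triangle_le[of z x _ x0]) auto
    ultimately have lower: "a - norm y0 * (?d + norm (x - x0)) \<le> r" using r by linarith
    have d: "?d \<le> D"
    proof (rule ccontr)
      assume "\<not> ?d \<le> D"
      then have d: "?d > 1" "?d > 2 * (norm y0 + \<bar>c\<bar> + 1) / k" unfolding D_def by auto
      from d(2) k have "norm y0 + \<bar>c\<bar> + 1 < k / 2 * ?d" by (simp add: field_simps)
      with d(1) have "1 * (\<bar>c\<bar> + 1) < ?d * (k / 2 * ?d - norm y0)"
        by (intro mult_strict_mono) auto
      moreover have "?d * (k / 2 * ?d - norm y0) = k / 2 * ?d\<^sup>2 - norm y0 * ?d"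
        by (simp add: algebra_simps power2_eq_square)
      moreover have "k / 2 * ?d\<^sup>2 - norm y0 * ?d \<le> c"
        using lower J unfolding c_def by (simp add: algebra_simps)
      ultimately have "1 * (\<bar>c\<bar> + 1) < c" by (metis less_le_trans)
      moreover have "c \<le> 1 * (\<bar>c\<bar> + 1)" using abs_ge_self[of c] by simp
      ultimately show False by (metis not_le)
    qed
    have "norm y0 * (?d + norm (x - x0)) \<le> norm y0 * (D + norm (x - x0))"
      using d by (intro mult_left_mono) auto
    moreover have "0 \<le> k / 2 * ?d\<^sup>2" using k by simp
    ultimately show ?thesis using d lower J unfolding lo_def by linarith
  qed
  have "closed E" unfolding E_def by (rule convex_lsc_closed_epigraph[OF v])
  moreover have contJ: "continuous_on A J" for A unfolding J_def by (intro continuous_intros)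
  ultimately have "closed S"
    unfolding S_def using closed_Collect_le[OF contJ continuous_on_const]
    by (simp add: closed_Int Collect_conj_eq)
  moreover have "S \<subseteq> cball x D \<times> {lo..J (x0, a)}"
    using S_bound by (auto simp: dist_norm norm_minus_commute)
  moreover have "compact (cball x D \<times> {lo..J (x0, a)})" by (intro compact_Times) auto
  ultimately have compS: "compact S" using compact_Int_closed[of "cball x D \<times> {lo..J (x0, a)}" S]
    by (simp add: Int_absorb1)
  have x0: "(x0, a) \<in> S" unfolding S_def E_def using a(1) by simp
  then have "S \<noteq> {}" by blast
  then obtain p where p: "p \<in> S" "\<And>q. q \<in> S \<Longrightarrow> J p \<le> J q"
    using continuous_attains_inf[OF compS _ contJ] by blast
  then have pE: "p \<in> E" unfolding S_def by simp
  have min: "J p \<le> J q" if "q \<in> E" for q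
    using p(2)[of q] p(2)[OF x0] that unfolding S_def by (cases "J q \<le> J (x0, a)") auto
  define z r where "z = fst p" and "r = snd p"
  have zr: "p = (z, r)" unfolding z_def r_def by simp
  have vz: "v z = ereal r"
  proof -
    have "v z \<noteq> - \<infinity>" using v unfolding convex_lsc_def by blast
    then obtain b where b: "v z = ereal b" using pE unfolding E_def zr by (cases "v z") auto
    then have "(z, b) \<in> E" "b \<le> r" using pE unfolding E_def zr by auto
    with min[of "(z, b)"] show ?thesis unfolding zr J_def b by simp
  qed
  have "k *\<^sub>R (x - z) \<in> subdifferential v z"
    unfolding subdifferential_def vz
  proof (intro CollectI conjI allI)
    fix z'
    show "ereal r + ereal ((k *\<^sub>R (x - z)) \<bullet> (z' - z)) \<le> v z'"
    proof (cases "v z'")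
      case (real r')
      then have z': "(z', r') \<in> E" unfolding E_def by simp
      have "0 \<le> (r' - r - (k *\<^sub>R (x - z)) \<bullet> (z' - z)) + t * (k / 2 * (norm (z' - z))\<^sup>2)"
        if t: "0 < t" "t \<le> 1" for t
      proof -
        have "(1 - t) *\<^sub>R p + t *\<^sub>R (z', r') \<in> E"
          using v t pE z' unfolding convex_lsc_def E_def by (intro convexD) auto
        then have "(z + t *\<^sub>R (z' - z), r + t * (r' - r)) \<in> E"
          unfolding zr by (simp add: algebra_simps)
        from min[OF this] have "0 \<le> t * (r' - r) + k / 2 * (norm ((z - x) + t *\<^sub>R (z' - z)))\<^sup>2
            - k / 2 * (norm (z - x))\<^sup>2"
          unfolding zr J_def by (simp add: algebra_simps)
        also have "(norm ((z - x) + t *\<^sub>R (z' - z)))\<^sup>2 =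
            (norm (z - x))\<^sup>2 + 2 * t * ((z - x) \<bullet> (z' - z)) + t\<^sup>2 * (norm (z' - z))\<^sup>2"
          by (rule norm_add_scaleR_squared)
        finally have "0 \<le> t * ((r' - r - (k *\<^sub>R (x - z)) \<bullet> (z' - z)) + t * (k / 2 * (norm (z' - z))\<^sup>2))"
          by (simp add: algebra_simps power2_eq_square inner_simps)
        with t(1) show ?thesis by (simp add: zero_le_mult_iff)
      qed
      from nonneg_if_affine_nonneg_near_0[OF this] show ?thesis unfolding real by simp
    qed (use v in \<open>auto simp: convex_lsc_def\<close>)
  qed simp
  then show thesis by (rule that)
qed

text \<open>A convex lower semicontinuous function whose subgradients stay in a bounded set is finite
  everywhere. In \<open>moreau_point\<close> the slope \<open>k *\<^sub>R (x - z)\<close> is bounded, hence \<open>z\<close> tends to \<open>x\<close> as \<open>k\<close>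
  grows; the affine bounds at \<open>z\<close> survive in the closed epigraph and give a finite value and a
  subgradient at \<open>x\<close>. This removes extended reals from the uniqueness proof.\<close>

lemma convex_lsc_has_slopes_in:
  assumes v: "convex_lsc v" and K: "compact K" "(\<Union>x. subdifferential v x) \<subseteq> K"
    and ne: "(\<Union>x. subdifferential v x) \<noteq> {}"
  obtains w where "v = (\<lambda>x. ereal (w x))" "has_slopes_in w K"
proof -
  define E where "E = {(x, r :: real). v x \<le> ereal r}"
  have E: "closed E" unfolding E_def by (rule convex_lsc_closed_epigraph[OF v])
  obtain R where R: "K \<subseteq> cball 0 R" "R > 0" by (rule compact_norm_bound[OF K(1)])
  obtain x0 y0 where y0: "y0 \<in> subdifferential v x0" using ne by blast
  obtain a where a: "v x0 = ereal a" by (rule subdifferential_realE[OF y0])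
  have key: "\<exists>y. \<forall>z c. v z = ereal c \<longrightarrow> v x \<le> ereal (c - y \<bullet> (z - x))" for x
  proof -
    have "\<exists>z. real (Suc n) *\<^sub>R (x - z) \<in> subdifferential v z" for n
      using moreau_point[OF v y0, of "real (Suc n)" x] by (metis of_nat_0_less_iff zero_less_Suc)
    then obtain z where z: "\<And>n. real (Suc n) *\<^sub>R (x - z n) \<in> subdifferential v (z n)" by metis
    define y where "y n = real (Suc n) *\<^sub>R (x - z n)" for n
    have y: "y n \<in> subdifferential v (z n)" for n unfolding y_def by (rule z)
    have yK: "y n \<in> K" for n using y K(2) by blast
    have "(\<lambda>n. z n - x) \<longlonglongrightarrow> 0"
    proof (rule Lim_null_comparison)
      show "\<forall>\<^sub>F n in sequentially. norm (z n - x) \<le> R * (1 / real (Suc n))"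
      proof (intro always_eventually allI)
        fix n
        have "real (Suc n) * norm (x - z n) \<le> R" using yK[of n] R(1) unfolding y_def by auto
        then show "norm (z n - x) \<le> R * (1 / real (Suc n))"
          by (simp add: norm_minus_commute field_simps)
      qed
      show "(\<lambda>n. R * (1 / real (Suc n))) \<longlonglongrightarrow> 0"
        using tendsto_mult_right_zero[OF lim_1_over_n[THEN LIMSEQ_Suc], of R] by simp
    qed
    then have zx: "z \<longlonglongrightarrow> x" by (simp add: LIM_zero_iff)
    obtain l r where l: "strict_mono r" "(y \<circ> r) \<longlonglongrightarrow> l"
      using K(1) yK unfolding compact_def by metis
    have zr: "(z \<circ> r) \<longlonglongrightarrow> x" using zx l(1) by (rule LIMSEQ_subseq_LIMSEQ)
    have "v x \<le> ereal (c - l \<bullet> (z' - x))" if c: "v z' = ereal c" for z' c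
    proof -
      have "(z n, c - y n \<bullet> (z' - z n)) \<in> E" for n
      proof (rule subdifferential_realE[OF y[of n]])
        fix b assume b: "v (z n) = ereal b" "\<And>p s. v p \<le> ereal s \<Longrightarrow> b + y n \<bullet> (p - z n) \<le> s"
        have "b + y n \<bullet> (z' - z n) \<le> c" using b(2)[of z' c] c by simp
        then show ?thesis unfolding E_def by (simp add: b(1) le_diff_eq)
      qed
      then have "((z \<circ> r) n, c - (y \<circ> r) n \<bullet> (z' - (z \<circ> r) n)) \<in> E" for n by simp
      moreover have "(\<lambda>n. ((z \<circ> r) n, c - (y \<circ> r) n \<bullet> (z' - (z \<circ> r) n))) \<longlonglongrightarrow> (x, c - l \<bullet> (z' - x))"
        by (intro tendsto_intros zr l(2))
      ultimately have "(x, c - l \<bullet> (z' - x)) \<in> E"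
        by (rule closed_sequentially[OF E])
      then show ?thesis unfolding E_def by simp
    qed
    then show ?thesis by blast
  qed
  define w where "w x = real_of_ereal (v x)" for x
  have vw: "v x = ereal (w x)" for x
  proof -
    from key[of x] a obtain y where "v x \<le> ereal (a - y \<bullet> (x0 - x))" by blast
    moreover have "v x \<noteq> - \<infinity>" using v unfolding convex_lsc_def by blast
    ultimately show ?thesis unfolding w_def by (cases "v x") auto
  qed
  have v_eq: "v = (\<lambda>x. ereal (w x))" using vw by blast
  moreover have "has_slopes_in w K"
    unfolding has_slopes_in_def
  proof
    fix x
    obtain y where "\<forall>z c. v z = ereal c \<longrightarrow> v x \<le> ereal (c - y \<bullet> (z - x))" using key[of x] by blast
    then have "y \<in> subgrads w x" unfolding subgrads_def v_eq by (auto simp: algebra_simps)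
    moreover have "subgrads w x \<subseteq> K" using K(2) unfolding v_eq subdifferential_ereal by blast
    ultimately show "subgrads w x \<noteq> {} \<and> subgrads w x \<subseteq> K" by blast
  qed
  ultimately show thesis by (rule that)
qed

lemma minimal_brenier_has_slopes_in:
  assumes v: "minimal_brenier \<mu> \<nu> Y v" and Y: "bounded Y" "Y \<noteq> {}"
  obtains w where "v = (\<lambda>x. ereal (w x))" "has_slopes_in w (closure Y)"
proof (rule convex_lsc_has_slopes_in[of v "closure Y"])
  show "convex_lsc v" using v unfolding minimal_brenier_def by blast
  show "compact (closure Y)" using Y(1) by (simp add: compact_closure)
  have "(\<Union>x. subdifferential v x) = closure Y" using v unfolding minimal_brenier_def by blast
  then show "(\<Union>x. subdifferential v x) \<subseteq> closure Y" "(\<Union>x. subdifferential v x) \<noteq> {}" using Y(2) by auto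
qed (rule that)

lemma gradient_in_subgrads:
  assumes "has_slopes_in u K" "\<exists>p. has_gradient (\<lambda>z. ereal (u z)) x p"
  shows "gradient (\<lambda>z. ereal (u z)) x \<in> subgrads u x \<and> gradient (\<lambda>z. ereal (u z)) x \<in> K"
proof -
  obtain p where p: "has_gradient (\<lambda>z. ereal (u z)) x p" using assms(2) by blast
  have "subgrads u x \<subseteq> K" using assms(1) unfolding has_slopes_in_def by blast
  then show ?thesis unfolding gradient_eq[OF assms(1) p] by simp
qed

section \<open>Kantorovich duality\<close>

definition conjugate :: "('a::euclidean_space \<Rightarrow> real) \<Rightarrow> 'a \<Rightarrow> real" where
  "conjugate v y = (SUP x. y \<bullet> x - v x)"

lemma conjugate_eq:
  assumes "y \<in> subgrads v x"
  shows "conjugate v y = y \<bullet> x - v x"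
  unfolding conjugate_def
proof (rule cSup_eq_maximum)
  fix s assume "s \<in> range (\<lambda>x. y \<bullet> x - v x)"
  then obtain z where "s = y \<bullet> z - v z" by blast
  with subgradsD[OF assms, of z] show "s \<le> y \<bullet> x - v x" by (simp add: inner_diff_right)
qed simp

lemma fenchel_young:
  assumes "y \<in> subgrads v z"
  shows "y \<bullet> x - v x \<le> conjugate v y"
  using subgradsD[OF assms, of x] unfolding conjugate_eq[OF assms] by (simp add: inner_diff_right)

text \<open>The indicator confines the statement to slopes that occur, where the supremum is attained;
  elsewhere it may be infinite, and its value as a real number would be arbitrary.\<close>

lemma conjugate_borel_measurable:
  assumes K: "closed K" and range: "\<And>y. y \<in> K \<Longrightarrow> \<exists>x. y \<in> subgrads v x"
  shows "(\<lambda>y. indicator K y * conjugate v y) \<in> borel_measurable borel"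
  unfolding borel_measurable_iff_le
proof
  fix a
  have "{y. \<forall>x. y \<bullet> x - v x \<le> a} = (\<Inter>x. {y. y \<bullet> x - v x \<le> a})" by auto
  then have cl: "closed {y. \<forall>x. y \<bullet> x - v x \<le> a}"
    by (simp only:) (intro closed_INT ballI closed_Collect_le continuous_intros)
  have "indicator K y * conjugate v y \<le> a \<longleftrightarrow>
      (y \<in> K \<and> (\<forall>x. y \<bullet> x - v x \<le> a)) \<or> (y \<notin> K \<and> 0 \<le> a)" for y
  proof (cases "y \<in> K")
    case True
    then obtain z where z: "y \<in> subgrads v z" using range by blast
    have "conjugate v y \<le> a \<longleftrightarrow> (\<forall>x. y \<bullet> x - v x \<le> a)"
      using fenchel_young[OF z] conjugate_eq[OF z] by (metis order_trans)
    then show ?thesis using True by simp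
  qed simp
  then have "{y. indicator K y * conjugate v y \<le> a} =
      (K \<inter> {y. \<forall>x. y \<bullet> x - v x \<le> a}) \<union> (- K \<inter> {y. 0 \<le> a})" by auto
  also have "\<dots> \<in> sets borel" using K cl by auto
  finally show "{y \<in> space borel. indicator K y * conjugate v y \<le> a} \<in> sets borel" by simp
qed

lemma AE_gradient_in_subgrads:
  assumes "minimal_brenier \<mu> \<nu> Y (\<lambda>x. ereal (u x))" "has_slopes_in u K"
  shows "AE x in \<mu>. gradient (\<lambda>z. ereal (u z)) x \<in> subgrads u x \<and> gradient (\<lambda>z. ereal (u z)) x \<in> K"
proof -
  have "AE x in \<mu>. \<exists>p. has_gradient (\<lambda>z. ereal (u z)) x p"
    using assms(1) unfolding minimal_brenier_def by blast
  then show ?thesis by eventually_elim (use gradient_in_subgrads[OF assms(2)] in blast)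
qed

lemma integrable_inner_bounded:
  fixes G :: "real^2 \<Rightarrow> real^2"
  assumes mu: "finite_measure \<mu>" "sets \<mu> = sets lebesgue" "AE x in \<mu>. norm x \<le> B"
    and G: "G \<in> borel_measurable \<mu>" "AE x in \<mu>. norm (G x) \<le> R"
  shows "integrable \<mu> (\<lambda>x. x \<bullet> G x)"
proof -
  interpret finite_measure \<mu> by (rule mu(1))
  have id: "(\<lambda>x. x) \<in> borel_measurable \<mu>"
    unfolding measurable_cong_sets[OF mu(2) refl] by (intro measurable_completion) simp
  show ?thesis
  proof (rule integrable_const_bound[of _ "\<bar>B\<bar> * \<bar>R\<bar>"])
    show "AE x in \<mu>. norm (x \<bullet> G x) \<le> \<bar>B\<bar> * \<bar>R\<bar>"
      using G(2) mu(3)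
    proof eventually_elim
      case (elim x)
      then have "norm x * norm (G x) \<le> \<bar>B\<bar> * \<bar>R\<bar>" by (intro mult_mono) auto
      then show ?case using Cauchy_Schwarz_ineq2[of x "G x"] by simp
    qed
  qed (use G(1) id in measurable)
qed

text \<open>The gap \<open>v x + v\<^sup>* (\<nabla>u x) - x \<bullet> \<nabla>u x\<close> in the Fenchel-Young inequality. Because \<open>\<nabla>u\<close> and \<open>\<nabla>v\<close> both
  transport \<open>\<mu>\<close> to \<open>\<nu>\<close>, the integral of \<open>v\<^sup>* (\<nabla>u x)\<close> equals that of \<open>v\<^sup>* (\<nabla>v x) = x \<bullet> \<nabla>v x - v x\<close>.
  This also proves the integrability of \<open>v\<^sup>*\<close>, which need not be bounded on the closure of \<open>Y\<close>.\<close>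

lemma transport_gap:
  fixes u v :: "real^2 \<Rightarrow> real"
  assumes mu: "finite_measure \<mu>" "sets \<mu> = sets lebesgue" "AE x in \<mu>. norm x \<le> B"
    and Y: "bounded Y" "Y \<noteq> {}"
    and u: "minimal_brenier \<mu> \<nu> Y (\<lambda>x. ereal (u x))" "has_slopes_in u (closure Y)"
    and v: "minimal_brenier \<mu> \<nu> Y (\<lambda>x. ereal (v x))" "has_slopes_in v (closure Y)"
  defines "gap \<equiv> \<lambda>x. v x + indicator (closure Y) (gradient (\<lambda>z. ereal (u z)) x) *
      conjugate v (gradient (\<lambda>z. ereal (u z)) x) - x \<bullet> gradient (\<lambda>z. ereal (u z)) x"
  shows "integrable \<mu> gap"
    and "(LINT x|\<mu>. gap x) = (LINT x|\<mu>. x \<bullet> gradient (\<lambda>z. ereal (v z)) x) -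
      (LINT x|\<mu>. x \<bullet> gradient (\<lambda>z. ereal (u z)) x)"
    and "AE x in \<mu>. 0 \<le> gap x"
    and "AE x in \<mu>. gap x = 0 \<longrightarrow> (\<exists>y. y \<in> subgrads u x \<and> y \<in> subgrads v x \<and>
          y = gradient (\<lambda>z. ereal (u z)) x)"
proof -
  interpret finite_measure \<mu> by (rule mu(1))
  let ?K = "closure Y"
  define Gu where "Gu = gradient (\<lambda>z. ereal (u z))"
  define Gv where "Gv = gradient (\<lambda>z. ereal (v z))"
  define w where "w y = indicator ?K y * conjugate v y" for y
  have gap_eq: "gap = (\<lambda>x. v x + w (Gu x) - x \<bullet> Gu x)"
    unfolding gap_def w_def Gu_def by simp
  have K: "compact ?K" using Y(1) by (simp add: compact_closure)
  obtain R where R: "?K \<subseteq> cball 0 R" "R > 0" by (rule compact_norm_bound[OF K])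
  have meas: "Gu \<in> borel_measurable \<mu>" "Gv \<in> borel_measurable \<mu>"
    and distr: "distr \<mu> borel Gu = \<nu>" "distr \<mu> borel Gv = \<nu>"
    using u(1) v(1) unfolding minimal_brenier_def Gu_def Gv_def by blast+
  have id_meas: "f \<in> borel_measurable \<mu>" if "f \<in> borel_measurable borel" for f :: "real^2 \<Rightarrow> real"
    unfolding measurable_cong_sets[OF mu(2) refl] by (intro measurable_completion) (use that in simp)
  have vm: "v \<in> borel_measurable \<mu>"
    by (intro id_meas borel_measurable_continuous_onI has_slopes_in_continuous[OF v(2) K])
  have range: "\<exists>x. y \<in> subgrads v x" if "y \<in> ?K" for y
    using v(1) that unfolding minimal_brenier_def subdifferential_ereal by blast
  have wm: "w \<in> borel_measurable borel"
    unfolding w_def by (rule conjugate_borel_measurable) (use range in auto)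
  have subu: "AE x in \<mu>. Gu x \<in> subgrads u x \<and> Gu x \<in> ?K"
    and subv: "AE x in \<mu>. Gv x \<in> subgrads v x \<and> Gv x \<in> ?K"
    unfolding Gu_def Gv_def by (rule AE_gradient_in_subgrads[OF u] AE_gradient_in_subgrads[OF v])+
  have bound: "norm y \<le> R" if "y \<in> ?K" for y using R(1) that by auto
  have ui: "integrable \<mu> (\<lambda>x. x \<bullet> Gu x)"
    by (rule integrable_inner_bounded[OF mu meas(1)]) (use subu in \<open>eventually_elim, use bound in blast\<close>)
  have vi: "integrable \<mu> (\<lambda>x. x \<bullet> Gv x)"
    by (rule integrable_inner_bounded[OF mu meas(2)]) (use subv in \<open>eventually_elim, use bound in blast\<close>)
  have vint: "integrable \<mu> v"
  proof (rule integrable_const_bound[OF _ vm, of "\<bar>v 0\<bar> + R * \<bar>B\<bar>"])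
    show "AE x in \<mu>. norm (v x) \<le> \<bar>v 0\<bar> + R * \<bar>B\<bar>"
      using mu(3)
    proof eventually_elim
      case (elim x)
      have "R * norm x \<le> R * \<bar>B\<bar>" using elim R(2) by (intro mult_left_mono) auto
      then show ?case using has_slopes_in_lipschitz[OF v(2) R(1), of x 0] by simp
    qed
  qed
  have wGv: "AE x in \<mu>. w (Gv x) = x \<bullet> Gv x - v x"
    using subv by eventually_elim (auto simp: w_def conjugate_eq inner_commute)
  have wm': "(\<lambda>x. w (Gu x)) \<in> borel_measurable \<mu>" "(\<lambda>x. w (Gv x)) \<in> borel_measurable \<mu>"
    using measurable_compose[OF meas(1) wm] measurable_compose[OF meas(2) wm] by simp_all
  have diff: "integrable \<mu> (\<lambda>x. x \<bullet> Gv x - v x)" using vi vint by simp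
  then have "integrable \<mu> (\<lambda>x. w (Gv x))"
    using wGv wm'(2) by (subst integrable_cong_AE) auto
  then have w\<nu>: "integrable \<nu> w"
    unfolding distr(2)[symmetric] using integrable_distr_eq[OF meas(2) wm] by simp
  then have wi: "integrable \<mu> (\<lambda>x. w (Gu x))"
    unfolding distr(1)[symmetric] using integrable_distr_eq[OF meas(1) wm] by simp
  have "(LINT x|\<mu>. w (Gu x)) = (LINT y|\<nu>. w y)"
    unfolding distr(1)[symmetric] using integral_distr[OF meas(1) wm] by simp
  also have "\<dots> = (LINT x|\<mu>. w (Gv x))"
    unfolding distr(2)[symmetric] using integral_distr[OF meas(2) wm] by simp
  also have "\<dots> = (LINT x|\<mu>. x \<bullet> Gv x - v x)"
    using wGv wm'(2) diff by (intro integral_cong_AE) auto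
  also have "\<dots> = (LINT x|\<mu>. x \<bullet> Gv x) - (LINT x|\<mu>. v x)" using vi vint by simp
  finally have eq: "(LINT x|\<mu>. w (Gu x)) = (LINT x|\<mu>. x \<bullet> Gv x) - (LINT x|\<mu>. v x)" .
  show "integrable \<mu> gap" unfolding gap_eq using vint wi ui by simp
  show "(LINT x|\<mu>. gap x) = (LINT x|\<mu>. x \<bullet> gradient (\<lambda>z. ereal (v z)) x) -
      (LINT x|\<mu>. x \<bullet> gradient (\<lambda>z. ereal (u z)) x)"
    unfolding gap_eq Gu_def[symmetric] Gv_def[symmetric] using vint wi ui eq by simp
  show "AE x in \<mu>. 0 \<le> gap x"
    using subu
  proof eventually_elim
    case (elim x)
    then obtain z where z: "Gu x \<in> subgrads v z" using range by blast
    show ?case using fenchel_young[OF z, of x] elim unfolding gap_eq w_def by (simp add: inner_commute)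
  qed
  show "AE x in \<mu>. gap x = 0 \<longrightarrow> (\<exists>y. y \<in> subgrads u x \<and> y \<in> subgrads v x \<and>
          y = gradient (\<lambda>z. ereal (u z)) x)"
    using subu
  proof eventually_elim
    case (elim x)
    then obtain z where z: "Gu x \<in> subgrads v z" using range by blast
    have "Gu x \<in> subgrads v x" if "gap x = 0"
    proof -
      have "conjugate v (Gu x) = Gu x \<bullet> x - v x"
        using that elim unfolding gap_eq w_def by (simp add: inner_commute)
      with fenchel_young[OF z] have "Gu x \<bullet> p - v p \<le> Gu x \<bullet> x - v x" for p by metis
      then show ?thesis unfolding subgrads_def by (auto simp: inner_diff_right algebra_simps)
    qed
    then show ?case using elim unfolding Gu_def by blast
  qed
qed

text \<open>Exchanging \<open>u\<close> and \<open>v\<close> changes the sign of the integral of the gap, while both gaps are nonnegative;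
  so they vanish almost everywhere.\<close>

lemma AE_common_subgradient:
  fixes u v :: "real^2 \<Rightarrow> real"
  assumes mu: "finite_measure \<mu>" "sets \<mu> = sets lebesgue" "AE x in \<mu>. norm x \<le> B"
    and Y: "bounded Y" "Y \<noteq> {}"
    and u: "minimal_brenier \<mu> \<nu> Y (\<lambda>x. ereal (u x))" "has_slopes_in u (closure Y)"
    and v: "minimal_brenier \<mu> \<nu> Y (\<lambda>x. ereal (v x))" "has_slopes_in v (closure Y)"
  shows "AE x in \<mu>. gradient (\<lambda>z. ereal (u z)) x \<in> subgrads u x \<inter> subgrads v x"
proof -
  note gap = transport_gap[OF mu Y u v] and gap' = transport_gap[OF mu Y v u]
  let ?gap = "\<lambda>x. v x + indicator (closure Y) (gradient (\<lambda>z. ereal (u z)) x) *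
      conjugate v (gradient (\<lambda>z. ereal (u z)) x) - x \<bullet> gradient (\<lambda>z. ereal (u z)) x"
  have "0 \<le> (LINT x|\<mu>. ?gap x)" by (rule integral_nonneg_AE[OF gap(3)])
  moreover have "0 \<le> - (LINT x|\<mu>. ?gap x)"
    using integral_nonneg_AE[OF gap'(3)] unfolding gap(2) gap'(2) by simp
  ultimately have "(LINT x|\<mu>. ?gap x) = 0" by linarith
  then have "AE x in \<mu>. ?gap x = 0"
    using integral_nonneg_eq_0_iff_AE[OF gap(1) gap(3)] by blast
  with gap(4) show ?thesis by eventually_elim auto
qed

section \<open>Uniqueness of the minimal Brenier solution\<close>

text \<open>Monotonicity against subgradients of slope \<open>y + r *\<^sub>R b\<close> and \<open>y - r *\<^sub>R b\<close> bounds each coordinate of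
  a point \<open>x\<close> that has a slope near \<open>y\<close>.\<close>

lemma subgrads_preimage_bounded:
  fixes u :: "'a::euclidean_space \<Rightarrow> real"
  assumes Y: "open Y" "y \<in> Y" and range: "Y \<subseteq> (\<Union>x. subgrads u x)"
  obtains \<delta> B where "\<delta> > 0" "\<And>x y'. y' \<in> subgrads u x \<Longrightarrow> norm (y' - y) \<le> \<delta> \<Longrightarrow> norm x \<le> B"
proof -
  obtain r where r: "r > 0" "cball y r \<subseteq> Y" using Y open_contains_cball by blast
  have "\<exists>a. y + s *\<^sub>R b \<in> subgrads u a" if "b \<in> Basis" "\<bar>s\<bar> = r" for b s
  proof -
    have "y + s *\<^sub>R b \<in> cball y r" using that by (simp add: dist_norm)
    then show ?thesis using r(2) range by blast
  qed
  then obtain a where a: "\<And>b s. b \<in> Basis \<Longrightarrow> \<bar>s\<bar> = r \<Longrightarrow> y + s *\<^sub>R b \<in> subgrads u (a b s)"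
    by metis
  define D where "D = real DIM('a)"
  have D: "D > 0" unfolding D_def by simp
  \<comment> \<open>The factor makes \<open>D * \<delta> * norm x\<close> equal to half of \<open>r * norm x\<close>, which can be absorbed.\<close>
  define \<delta> where "\<delta> = r / (2 * D)"
  define C where "C = (\<Sum>b\<in>Basis. norm (a b r) + norm (a b (- r))) * (r + \<delta>)"
  have "norm x \<le> 2 * D * C / r" if x: "y' \<in> subgrads u x" "norm (y' - y) \<le> \<delta>" for x y'
  proof -
    have \<delta>: "\<delta> > 0" unfolding \<delta>_def using r(1) D by simp
    have le: "s * (b \<bullet> x) \<le> C + \<delta> * norm x" if b: "b \<in> Basis" and s: "s = r \<or> s = - r" for b s
    proof -
      let ?d = "y + s *\<^sub>R b - y'"
      have "\<bar>s\<bar> = r" using s r(1) by auto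
      from subgrads_monotone[OF a[OF b this] x(1)]
      have "?d \<bullet> x \<le> ?d \<bullet> a b s" by (simp add: inner_diff_right)
      also have "\<dots> \<le> norm ?d * norm (a b s)" by (rule norm_cauchy_schwarz)
      also have "\<dots> \<le> (r + \<delta>) * (\<Sum>b\<in>Basis. norm (a b r) + norm (a b (- r)))"
      proof (rule mult_mono)
        have "norm ?d \<le> norm (s *\<^sub>R b) + norm (y' - y)"
          using norm_triangle_ineq4[of "s *\<^sub>R b" "y' - y"] by (simp add: algebra_simps)
        also have "\<dots> \<le> r + \<delta>" using b \<open>\<bar>s\<bar> = r\<close> x(2) by simp
        finally show "norm ?d \<le> r + \<delta>" .
        have "norm (a b s) \<le> norm (a b r) + norm (a b (- r))" using s by auto
        also have "\<dots> \<le> (\<Sum>b\<in>Basis. norm (a b r) + norm (a b (- r)))"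
          by (rule member_le_sum[OF b]) auto
        finally show "norm (a b s) \<le> (\<Sum>b\<in>Basis. norm (a b r) + norm (a b (- r)))" .
      qed (use r(1) \<delta> in auto)
      finally have "?d \<bullet> x \<le> C" unfolding C_def by (simp add: mult.commute)
      moreover have "(y' - y) \<bullet> x \<le> \<delta> * norm x"
        using norm_cauchy_schwarz[of "y' - y" x] mult_right_mono[OF x(2), of "norm x"] by simp
      ultimately show ?thesis by (simp add: algebra_simps)
    qed
    have "r * \<bar>x \<bullet> b\<bar> \<le> C + \<delta> * norm x" if "b \<in> Basis" for b
      using le[OF that, of r] le[OF that, of "- r"] by (cases "0 \<le> x \<bullet> b") (auto simp: inner_commute)
    then have "(\<Sum>b\<in>Basis. r * \<bar>x \<bullet> b\<bar>) \<le> D * (C + \<delta> * norm x)"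
      unfolding D_def by (intro sum_bounded_above) auto
    moreover have "r * norm x \<le> (\<Sum>b\<in>Basis. r * \<bar>x \<bullet> b\<bar>)"
      unfolding sum_distrib_left[symmetric] using r(1) norm_le_l1[of x] by (intro mult_left_mono) auto
    moreover have "D * (C + \<delta> * norm x) = D * C + r * norm x / 2"
      unfolding \<delta>_def using D by (simp add: field_simps)
    ultimately have "r * norm x \<le> 2 * D * C" by linarith
    then show ?thesis using r(1) by (simp add: field_simps)
  qed
  moreover have "\<delta> > 0" unfolding \<delta>_def using r(1) D by simp
  ultimately show thesis using that by blast
qed

lemma common_subgradient_dense_imp_all:
  fixes u v :: "'a::euclidean_space \<Rightarrow> real"
  assumes K: "compact K" and u: "has_slopes_in u K" and v: "has_slopes_in v K"
    and Y: "open Y" "y \<in> Y" and range: "Y \<subseteq> (\<Union>x. subgrads u x)"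
    and dense: "\<And>e. e > 0 \<Longrightarrow> \<exists>x y'. norm (y' - y) < e \<and> y' \<in> subgrads u x \<inter> subgrads v x"
  shows "\<exists>x. y \<in> subgrads u x \<inter> subgrads v x"
proof -
  obtain \<delta> B where \<delta>: "\<delta> > 0" "\<And>x y'. y' \<in> subgrads u x \<Longrightarrow> norm (y' - y) \<le> \<delta> \<Longrightarrow> norm x \<le> B"
    by (rule subgrads_preimage_bounded[OF Y range]) blast
  have "\<exists>x y'. norm (y' - y) < min \<delta> (1 / real (Suc n)) \<and> y' \<in> subgrads u x \<inter> subgrads v x" for n
    using \<delta>(1) by (intro dense) simp
  then obtain xs ys where xy: "\<And>n. norm (ys n - y) < min \<delta> (1 / real (Suc n))"
      "\<And>n. ys n \<in> subgrads u (xs n)" "\<And>n. ys n \<in> subgrads v (xs n)" by (metis IntD1 IntD2)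
  have "(\<lambda>n. ys n - y) \<longlonglongrightarrow> 0"
    by (rule Lim_null_comparison[OF _ lim_1_over_n[THEN LIMSEQ_Suc]])
      (use xy(1) in \<open>auto intro!: always_eventually less_imp_le\<close>)
  then have ys: "ys \<longlonglongrightarrow> y" by (simp add: LIM_zero_iff)
  have "xs n \<in> cball 0 B" for n using \<delta>(2)[OF xy(2)] xy(1)[of n] by auto
  then obtain x r where x: "strict_mono r" "(xs \<circ> r) \<longlonglongrightarrow> x"
    using compact_cball[of 0 B] unfolding compact_def by metis
  have "(ys \<circ> r) \<longlonglongrightarrow> y" using ys x(1) by (rule LIMSEQ_subseq_LIMSEQ)
  then have "y \<in> subgrads u x \<inter> subgrads v x"
    using subgrads_closed_graph[OF u K x(2)] subgrads_closed_graph[OF v K x(2)] xy by simp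
  then show ?thesis by blast
qed

text \<open>Cut the segment from \<open>p\<close> to \<open>q\<close> into \<open>N\<close> equal parts and choose a point with a common subgradient
  for each division slope. Over one part, the increments of \<open>u\<close> and of \<open>v\<close> lie between the same two
  numbers, whose difference is \<open>((q - p) \<bullet> (x' - x)) / N\<close> for consecutive points \<open>x\<close> and \<open>x'\<close>. The sum telescopes
  to \<open>((q - p) \<bullet> (b - a)) / N\<close>, so only the two end points matter as \<open>N\<close> grows.\<close>

lemma common_subgradient_difference_const:
  fixes u v :: "'a::euclidean_space \<Rightarrow> real"
  assumes Y: "convex Y" and common: "\<And>y. y \<in> Y \<Longrightarrow> \<exists>x. y \<in> subgrads u x \<inter> subgrads v x"
    and p: "p \<in> Y" "p \<in> subgrads u a \<inter> subgrads v a"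
    and q: "q \<in> Y" "q \<in> subgrads u b \<inter> subgrads v b"
  shows "u a - v a = u b - v b"
proof -
  have bound: "\<bar>(u a - v a) - (u b - v b)\<bar> \<le> ((q - p) \<bullet> (b - a)) * (1 / real (Suc n))" for n
  proof -
    define N where "N = Suc n"
    define y where "y i = p + (real i / N) *\<^sub>R (q - p)" for i
    have y0: "y 0 = p" "y N = q" unfolding y_def N_def by simp_all
    have yY: "y i \<in> Y" if "i \<le> N" for i
    proof -
      have "(1 - real i / N) *\<^sub>R p + (real i / N) *\<^sub>R q \<in> Y"
        using that by (intro convexD[OF Y p(1) q(1)]) (simp_all add: N_def del: of_nat_Suc)
      then show ?thesis unfolding y_def by (simp add: algebra_simps)
    qed
    have "\<exists>x. i \<le> N \<longrightarrow> (y i \<in> subgrads u x \<inter> subgrads v x \<and> (i = 0 \<longrightarrow> x = a) \<and> (i = N \<longrightarrow> x = b))" for i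
      using common[OF yY, of i] p(2) q(2) y0 by (cases "i = 0"; cases "i = N") (auto simp: N_def)
    then obtain x where x: "\<And>i. i \<le> N \<Longrightarrow> y i \<in> subgrads u (x i)" "\<And>i. i \<le> N \<Longrightarrow> y i \<in> subgrads v (x i)"
        "x 0 = a" "x N = b" by (metis IntD1 IntD2 order_refl zero_le)
    define D where "D i = u (x i) - v (x i)" for i
    have step: "\<bar>D (Suc i) - D i\<bar> \<le> ((q - p) \<bullet> x (Suc i) - (q - p) \<bullet> x i) / N" if "i < N" for i
    proof -
      have i: "i \<le> N" "Suc i \<le> N" using that by auto
      have "y (Suc i) - y i = (1 / N) *\<^sub>R (q - p)"
        unfolding y_def by (simp add: algebra_simps diff_divide_distrib add_divide_distrib flip: scaleR_left.diff)
      then have "((q - p) \<bullet> x (Suc i) - (q - p) \<bullet> x i) / N = (y (Suc i) - y i) \<bullet> (x (Suc i) - x i)"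
        by (simp add: inner_diff_right diff_divide_distrib)
      then show ?thesis
        using subgradsD[OF x(1)[OF i(1)], of "x (Suc i)"] subgradsD[OF x(2)[OF i(1)], of "x (Suc i)"]
          subgradsD[OF x(1)[OF i(2)], of "x i"] subgradsD[OF x(2)[OF i(2)], of "x i"]
        unfolding D_def by (simp add: algebra_simps abs_le_iff)
    qed
    have "\<bar>D N - D 0\<bar> = \<bar>\<Sum>i<N. D (Suc i) - D i\<bar>" by (simp add: sum_lessThan_telescope)
    also have "\<dots> \<le> (\<Sum>i<N. \<bar>D (Suc i) - D i\<bar>)" by (rule sum_abs)
    also have "\<dots> \<le> (\<Sum>i<N. ((q - p) \<bullet> x (Suc i) - (q - p) \<bullet> x i) / N)"
      by (intro sum_mono step) simp
    also have "\<dots> = ((q - p) \<bullet> x N - (q - p) \<bullet> x 0) / N"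
      unfolding sum_divide_distrib[symmetric] sum_lessThan_telescope[of "\<lambda>i. (q - p) \<bullet> x i"] ..
    finally have "\<bar>D N - D 0\<bar> \<le> ((q - p) \<bullet> b - (q - p) \<bullet> a) / N" unfolding x(3,4) .
    moreover have "D N = u b - v b" "D 0 = u a - v a" unfolding D_def x(3,4) by simp_all
    ultimately show ?thesis unfolding N_def by (simp add: inner_diff_right abs_minus_commute)
  qed
  have "(\<lambda>n. ((q - p) \<bullet> (b - a)) * (1 / real (Suc n))) \<longlonglongrightarrow> 0"
    using tendsto_mult_right_zero[OF lim_1_over_n[THEN LIMSEQ_Suc]] by simp
  then have "\<bar>(u a - v a) - (u b - v b)\<bar> \<le> 0"
    by (rule LIMSEQ_le_const) (use bound in auto)
  then show ?thesis by simp
qed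

text \<open>A slope \<open>y0\<close> of \<open>u\<close> at \<open>x0\<close> may lie on the boundary of \<open>Y\<close>, where nothing is known about \<open>v\<close>. Moving
  it by a fraction \<open>t\<close> towards \<open>y1 \<in> Y\<close> gives a common slope in \<open>Y\<close>, at a cost of order \<open>t\<close>.\<close>

lemma le_if_common_subgradients:
  fixes u v :: "'a::euclidean_space \<Rightarrow> real"
  assumes Y: "open Y" "convex Y" "Y \<noteq> {}" and u: "has_slopes_in u (closure Y)"
    and common: "\<And>y. y \<in> Y \<Longrightarrow> \<exists>x. y \<in> subgrads u x \<inter> subgrads v x \<and> u x - v x = c"
  shows "u x0 - v x0 \<le> c"
proof -
  obtain y0 where y0: "y0 \<in> subgrads u x0" "y0 \<in> closure Y" using u unfolding has_slopes_in_def by blast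
  obtain y1 where y1: "y1 \<in> Y" using Y(3) by blast
  obtain x1 where x1: "y1 \<in> subgrads u x1" using common[OF y1] by blast
  have "0 \<le> (v x0 - (u x0 - c)) + t * (u x0 - (u x1 + y1 \<bullet> (x0 - x1)))" if t: "0 < t" "t \<le> 1" for t
  proof -
    define y where "y = y0 - t *\<^sub>R (y0 - y1)"
    have "y \<in> Y"
      using mem_interior_closure_convex_shrink[OF Y(2) _ y0(2) t, of y1] y1 Y(1)
      unfolding y_def by (simp add: interior_open)
    then obtain x where x: "y \<in> subgrads u x" "y \<in> subgrads v x" "u x - v x = c" using common by blast
    have "(1 - t) * (u x0 + y0 \<bullet> (x - x0)) + t * (u x1 + y1 \<bullet> (x - x1)) \<le> (1 - t) * u x + t * u x"
      using t subgradsD[OF y0(1), of x] subgradsD[OF x1, of x] by (intro add_mono mult_left_mono) auto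
    moreover have "v x + y \<bullet> (x0 - x) \<le> v x0" by (rule subgradsD[OF x(2)])
    ultimately show ?thesis using x(3) unfolding y_def by (simp add: algebra_simps)
  qed
  from nonneg_if_affine_nonneg_near_0[OF this] show ?thesis by simp
qed

lemma minimal_brenier_real_has_slopes_in:
  assumes "minimal_brenier \<mu> \<nu> Y (\<lambda>x. ereal (w x))" "bounded Y" "Y \<noteq> {}"
  shows "has_slopes_in w (closure Y)"
proof -
  obtain w' where w': "(\<lambda>x. ereal (w x)) = (\<lambda>x. ereal (w' x))" "has_slopes_in w' (closure Y)"
    by (rule minimal_brenier_has_slopes_in[OF assms])
  have "w = w'" using fun_cong[OF w'(1)] by auto
  with w'(2) show ?thesis by simp
qed

theorem minimal_brenier_unique:
  fixes u v :: "real^2 \<Rightarrow> real"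
  assumes mu: "finite_measure \<mu>" "sets \<mu> = sets lebesgue" "AE x in \<mu>. norm x \<le> B"
    and Y: "open Y" "bounded Y" "convex Y" "Y \<noteq> {}"
    and pos: "\<And>A. open A \<Longrightarrow> A \<noteq> {} \<Longrightarrow> A \<subseteq> Y \<Longrightarrow> emeasure \<nu> A \<noteq> 0"
    and u: "minimal_brenier \<mu> \<nu> Y (\<lambda>x. ereal (u x))"
    and v: "minimal_brenier \<mu> \<nu> Y (\<lambda>x. ereal (v x))"
    and u0: "u x0 = v x0"
  shows "u = v"
proof -
  have slopes: "has_slopes_in u (closure Y)" "has_slopes_in v (closure Y)"
    by (rule minimal_brenier_real_has_slopes_in[OF _ Y(2,4)], rule u)
      (rule minimal_brenier_real_has_slopes_in[OF _ Y(2,4)], rule v)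
  have K: "compact (closure Y)" using Y(2) by (simp add: compact_closure)
  define G where "G = gradient (\<lambda>z. ereal (u z))"
  have G: "G \<in> borel_measurable \<mu>" "distr \<mu> borel G = \<nu>" "(\<Union>x. subgrads u x) = closure Y"
    using u unfolding minimal_brenier_def subdifferential_ereal G_def by blast+
  have AE: "AE x in \<mu>. G x \<in> subgrads u x \<inter> subgrads v x"
    unfolding G_def by (rule AE_common_subgradient[OF mu Y(2,4) u slopes(1) v slopes(2)])
  have common: "\<exists>x. y \<in> subgrads u x \<inter> subgrads v x" if y: "y \<in> Y" for y
  proof (rule common_subgradient_dense_imp_all[OF K slopes Y(1) y])
    show "Y \<subseteq> (\<Union>x. subgrads u x)" using G(3) closure_subset by blast
    fix e :: real assume e: "e > 0"
    show "\<exists>x y'. norm (y' - y) < e \<and> y' \<in> subgrads u x \<inter> subgrads v x"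
    proof (rule ccontr)
      assume "\<not> ?thesis"
      then have far: "\<not> norm (y' - y) < e" if "y' \<in> subgrads u x \<inter> subgrads v x" for x y'
        using that by blast
      have AE': "AE x in \<mu>. G x \<notin> ball y e \<inter> Y"
        using AE
      proof eventually_elim
        case (elim x)
        from far[OF this] show ?case by (simp add: dist_norm norm_minus_commute)
      qed
      have "G -` (ball y e \<inter> Y) \<inter> space \<mu> \<in> sets \<mu>"
        using Y(1) by (intro measurable_sets[OF G(1)]) auto
      moreover have "AE x in \<mu>. x \<notin> G -` (ball y e \<inter> Y) \<inter> space \<mu>"
        using AE' by eventually_elim blast
      ultimately have "emeasure \<mu> (G -` (ball y e \<inter> Y) \<inter> space \<mu>) = 0"
        using AE_iff_null_sets by blast
      then have "emeasure \<nu> (ball y e \<inter> Y) = 0"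
        unfolding G(2)[symmetric] using G(1) Y(1) by (simp add: emeasure_distr)
      moreover have "emeasure \<nu> (ball y e \<inter> Y) \<noteq> 0"
      proof (rule pos)
        have "y \<in> ball y e \<inter> Y" using y e by simp
        then show "ball y e \<inter> Y \<noteq> {}" by blast
      qed (use Y(1) in auto)
      ultimately show False by contradiction
    qed
  qed
  obtain y1 where y1: "y1 \<in> Y" using Y(4) by blast
  obtain x1 where x1: "y1 \<in> subgrads u x1 \<inter> subgrads v x1" using common[OF y1] by blast
  define c where "c = u x1 - v x1"
  have const: "\<exists>x. y \<in> subgrads u x \<inter> subgrads v x \<and> u x - v x = c" if y: "y \<in> Y" for y
  proof -
    obtain x where x: "y \<in> subgrads u x \<inter> subgrads v x" using common[OF y] by blast
    have "u x - v x = c"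
      unfolding c_def by (rule common_subgradient_difference_const[OF Y(3) common y x y1 x1])
    with x show ?thesis by blast
  qed
  have "u x - v x \<le> c" for x
    by (rule le_if_common_subgradients[OF Y(1,3,4) slopes(1) const])
  moreover have "v x - u x \<le> - c" for x
    by (rule le_if_common_subgradients[OF Y(1,3,4) slopes(2)]) (use const minus_diff_eq in \<open>metis Int_commute\<close>)
  ultimately have "u x - v x = c" for x by (smt (verit))
  with u0 have "u x = v x" for x
    by (metis cancel_comm_monoid_add_class.diff_cancel eq_iff_diff_eq_0)
  then show ?thesis by blast
qed

section \<open>The hexagon of a superbase\<close>

lemma H_nonneg:
  assumes "0 \<le> a" "0 \<le> b" "0 \<le> c"
  shows "0 \<le> H a b c"
proof (cases "b + c \<le> a \<or> a + c \<le> b \<or> a + b \<le> c")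
  case False
  then have "0 \<le> (b + c - a) * (a + c - b) + (a + c - b) * (a + b - c) + (a + b - c) * (b + c - a)"
    by (intro add_nonneg_nonneg mult_nonneg_nonneg) auto
  also have "\<dots> = 4 * H a b c"
    using False unfolding H_def by (simp add: algebra_simps power2_eq_square)
  finally show ?thesis by simp
qed (use assms in \<open>auto simp: H_def\<close>)

text \<open>The left-hand side is the quadratic form \<open>q = (A * B + B * C + C * A) / 4\<close> in
  \<open>A = b' + c' - a'\<close>, \<open>B = a' + c' - b'\<close> and \<open>C = a' + b' - c'\<close>, the area of the hexagon cut out by
  three strips of widths \<open>a'\<close>, \<open>b'\<close>, \<open>c'\<close> with a common centre. It is increasing on the cone of the
  triangle inequalities and at most each of the three products of two widths, which covers the cases
  in the definition of \<^const>\<open>H\<close>.\<close>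

lemma hexagon_le_H:
  fixes a b c a' b' c' :: real
  assumes le: "a' \<le> a" "b' \<le> b" "c' \<le> c" and pos: "0 \<le> a'" "0 \<le> b'" "0 \<le> c'"
    and tri: "a' \<le> b' + c'" "b' \<le> a' + c'" "c' \<le> a' + b'"
  shows "a' * b' - (a' + b' - c')\<^sup>2 / 4 \<le> H a b c"
proof -
  let ?q = "a' * b' - (a' + b' - c')\<^sup>2 / 4"
  have bc: "?q \<le> b' * c'"
  proof -
    \<comment> \<open>The quadratic form is symmetric in the three widths.\<close>
    have "?q = b' * c' - (b' + c' - a')\<^sup>2 / 4" by (simp add: power2_eq_square field_simps)
    then show ?thesis by simp
  qed
  have ac: "?q \<le> a' * c'"
  proof -
    have "?q = a' * c' - (a' + c' - b')\<^sup>2 / 4" by (simp add: power2_eq_square field_simps)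
    then show ?thesis by simp
  qed
  have ab: "?q \<le> a' * b'" by simp
  have prods: "b' * c' \<le> b * c" "a' * c' \<le> a * c" "a' * b' \<le> a * b"
    using le pos by (auto intro!: mult_mono)
  show ?thesis
  proof (cases "b + c \<le> a \<or> a + c \<le> b \<or> a + b \<le> c")
    case True
    have "?q \<le> b * c" "?q \<le> a * c" "?q \<le> a * b"
      using order_trans[OF bc prods(1)] order_trans[OF ac prods(2)] order_trans[OF ab prods(3)] .
    then show ?thesis using True unfolding H_def by auto
  next
    case False
    \<comment> \<open>The difference of the form at two points is its gradient at their midpoint applied to the
      difference of the points; \<open>A\<close>, \<open>B\<close>, \<open>C\<close> are four times the components of that gradient.\<close>
    define A B C where "A = b + c - a + (b' + c' - a')" and "B = a + c - b + (a' + c' - b')"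
      and "C = a + b - c + (a' + b' - c')"
    have "0 \<le> A" "0 \<le> B" "0 \<le> C" using False tri unfolding A_def B_def C_def by auto
    then have "0 \<le> A * (a - a') + B * (b - b') + C * (c - c')"
      using le by (intro add_nonneg_nonneg mult_nonneg_nonneg) auto
    moreover have "H a b c = (a * b + b * c + c * a) / 2 - (a\<^sup>2 + b\<^sup>2 + c\<^sup>2) / 4"
      using False by (simp add: H_def)
    then have "A * (a - a') + B * (b - b') + C * (c - c') = 4 * (H a b c - ?q)"
      unfolding A_def B_def C_def by (simp add: power2_eq_square field_simps)
    ultimately show ?thesis by simp
  qed
qed

lemma right_triangle:
  fixes a b k :: real
  defines "T \<equiv> convex hull {vector [a, b], vector [a + k, b], vector [a, b + k] :: real^2}"
  shows "T \<in> lmeasurable" "measure lebesgue T = k\<^sup>2 / 2"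
proof -
  show "T \<in> lmeasurable"
    unfolding T_def by (intro measurable_convex bounded_convex_hull) auto
  have "compact T" unfolding T_def by (intro compact_convex_hull finite_imp_compact) simp
  then have "measure lebesgue T = measure lborel T"
    by (intro measure_completion) (simp add: compact_imp_closed)
  also have "\<dots> = k\<^sup>2 / 2"
    unfolding T_def content_triangle by (simp add: power2_eq_square abs_mult)
  finally show "measure lebesgue T = k\<^sup>2 / 2" .
qed

lemma hull3_inner_bounds:
  fixes A B C :: "'a::real_inner"
  assumes "z \<in> convex hull {A, B, C}"
  shows "min (w \<bullet> A) (min (w \<bullet> B) (w \<bullet> C)) \<le> w \<bullet> z" "w \<bullet> z \<le> max (w \<bullet> A) (max (w \<bullet> B) (w \<bullet> C))"
proof -
  have hull: "z \<in> S" if "convex S" "{A, B, C} \<subseteq> S" for S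
    using hull_minimal[of "{A, B, C}" S convex] that assms by auto
  have "convex {z. d \<le> w \<bullet> z}" for d using convex_halfspace_ge[of d w] by simp
  from hull[OF this[of "min (w \<bullet> A) (min (w \<bullet> B) (w \<bullet> C))"]]
  show "min (w \<bullet> A) (min (w \<bullet> B) (w \<bullet> C)) \<le> w \<bullet> z" by (auto simp: min_le_iff_disj)
  have "convex {z. w \<bullet> z \<le> d}" for d using convex_halfspace_le[of w d] by simp
  from hull[OF this[of "max (w \<bullet> A) (max (w \<bullet> B) (w \<bullet> C))"]]
  show "w \<bullet> z \<le> max (w \<bullet> A) (max (w \<bullet> B) (w \<bullet> C))" by (auto simp: le_max_iff_disj)
qed

lemma vector11_inner: "vector [1, 1] \<bullet> (z :: real^2) = z $ 1 + z $ 2"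
  unfolding inner_vec_def sum_2 by simp

lemma triangle_hull_bounds:
  fixes A B C :: "real^2"
  assumes "z \<in> convex hull {A, B, C}"
  shows "min (A $ 1) (min (B $ 1) (C $ 1)) \<le> z $ 1" "z $ 1 \<le> max (A $ 1) (max (B $ 1) (C $ 1))"
    and "min (A $ 2) (min (B $ 2) (C $ 2)) \<le> z $ 2" "z $ 2 \<le> max (A $ 2) (max (B $ 2) (C $ 2))"
    and "min (A $ 1 + A $ 2) (min (B $ 1 + B $ 2) (C $ 1 + C $ 2)) \<le> z $ 1 + z $ 2"
    and "z $ 1 + z $ 2 \<le> max (A $ 1 + A $ 2) (max (B $ 1 + B $ 2) (C $ 1 + C $ 2))"
proof -
  have ax: "axis i 1 \<bullet> p = p $ i" for i and p :: "real^2" by (simp add: inner_axis')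
  note bounds = hull3_inner_bounds[OF assms, of "axis 1 1", unfolded ax]
    hull3_inner_bounds[OF assms, of "axis 2 1", unfolded ax]
    hull3_inner_bounds[OF assms, of "vector [1, 1]", unfolded vector11_inner]
  show "min (A $ 1) (min (B $ 1) (C $ 1)) \<le> z $ 1" "z $ 1 \<le> max (A $ 1) (max (B $ 1) (C $ 1))"
    "min (A $ 2) (min (B $ 2) (C $ 2)) \<le> z $ 2" "z $ 2 \<le> max (A $ 2) (max (B $ 2) (C $ 2))"
    "min (A $ 1 + A $ 2) (min (B $ 1 + B $ 2) (C $ 1 + C $ 2)) \<le> z $ 1 + z $ 2"
    "z $ 1 + z $ 2 \<le> max (A $ 1 + A $ 2) (max (B $ 1 + B $ 2) (C $ 1 + C $ 2))"
    by (fact bounds)+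
qed

lemma negligible_antidiagonal: "negligible {z :: real^2. z $ 1 + z $ 2 = d}"
proof -
  have "vector [1, 1] \<bullet> (axis 1 1 :: real^2) = 1" unfolding vector11_inner by (simp add: axis_def)
  then have "vector [1, 1] \<noteq> (0 :: real^2)" by (metis inner_zero_left zero_neq_one)
  then have "negligible {z :: real^2. vector [1, 1] \<bullet> z = d}" by (intro negligible_hyperplane) simp
  then show ?thesis unfolding vector11_inner .
qed

text \<open>A set between the lines \<open>z $ 1 + z $ 2 = k1\<close> and \<open>z $ 1 + z $ 2 = k2\<close> does not enter two right triangles
  in the corners of the rectangle. The assumptions on \<open>k1\<close> and \<open>k2\<close> say that the triangles with legs \<open>k\<close>
  and \<open>k'\<close> fit into it. The strips may have different centres, but \<open>k + k'\<close> is determined by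
  the widths and \<open>k\<^sup>2 / 2 + k'\<^sup>2 / 2 \<ge> (k + k')\<^sup>2 / 4\<close>.\<close>

lemma measure_hexagon_tight:
  fixes S :: "(real^2) set"
  assumes S: "S \<in> lmeasurable"
    and sub: "\<And>z. z \<in> S \<Longrightarrow> a1 \<le> z $ 1 \<and> z $ 1 \<le> a2 \<and> b1 \<le> z $ 2 \<and> z $ 2 \<le> b2 \<and>
        k1 \<le> z $ 1 + z $ 2 \<and> z $ 1 + z $ 2 \<le> k2"
    and ord: "a1 \<le> a2" "b1 \<le> b2" "k1 \<le> k2"
    and k: "0 \<le> k1 - a1 - b1" "k1 - a1 - b1 \<le> a2 - a1" "k1 - a1 - b1 \<le> b2 - b1"
    and k': "0 \<le> a2 + b2 - k2" "a2 + b2 - k2 \<le> a2 - a1" "a2 + b2 - k2 \<le> b2 - b1"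
  shows "measure lebesgue S \<le> (a2 - a1) * (b2 - b1) - ((a2 - a1) + (b2 - b1) - (k2 - k1))\<^sup>2 / 4"
proof -
  define k where "k = k1 - a1 - b1"
  define k' where "k' = a2 + b2 - k2"
  define T1 where "T1 = convex hull {vector [a1, b1], vector [a1 + k, b1], vector [a1, b1 + k] :: real^2}"
  define T2 where "T2 = convex hull {vector [a2, b2], vector [a2 + - k', b2], vector [a2, b2 + - k'] :: real^2}"
  note T1 = right_triangle[of a1 b1 k, folded T1_def]
  note T2 = right_triangle[of a2 b2 "- k'", folded T2_def]
  define Q :: "(real^2) set" where "Q = cbox (vector [a1, b1]) (vector [a2, b2])"
  have T1_bounds: "a1 \<le> z $ 1 \<and> z $ 1 \<le> a2 \<and> b1 \<le> z $ 2 \<and> z $ 2 \<le> b2 \<and> z $ 1 + z $ 2 \<le> k1" if "z \<in> T1" for z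
    using triangle_hull_bounds[OF that[unfolded T1_def]] assms(6-) ord
    by (simp add: k_def)
  have T2_bounds: "a1 \<le> z $ 1 \<and> z $ 1 \<le> a2 \<and> b1 \<le> z $ 2 \<and> z $ 2 \<le> b2 \<and> k2 \<le> z $ 1 + z $ 2" if "z \<in> T2" for z
    using triangle_hull_bounds[OF that[unfolded T2_def]] assms(6-) ord
    by (simp add: k'_def)
  have "negligible (S \<inter> T1)"
    by (rule negligible_subset[OF negligible_antidiagonal[of k1]]) (use sub T1_bounds in force)
  moreover have "negligible (S \<inter> T2)"
    by (rule negligible_subset[OF negligible_antidiagonal[of k2]]) (use sub T2_bounds in force)
  moreover have "negligible (T1 \<inter> T2)"
    by (rule negligible_subset[OF negligible_antidiagonal[of k1]]) (use T1_bounds T2_bounds ord(3) in force)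
  ultimately have "measure lebesgue (S \<union> T1 \<union> T2) =
      measure lebesgue S + measure lebesgue T1 + measure lebesgue T2"
    using S T1(1) T2(1) by (intro measure_Un3_negligible refl)
  moreover have "measure lebesgue (S \<union> T1 \<union> T2) \<le> measure lebesgue Q"
  proof (rule measure_mono_fmeasurable)
    show "S \<union> T1 \<union> T2 \<subseteq> Q" using sub T1_bounds T2_bounds by (force simp: Q_def mem_box_cart forall_2)
  qed (use S T1(1) T2(1) in \<open>auto simp: Q_def fmeasurableD\<close>)
  moreover have "measure lebesgue Q = (a2 - a1) * (b2 - b1)"
  proof -
    have "Q \<noteq> {}" unfolding Q_def interval_ne_empty_cart forall_2 using ord by simp
    then have "measure lborel Q = (a2 - a1) * (b2 - b1)"
      unfolding Q_def by (subst content_cbox_cart) (simp_all add: UNIV_2)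
    then show ?thesis unfolding Q_def by simp
  qed
  ultimately have "measure lebesgue S + k\<^sup>2 / 2 + k'\<^sup>2 / 2 \<le> (a2 - a1) * (b2 - b1)"
    unfolding T1(2) T2(2) by simp
  moreover have "(k + k')\<^sup>2 / 4 \<le> k\<^sup>2 / 2 + k'\<^sup>2 / 2"
    using zero_le_power2[of "k - k'"] by (simp add: power2_eq_square algebra_simps)
  ultimately have "measure lebesgue S \<le> (a2 - a1) * (b2 - b1) - (k + k')\<^sup>2 / 4" by linarith
  moreover have "k + k' = (a2 - a1) + (b2 - b1) - (k2 - k1)" unfolding k_def k'_def by simp
  ultimately show ?thesis by simp
qed

lemma of_int_vec_add: "of_int_vec (a + b) = of_int_vec a + of_int_vec b"
  and of_int_vec_minus: "of_int_vec (- a) = - of_int_vec a"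
  and of_int_vec_0: "of_int_vec 0 = 0"
  by (simp_all add: of_int_vec_def vec_eq_iff)

lemma superbase_sum_eq_0:
  assumes "superbase e e' e''"
  shows "of_int_vec e + of_int_vec e' + of_int_vec e'' = 0"
  using assms unfolding superbase_def of_int_vec_add[symmetric] by (simp add: of_int_vec_0)

lemma superbase_det:
  assumes "superbase e e' e''"
  shows "\<bar>of_int_vec e' $ 1 * of_int_vec e'' $ 2 - of_int_vec e' $ 2 * of_int_vec e'' $ 1\<bar> = 1"
proof -
  have "\<bar>e' $ 1 * e'' $ 2 - e' $ 2 * e'' $ 1\<bar> = 1"
    using assms unfolding superbase_def by (simp add: det_2)
  then have "\<bar>real_of_int (e' $ 1 * e'' $ 2 - e' $ 2 * e'' $ 1)\<bar> = 1"
    by linarith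
  then show ?thesis by (simp add: of_int_vec_def)
qed

text \<open>The geometric content of the operator \<^const>\<open>MA\<close>. In the coordinates
  \<open>(h * (y \<bullet> e'), h * (y \<bullet> e''))\<close>, which scale areas by \<open>h\<^sup>2\<close>, the three strips become a hexagon. The
  strips are first shrunk until each boundary line touches \<open>S\<close>; this yields the hypotheses of
  \<open>measure_hexagon_tight\<close>, and \<open>hexagon_le_H\<close> returns to the given widths.\<close>

lemma measure_superbase_cell:
  fixes P M :: "int^2 \<Rightarrow> real"
  assumes sb: "superbase e e' e''" and S: "compact S"
    and bounds: "\<And>y d. y \<in> S \<Longrightarrow> d \<in> {e, e', e''} \<Longrightarrow>
        - M d \<le> h * (y \<bullet> of_int_vec d) \<and> h * (y \<bullet> of_int_vec d) \<le> P d"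
  shows "h\<^sup>2 * measure lebesgue S \<le> H (max (P e + M e) 0) (max (P e' + M e') 0) (max (P e'' + M e'') 0)"
proof (cases "S = {}")
  case True
  then show ?thesis by (simp add: H_nonneg)
next
  case False
  define L :: "real^2 \<Rightarrow> real^2" where "L y = vector [h * (y \<bullet> of_int_vec e'), h * (y \<bullet> of_int_vec e'')]" for y
  have L1: "L y $ 1 = h * (y \<bullet> of_int_vec e')" and L2: "L y $ 2 = h * (y \<bullet> of_int_vec e'')" for y
    unfolding L_def by simp_all
  have L12: "L y $ 1 + L y $ 2 = - (h * (y \<bullet> of_int_vec e))" for y
  proof -
    have "of_int_vec e' + of_int_vec e'' = - of_int_vec e"
      using superbase_sum_eq_0[OF sb] by (simp add: add_eq_0_iff algebra_simps)
    then have "y \<bullet> of_int_vec e' + y \<bullet> of_int_vec e'' = - (y \<bullet> of_int_vec e)"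
      by (metis inner_add_right inner_minus_right)
    then show ?thesis unfolding L1 L2 by (metis distrib_left mult_minus_right)
  qed
  have lin: "linear L"
    by (rule linearI) (simp_all add: vec_eq_iff forall_2 L1 L2 inner_add_left algebra_simps)
  have "det (matrix L) = h\<^sup>2 * (of_int_vec e' $ 1 * of_int_vec e'' $ 2 - of_int_vec e' $ 2 * of_int_vec e'' $ 1)"
    by (simp add: det_2 matrix_def L1 L2 inner_axis' power2_eq_square algebra_simps)
  then have det: "\<bar>det (matrix L)\<bar> = h\<^sup>2" using superbase_det[OF sb] by (simp add: abs_mult)
  have "S \<in> lmeasurable" using S by (rule lmeasurable_compact)
  then have meas: "measure lebesgue (L ` S) = h\<^sup>2 * measure lebesgue S"
    using measure_linear_image[OF lin] det by simp
  have cont: "continuous_on A (\<lambda>y. L y $ i)" for A i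
    by (intro continuous_intros linear_continuous_on) (simp add: lin linear_conv_bounded_linear[symmetric])
  have cont12: "continuous_on A (\<lambda>y. L y $ 1 + L y $ 2)" for A
    by (intro continuous_on_add cont)
  note inf = continuous_attains_inf[OF S False] and sup = continuous_attains_sup[OF S False]
  obtain ya1 where ya1: "ya1 \<in> S" "\<forall>y\<in>S. L ya1 $ 1 \<le> L y $ 1" using inf[OF cont[of S 1]] by blast
  obtain ya2 where ya2: "ya2 \<in> S" "\<forall>y\<in>S. L y $ 1 \<le> L ya2 $ 1" using sup[OF cont[of S 1]] by blast
  obtain yb1 where yb1: "yb1 \<in> S" "\<forall>y\<in>S. L yb1 $ 2 \<le> L y $ 2" using inf[OF cont[of S 2]] by blast
  obtain yb2 where yb2: "yb2 \<in> S" "\<forall>y\<in>S. L y $ 2 \<le> L yb2 $ 2" using sup[OF cont[of S 2]] by blast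
  obtain yk1 where yk1: "yk1 \<in> S" "\<forall>y\<in>S. L yk1 $ 1 + L yk1 $ 2 \<le> L y $ 1 + L y $ 2"
    using inf[OF cont12[of S]] by blast
  obtain yk2 where yk2: "yk2 \<in> S" "\<forall>y\<in>S. L y $ 1 + L y $ 2 \<le> L yk2 $ 1 + L yk2 $ 2"
    using sup[OF cont12[of S]] by blast
  define a1 a2 b1 b2 k1 k2 where "a1 = L ya1 $ 1" and "a2 = L ya2 $ 1" and "b1 = L yb1 $ 2"
    and "b2 = L yb2 $ 2" and "k1 = L yk1 $ 1 + L yk1 $ 2" and "k2 = L yk2 $ 1 + L yk2 $ 2"
  note defs = a1_def a2_def b1_def b2_def k1_def k2_def
  have sub: "a1 \<le> L y $ 1 \<and> L y $ 1 \<le> a2 \<and> b1 \<le> L y $ 2 \<and> L y $ 2 \<le> b2 \<and>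
      k1 \<le> L y $ 1 + L y $ 2 \<and> L y $ 1 + L y $ 2 \<le> k2" if "y \<in> S" for y
    using that ya1(2) ya2(2) yb1(2) yb2(2) yk1(2) yk2(2) unfolding defs by blast
  have attained: "L ya1 $ 1 = a1" "L ya2 $ 1 = a2" "L yb1 $ 2 = b1" "L yb2 $ 2 = b2"
    "L yk1 $ 1 + L yk1 $ 2 = k1" "L yk2 $ 1 + L yk2 $ 2 = k2" unfolding defs by simp_all
  note tight = sub[OF ya1(1)] sub[OF ya2(1)] sub[OF yb1(1)] sub[OF yb2(1)] sub[OF yk1(1)] sub[OF yk2(1)]
  have ord: "a1 \<le> a2" "b1 \<le> b2" "k1 \<le> k2" using tight by linarith+
  have k: "0 \<le> k1 - a1 - b1" "k1 - a1 - b1 \<le> a2 - a1" "k1 - a1 - b1 \<le> b2 - b1"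
    "0 \<le> a2 + b2 - k2" "a2 + b2 - k2 \<le> a2 - a1" "a2 + b2 - k2 \<le> b2 - b1"
    using tight attained by linarith+
  have "measure lebesgue (L ` S) \<le> (a2 - a1) * (b2 - b1) - ((a2 - a1) + (b2 - b1) - (k2 - k1))\<^sup>2 / 4"
  proof (rule measure_hexagon_tight[OF _ _ ord k])
    show "L ` S \<in> lmeasurable"
      by (intro lmeasurable_compact compact_continuous_image S linear_continuous_on)
        (simp add: lin linear_conv_bounded_linear[symmetric])
  qed (use sub in blast)
  also have "\<dots> = (k2 - k1) * (a2 - a1) - ((k2 - k1) + (a2 - a1) - (b2 - b1))\<^sup>2 / 4"
    by (simp add: power2_eq_square field_simps)
  also have "\<dots> \<le> H (max (P e + M e) 0) (max (P e' + M e') 0) (max (P e'' + M e'') 0)"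
  proof (rule hexagon_le_H)
    have "k2 - k1 \<le> P e + M e"
      using bounds[OF yk1(1), of e] bounds[OF yk2(1), of e] unfolding k1_def k2_def L12 by simp
    then show "k2 - k1 \<le> max (P e + M e) 0" by simp
    have "a2 - a1 \<le> P e' + M e'"
      using bounds[OF ya1(1), of e'] bounds[OF ya2(1), of e'] unfolding a1_def a2_def L1 by simp
    then show "a2 - a1 \<le> max (P e' + M e') 0" by simp
    have "b2 - b1 \<le> P e'' + M e''"
      using bounds[OF yb1(1), of e''] bounds[OF yb2(1), of e''] unfolding b1_def b2_def L2 by simp
    then show "b2 - b1 \<le> max (P e'' + M e'') 0" by simp
  qed (use ord k in linarith)+
  finally show ?thesis unfolding meas .
qed

section \<open>Masses of the source and of the target\<close>

lemma emeasure_source: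
  assumes f: "integrable lebesgue f" "\<And>x. 0 \<le> f x" and A: "A \<in> sets lebesgue"
  shows "emeasure (source_measure f) A = ennreal (LINT x:A|lebesgue. f x)"
proof -
  have i: "set_integrable lebesgue A f"
    by (rule set_integrable_subset[of _ UNIV]) (use f A in \<open>auto simp: set_integrable_def\<close>)
  have "emeasure (source_measure f) A = (\<integral>\<^sup>+x. ennreal (f x) * indicator A x \<partial>lebesgue)"
    unfolding source_measure_def using f(1) A by (intro emeasure_density) auto
  also have "\<dots> = (\<integral>\<^sup>+x. ennreal (indicator A x *\<^sub>R f x) \<partial>lebesgue)"
    by (intro nn_integral_cong) (auto simp: indicator_def)
  also have "\<dots> = ennreal (LINT x:A|lebesgue. f x)"
    unfolding set_lebesgue_integral_def
    using i f(2) by (intro nn_integral_eq_integral) (auto simp: set_integrable_def)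
  finally show ?thesis .
qed

lemma measure_source:
  assumes f: "integrable lebesgue f" "\<And>x. 0 \<le> f x" and A: "A \<in> sets lebesgue"
  shows "measure (source_measure f) A = (LINT x:A|lebesgue. f x)"
proof -
  have "0 \<le> (LINT x:A|lebesgue. f x)"
    unfolding set_lebesgue_integral_def using f(2) by (intro Bochner_Integration.integral_nonneg) (auto simp: indicator_def)
  then show ?thesis unfolding measure_def emeasure_source[OF assms] by simp
qed

lemma finite_source:
  assumes "integrable lebesgue f" "\<And>x. 0 \<le> f x"
  shows "finite_measure (source_measure f)"
proof (rule finite_measureI)
  have "space (source_measure f) = UNIV" by (simp add: source_measure_def)
  then show "emeasure (source_measure f) (space (source_measure f)) \<noteq> \<infinity>"
    using emeasure_source[OF assms, of UNIV] by simp
qed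

lemma measure_source_pos:
  assumes f: "integrable lebesgue f" "\<And>x. 0 \<le> f x" and A: "open A" "A \<noteq> {}" "bounded A"
    and m: "m > 0" "\<And>x. x \<in> A \<Longrightarrow> m \<le> f x"
  shows "0 < measure (source_measure f) A"
proof -
  have lm: "A \<in> lmeasurable" using A(1,3) by (rule lmeasurable_open[rotated])
  have "\<not> negligible A" using A(1,2) open_not_negligible by blast
  then have "0 < measure lebesgue A"
    using lm by (metis measure_le_0_iff negligible_iff_measure not_le)
  then have "0 < m * measure lebesgue A" using m(1) by simp
  also have "m * measure lebesgue A = (LINT x:A|lebesgue. m)"
    using lm unfolding set_lebesgue_integral_def by (simp add: mult.commute)
  also have "\<dots> \<le> (LINT x:A|lebesgue. f x)"
  proof (rule set_integral_mono)
    show "set_integrable lebesgue A (\<lambda>_. m)"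
      using lm unfolding set_integrable_def real_scaleR_def
      by (intro integrable_mult_left integrable_real_indicator) (auto simp: fmeasurable_def)
    show "set_integrable lebesgue A f"
      by (rule set_integrable_subset[of _ UNIV]) (use f lm in \<open>auto simp: set_integrable_def\<close>)
  qed (rule m(2))
  also have "\<dots> = measure (source_measure f) A"
    using measure_source[OF f, of A] lm by auto
  finally show ?thesis .
qed

text \<open>Open cells of different grid points are disjoint, so their masses add up; the boundary of a cell
  does not contribute to the cell average.\<close>

lemma measure_source_cell:
  fixes f :: "real^2 \<Rightarrow> real"
  assumes f: "integrable lebesgue f" "\<And>x. 0 \<le> f x" and h: "h > 0"
  shows "measure (source_measure f) (box (x - vec (h / 2)) (x + vec (h / 2))) = h\<^sup>2 * cell_average h f x"
proof -
  let ?a = "vec (- h / 2) :: real^2" and ?b = "vec (h / 2) :: real^2"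
  have ab: "?a + x = x - vec (h / 2)" "?b + x = x + vec (h / 2)" by (simp_all add: vec_eq_iff)
  have abs: "f absolutely_integrable_on cbox (?a + x) (?b + x)"
    by (rule set_integrable_subset[of _ UNIV]) (use f in \<open>auto simp: set_integrable_def\<close>)
  then have "f integrable_on cbox (?a + x) (?b + x)"
    by (rule set_lebesgue_integral_eq_integral(1))
  then have shift: "(f \<circ> (+) x) integrable_on cbox ?a ?b" by (simp only: integrable_on_shift_cbox)
  have abs': "(\<lambda>t. f (x + t)) absolutely_integrable_on cbox ?a ?b"
    using shift f(2) by (intro nonnegative_absolutely_integrable_1) (auto simp: o_def)
  have "(LINT t:cbox ?a ?b|lebesgue. f (x + t)) = integral (cbox ?a ?b) (f \<circ> (+) x)"
    using set_lebesgue_integral_eq_integral(2)[OF abs'] by (simp add: o_def)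
  also have "\<dots> = integral (cbox (?a + x) (?b + x)) f" by (rule integral_shift_cbox_plus)
  also have "\<dots> = (LINT t:cbox (?a + x) (?b + x)|lebesgue. f t)"
    by (rule set_lebesgue_integral_eq_integral(2)[OF abs, symmetric])
  also have "\<dots> = (LINT t:box (?a + x) (?b + x)|lebesgue. f t)"
  proof (rule set_integral_null_delta[symmetric])
    have "negligible (cbox (?a + x) (?b + x) - box (?a + x) (?b + x))"
      by (rule negligible_frontier_interval)
    then show "sym_diff (box (?a + x) (?b + x)) (cbox (?a + x) (?b + x)) \<in> null_sets lebesgue"
      using box_subset_cbox[of "?a + x" "?b + x"]
      by (simp add: negligible_iff_null_sets Diff_eq_empty_iff[THEN iffD2] sup_commute)
  qed (use f(1) in auto)
  also have "\<dots> = measure (source_measure f) (box (x - vec (h / 2)) (x + vec (h / 2)))"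
    unfolding ab using measure_source[OF f, of "box (x - vec (h / 2)) (x + vec (h / 2))"] by simp
  finally show ?thesis using h unfolding cell_average_def by simp
qed

lemma emeasure_target:
  fixes g :: "real^2 \<Rightarrow> real"
  assumes g: "continuous_on UNIV g" and Y: "open Y" and A: "A \<in> sets borel"
  shows "emeasure (target_measure Y g) A = (\<integral>\<^sup>+y. ennreal (g y) * indicator (A \<inter> Y) y \<partial>lborel)"
proof -
  have [measurable]: "g \<in> borel_measurable borel" using g(1) by (rule borel_measurable_continuous_onI)
  have [measurable]: "Y \<in> sets borel" using Y by simp
  have m: "(\<lambda>y. ennreal (g y * indicator Y y)) \<in> borel_measurable lborel"
    by simp
  have "emeasure (target_measure Y g) A = (\<integral>\<^sup>+y. ennreal (g y * indicator Y y) * indicator A y \<partial>lborel)"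
    unfolding target_measure_def by (rule emeasure_density[OF m]) (use A in simp)
  also have "\<dots> = (\<integral>\<^sup>+y. ennreal (g y) * indicator (A \<inter> Y) y \<partial>lborel)"
    by (intro nn_integral_cong) (auto simp: indicator_def)
  finally show ?thesis .
qed

lemma emeasure_target_UNIV:
  fixes g :: "real^2 \<Rightarrow> real"
  assumes g: "continuous_on UNIV g" "\<And>y. 0 \<le> g y" and Y: "open Y" and mass: "(LINT y:Y|lborel. g y) = 1"
  shows "emeasure (target_measure Y g) UNIV = 1"
proof -
  have "integrable lborel (\<lambda>y. indicator Y y *\<^sub>R g y)"
  proof (rule ccontr)
    assume "\<not> ?thesis"
    then have "(LINT y:Y|lborel. g y) = 0"
      unfolding set_lebesgue_integral_def by (rule not_integrable_integral_eq)
    with mass show False by simp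
  qed
  then have "(\<integral>\<^sup>+y. ennreal (indicator Y y *\<^sub>R g y) \<partial>lborel) = ennreal 1"
    unfolding mass[symmetric] set_lebesgue_integral_def using g(2) by (intro nn_integral_eq_integral) auto
  moreover have "(\<integral>\<^sup>+y. ennreal (indicator Y y *\<^sub>R g y) \<partial>lborel) =
      (\<integral>\<^sup>+y. ennreal (g y) * indicator (UNIV \<inter> Y) y \<partial>lborel)"
    by (intro nn_integral_cong) (auto simp: indicator_def)
  ultimately show ?thesis using emeasure_target[OF g(1) Y, of UNIV] by simp
qed

lemma finite_target:
  fixes g :: "real^2 \<Rightarrow> real"
  assumes "continuous_on UNIV g" "\<And>y. 0 \<le> g y" "open Y" "(LINT y:Y|lborel. g y) = 1"
  shows "finite_measure (target_measure Y g)"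
proof (rule finite_measureI)
  have "space (target_measure Y g) = UNIV" by (simp add: target_measure_def)
  then show "emeasure (target_measure Y g) (space (target_measure Y g)) \<noteq> \<infinity>"
    using emeasure_target_UNIV[OF assms] by simp
qed

lemma measure_target_le:
  fixes g :: "real^2 \<Rightarrow> real"
  assumes g: "continuous_on UNIV g" and Y: "open Y"
    and A: "compact A" and c: "0 \<le> c" "\<And>y. y \<in> A \<Longrightarrow> g y \<le> c"
  shows "measure (target_measure Y g) A \<le> c * measure lebesgue A"
proof -
  have A': "A \<in> sets borel" using A by (simp add: compact_imp_closed)
  have fin: "emeasure lborel A < \<infinity>" using emeasure_compact_finite[OF A] by simp
  have "emeasure (target_measure Y g) A = (\<integral>\<^sup>+y. ennreal (g y) * indicator (A \<inter> Y) y \<partial>lborel)"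
    by (rule emeasure_target[OF g Y A'])
  also have "\<dots> \<le> (\<integral>\<^sup>+y. ennreal c * indicator A y \<partial>lborel)"
    using c by (intro nn_integral_mono) (auto simp: indicator_def ennreal_leI)
  also have "\<dots> = ennreal c * emeasure lborel A" using A' by (intro nn_integral_cmult_indicator) simp
  also have "\<dots> = ennreal (c * measure lborel A)"
    using c(1) fin by (simp add: emeasure_eq_ennreal_measure ennreal_mult' less_top)
  finally have "measure (target_measure Y g) A \<le> c * measure lborel A"
    unfolding measure_def[of "target_measure Y g"] using c(1) by (metis enn2real_leI measure_nonneg mult_nonneg_nonneg)
  then show ?thesis using A' by simp
qed

lemma emeasure_target_pos:
  fixes g :: "real^2 \<Rightarrow> real"
  assumes g: "continuous_on UNIV g" and Y: "open Y"
    and m: "0 < m" "\<And>y. m \<le> g y" and A: "open A" "A \<noteq> {}" "A \<subseteq> Y"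
  shows "emeasure (target_measure Y g) A \<noteq> 0"
proof -
  have "ennreal m * emeasure lborel A = (\<integral>\<^sup>+y. ennreal m * indicator A y \<partial>lborel)"
    using A(1) by (intro nn_integral_cmult_indicator[symmetric]) simp
  also have "\<dots> \<le> (\<integral>\<^sup>+y. ennreal (g y) * indicator (A \<inter> Y) y \<partial>lborel)"
    using m A(3) by (intro nn_integral_mono) (auto simp: indicator_def ennreal_leI)
  also have "\<dots> = emeasure (target_measure Y g) A"
    using emeasure_target[OF g Y, of A] A(1) by simp
  finally have le: "ennreal m * emeasure lborel A \<le> emeasure (target_measure Y g) A" .
  have "A \<notin> null_sets lborel"
    using A(1,2) open_not_negligible[of A] negligible_iff_null_sets null_sets_completionI by blast
  then have "emeasure lborel A \<noteq> 0" using A(1) by auto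
  then show ?thesis using le m(1) by auto
qed

section \<open>Grid and support function\<close>

lemma square_iff: "x \<in> square \<longleftrightarrow> \<bar>x $ 1\<bar> \<le> 1 \<and> \<bar>x $ 2\<bar> \<le> 1"
  unfolding square_def mem_box_cart by (auto simp: forall_2 vec_def)

lemma square_compact: "compact square"
  unfolding square_def by (rule compact_cbox)

lemma zero_in_grid: "0 \<in> grid h \<inter> square"
proof -
  have "(0 :: real^2) = h *\<^sub>R of_int_vec 0" by (simp add: of_int_vec_0)
  then have "(0 :: real^2) \<in> grid h" unfolding grid_def by blast
  then show ?thesis by (simp add: square_iff)
qed

lemma grid_shift:
  assumes "x \<in> grid h"
  shows "x + h *\<^sub>R of_int_vec e \<in> grid h"
proof -
  obtain a where "x = h *\<^sub>R of_int_vec a" using assms unfolding grid_def by blast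
  then have "x + h *\<^sub>R of_int_vec e = h *\<^sub>R of_int_vec (a + e)"
    by (simp add: of_int_vec_add algebra_simps)
  then show ?thesis unfolding grid_def by blast
qed

lemma finite_int_vec_box: "finite {e :: int^2. \<bar>e $ 1\<bar> \<le> n \<and> \<bar>e $ 2\<bar> \<le> n}"
proof (rule finite_imageD)
  show "finite ((\<lambda>e. (e $ 1, e $ 2)) ` {e :: int^2. \<bar>e $ 1\<bar> \<le> n \<and> \<bar>e $ 2\<bar> \<le> n})"
    by (rule finite_subset[of _ "{-n..n} \<times> {-n..n}"]) auto
  show "inj_on (\<lambda>e. (e $ 1, e $ 2)) {e :: int^2. \<bar>e $ 1\<bar> \<le> n \<and> \<bar>e $ 2\<bar> \<le> n}"
    by (auto intro!: inj_onI simp: vec_eq_iff forall_2)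
qed

lemma finite_stencil:
  assumes h: "h > 0"
  shows "finite {e. x + h *\<^sub>R of_int_vec e \<in> square}"
proof (rule finite_subset[OF _ finite_int_vec_box])
  let ?n = "\<lceil>(1 + \<bar>x $ 1\<bar> + \<bar>x $ 2\<bar>) / h\<rceil>"
  show "{e. x + h *\<^sub>R of_int_vec e \<in> square} \<subseteq> {e. \<bar>e $ 1\<bar> \<le> ?n \<and> \<bar>e $ 2\<bar> \<le> ?n}"
  proof clarify
    fix e assume "x + h *\<^sub>R of_int_vec e \<in> square"
    then have *: "\<bar>x $ i + h * of_int (e $ i)\<bar> \<le> 1" for i
      using exhaust_2[of i] by (auto simp: square_iff of_int_vec_def)
    have "of_int \<bar>e $ i\<bar> \<le> (1 + \<bar>x $ 1\<bar> + \<bar>x $ 2\<bar>) / h" for i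
    proof -
      have "h * of_int \<bar>e $ i\<bar> = \<bar>h * of_int (e $ i)\<bar>" using h by (simp add: abs_mult)
      also have "\<dots> \<le> 1 + \<bar>x $ i\<bar>" using *[of i] by linarith
      also have "\<dots> \<le> 1 + \<bar>x $ 1\<bar> + \<bar>x $ 2\<bar>" using exhaust_2[of i] by auto
      finally show ?thesis using h by (simp add: field_simps)
    qed
    then have "\<lceil>real_of_int \<bar>e $ i\<bar>\<rceil> \<le> ?n" for i by (rule ceiling_mono)
    then have "\<bar>e $ i\<bar> \<le> ?n" for i by (simp only: ceiling_of_int)
    then show "\<bar>e $ 1\<bar> \<le> ?n \<and> \<bar>e $ 2\<bar> \<le> ?n" by blast
  qed
qed

lemma finite_grid_square:
  assumes "h > 0"
  shows "finite (grid h \<inter> square)"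
proof -
  have "grid h \<inter> square \<subseteq> (\<lambda>e. h *\<^sub>R of_int_vec e) ` {e. 0 + h *\<^sub>R of_int_vec e \<in> square}"
    unfolding grid_def by auto
  then show ?thesis using finite_stencil[OF assms] by (meson finite_imageI finite_subset)
qed

lemma inner_le_support_fun:
  assumes Y: "bounded Y" and y: "y \<in> closure Y"
  shows "y \<bullet> z \<le> support_fun Y z"
  unfolding support_fun_def
proof (rule cSUP_upper[OF y])
  obtain R where R: "closure Y \<subseteq> cball 0 R"
    using compact_norm_bound[of "closure Y"] Y by (metis compact_closure)
  have "y \<bullet> z \<le> R * norm z" if "y \<in> closure Y" for y
  proof -
    have "norm y \<le> R" using that R by auto
    then have "norm y * norm z \<le> R * norm z" by (intro mult_right_mono) auto
    then show ?thesis using norm_cauchy_schwarz[of y z] by linarith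
  qed
  then show "bdd_above ((\<lambda>y. y \<bullet> z) ` closure Y)" by (auto intro!: bdd_aboveI2)
qed

lemma support_fun_le:
  assumes Y: "Y \<noteq> {}" and R: "closure Y \<subseteq> cball 0 R"
  shows "support_fun Y z \<le> R * norm z"
  unfolding support_fun_def
proof (rule cSUP_least)
  fix y assume "y \<in> closure Y"
  then have "norm y \<le> R" using R by auto
  then have "norm y * norm z \<le> R * norm z" by (intro mult_right_mono) auto
  then show "y \<bullet> z \<le> R * norm z" using norm_cauchy_schwarz[of y z] by linarith
qed (use Y in auto)

lemma of_int_vec_axes:
  "of_int_vec (vector [1, 0]) = axis 1 1" "of_int_vec (vector [-1, 0]) = - axis 1 1"
  "of_int_vec (vector [0, 1]) = axis 2 1" "of_int_vec (vector [0, -1]) = - axis 2 1"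
  by (simp_all add: of_int_vec_def vec_eq_iff forall_2 axis_def)

section \<open>The convex function of a grid function\<close>

text \<open>The part of the setting in which \<open>U\<close> is an arbitrary grid function. The radius \<open>R\<close> only depends on
  \<open>Y\<close>, so that bounds in terms of \<open>R\<close> are uniform along the sequence of grids.\<close>

locale grid_potential =
  fixes Y :: "(real^2) set" and R :: real and V :: "(int^2) set" and h :: real and U :: "real^2 \<Rightarrow> real"
  assumes Y_bounded: "bounded Y" and Y_nonempty: "Y \<noteq> {}" and Y_ball: "closure Y \<subseteq> cball 0 R"
    and h_pos: "h > 0"
    and V_axes: "{vector [1, 0], vector [-1, 0], vector [0, 1], vector [0, -1]} \<subseteq> V"
begin

abbreviation "nodes \<equiv> grid h \<inter> square"
abbreviation "polygon \<equiv> outer_polygon Y V"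
abbreviation "dual_U \<equiv> grid_conjugate h U"
abbreviation "u \<equiv> convex_extension Y V h U"

lemma polygonD: "y \<in> polygon \<Longrightarrow> e \<in> V \<Longrightarrow> y \<bullet> of_int_vec e \<le> support_fun Y (of_int_vec e)"
  unfolding outer_polygon_def by blast

lemma closure_subset_polygon: "closure Y \<subseteq> polygon"
  unfolding outer_polygon_def using inner_le_support_fun[OF Y_bounded] by blast

lemma polygon_ball: "polygon \<subseteq> cball 0 (2 * R)"
proof
  fix y assume y: "y \<in> polygon"
  have *: "y \<bullet> of_int_vec e \<le> R * norm (of_int_vec e)" if "e \<in> V" for e
    using polygonD[OF y that] support_fun_le[OF Y_nonempty Y_ball, of "of_int_vec e"] by linarith
  have "\<bar>y $ 1\<bar> \<le> R" "\<bar>y $ 2\<bar> \<le> R"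
    using *[of "vector [1, 0]"] *[of "vector [-1, 0]"] *[of "vector [0, 1]"] *[of "vector [0, -1]"] V_axes
    by (auto simp: of_int_vec_axes inner_axis abs_le_iff)
  moreover have "norm y \<le> \<bar>y $ 1\<bar> + \<bar>y $ 2\<bar>"
    using norm_le_l1_cart[of y] by (simp add: sum_2)
  ultimately show "y \<in> cball 0 (2 * R)" by simp
qed

lemma polygon_compact: "compact polygon"
proof -
  have "polygon = (\<Inter>e\<in>V. {y. y \<bullet> of_int_vec e \<le> support_fun Y (of_int_vec e)})"
    unfolding outer_polygon_def by auto
  also have "closed \<dots>" by (intro closed_INT ballI closed_Collect_le continuous_intros)
  finally have "closed polygon" .
  moreover have "bounded polygon" by (rule bounded_subset[OF bounded_cball polygon_ball])
  ultimately show ?thesis by (simp add: compact_eq_bounded_closed)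
qed

lemma finite_nodes: "finite nodes" by (rule finite_grid_square[OF h_pos])

lemma dual_U_ge: "x \<in> nodes \<Longrightarrow> y \<bullet> x - U x \<le> dual_U y"
  unfolding grid_conjugate_def by (rule Max_ge) (use finite_nodes in auto)

lemma dual_U_attained: "\<exists>x\<in>nodes. dual_U y = y \<bullet> x - U x"
proof -
  have "dual_U y \<in> (\<lambda>x. y \<bullet> x - U x) ` nodes"
    unfolding grid_conjugate_def by (rule Max_in) (use finite_nodes zero_in_grid in blast)+
  then show ?thesis by blast
qed

lemma dual_U_continuous: "continuous_on A dual_U"
proof -
  have sq: "norm x \<le> 2" if "x \<in> nodes" for x
    using that norm_le_l1_cart[of x] by (auto simp: sum_2 square_iff)
  have le: "dual_U y - dual_U z \<le> 2 * norm (y - z)" for y z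
  proof -
    obtain x where x: "x \<in> nodes" "dual_U y = y \<bullet> x - U x" using dual_U_attained by blast
    have "dual_U y - dual_U z \<le> (y - z) \<bullet> x"
      using dual_U_ge[OF x(1), of z] x(2) by (simp add: inner_diff_left)
    also have "\<dots> \<le> norm (y - z) * norm x" by (rule norm_cauchy_schwarz)
    also have "\<dots> \<le> norm (y - z) * 2" by (intro mult_left_mono sq x(1)) simp
    finally show ?thesis by simp
  qed
  have "2-lipschitz_on A dual_U"
  proof (rule lipschitz_onI)
    show "dist (dual_U y) (dual_U z) \<le> 2 * dist y z" for y z
      using le[of y z] le[of z y] by (simp add: dist_norm norm_minus_commute abs_le_iff)
  qed simp
  then show ?thesis by (rule lipschitz_on_continuous_on)
qed

lemma u_attained: "\<exists>y\<in>polygon. u x = x \<bullet> y - dual_U y"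
  and u_ge: "y \<in> polygon \<Longrightarrow> x \<bullet> y - dual_U y \<le> u x"
proof -
  have cont: "continuous_on polygon (\<lambda>y. x \<bullet> y - dual_U y)"
    by (intro continuous_intros dual_U_continuous)
  have ne: "polygon \<noteq> {}" using closure_subset_polygon Y_nonempty by auto
  obtain y0 where y0: "y0 \<in> polygon" "\<forall>y\<in>polygon. x \<bullet> y - dual_U y \<le> x \<bullet> y0 - dual_U y0"
    using continuous_attains_sup[OF polygon_compact ne cont] by blast
  have eq: "u x = x \<bullet> y0 - dual_U y0"
    unfolding convex_extension_def by (rule cSup_eq_maximum) (use y0 in auto)
  show "\<exists>y\<in>polygon. u x = x \<bullet> y - dual_U y" using y0(1) eq by blast
  show "y \<in> polygon \<Longrightarrow> x \<bullet> y - dual_U y \<le> u x" using y0(2) eq by auto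
qed

lemma u_directional:
  assumes "e \<in> V"
  shows "u (x + of_int_vec e) \<le> u x + support_fun Y (of_int_vec e)"
proof -
  obtain y where y: "y \<in> polygon" "u (x + of_int_vec e) = (x + of_int_vec e) \<bullet> y - dual_U y"
    using u_attained by blast
  show ?thesis
    using u_ge[OF y(1), of x] polygonD[OF y(1) assms] unfolding y(2)
    by (simp add: inner_add_left inner_add_right inner_commute)
qed

text \<open>The supremum that defines \<open>u x\<close> is attained, and a maximiser is a subgradient. Conversely, the
  increments of \<open>u\<close> in the directions \<open>e \<in> V\<close> are at most the support function, which is the
  condition that defines the polygon.\<close>

lemma u_slopes: "has_slopes_in u polygon"
  unfolding has_slopes_in_def
proof (intro allI conjI subsetI)
  fix x
  obtain y where y: "y \<in> polygon" "u x = x \<bullet> y - dual_U y" using u_attained by blast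
  have "u x + y \<bullet> (z - x) \<le> u z" for z
    using u_ge[OF y(1), of z] y(2) by (simp add: inner_diff_right inner_commute)
  then have "y \<in> subgrads u x" unfolding subgrads_def by blast
  then show "subgrads u x \<noteq> {}" by blast
  fix p assume p: "p \<in> subgrads u x"
  show "p \<in> polygon" unfolding outer_polygon_def
  proof (intro CollectI ballI)
    fix e assume "e \<in> V"
    with u_directional[OF this, of x] subgradsD[OF p, of "x + of_int_vec e"]
    show "p \<bullet> of_int_vec e \<le> support_fun Y (of_int_vec e)" by simp
  qed
qed

lemma u_le_U:
  assumes "x \<in> nodes"
  shows "u x \<le> U x"
proof -
  obtain y where y: "y \<in> polygon" "u x = x \<bullet> y - dual_U y" using u_attained by blast
  show ?thesis using dual_U_ge[OF assms, of y] y(2) by (simp add: inner_commute)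
qed

definition contact_cell :: "real^2 \<Rightarrow> (real^2) set" where
  "contact_cell x = {y \<in> closure Y. dual_U y = y \<bullet> x - U x}"

text \<open>A contact slope gives an affine function below \<open>U\<close> on the whole grid that equals \<open>U\<close> at \<open>x\<close>; this
  function is also below \<open>u\<close>. At nodes with an empty contact cell, \<open>u\<close> may be smaller than \<open>U\<close>.\<close>

lemma contact:
  assumes x: "x \<in> nodes" and y: "y \<in> contact_cell x"
  shows "u x = U x" "y \<in> subgrads u x"
proof -
  have y': "y \<in> polygon" "dual_U y = y \<bullet> x - U x"
    using y closure_subset_polygon unfolding contact_cell_def by auto
  show ux: "u x = U x"
    using u_ge[OF y'(1), of x] y'(2) u_le_U[OF x] by (simp add: inner_commute)
  show "y \<in> subgrads u x" unfolding subgrads_def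
  proof (intro CollectI allI)
    show "u x + y \<bullet> (z - x) \<le> u z" for z
      using u_ge[OF y'(1), of z] y'(2) ux by (simp add: inner_diff_right inner_commute)
  qed
qed

lemma contact_cell_compact: "compact (contact_cell x)"
proof -
  have "contact_cell x = closure Y \<inter> {y. dual_U y = y \<bullet> x - U x}"
    unfolding contact_cell_def by blast
  also have "closed \<dots>"
    by (intro closed_Int closed_closure closed_Collect_eq continuous_intros dual_U_continuous)
  finally have "closed (contact_cell x)" .
  moreover have "bounded (contact_cell x)"
    by (rule bounded_subset[OF bounded_cball[of 0 R]]) (use Y_ball in \<open>auto simp: contact_cell_def\<close>)
  ultimately show ?thesis by (simp add: compact_eq_bounded_closed)
qed

lemma contact_cells_cover: "y \<in> closure Y \<Longrightarrow> \<exists>x\<in>nodes. y \<in> contact_cell x"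
  using dual_U_attained[of y] unfolding contact_cell_def by auto

lemma contact_cell_increment:
  assumes x: "x \<in> nodes" and y: "y \<in> contact_cell x" and e: "x + h *\<^sub>R of_int_vec e \<in> square"
  shows "h * (y \<bullet> of_int_vec e) \<le> delta h e U x"
proof -
  have "x + h *\<^sub>R of_int_vec e \<in> nodes" using x e grid_shift by blast
  from dual_U_ge[OF this, of y] y show ?thesis
    unfolding contact_cell_def delta_def by (simp add: inner_add_right)
qed

lemma contact_cell_increment_ext:
  assumes x: "x \<in> nodes" and y: "y \<in> contact_cell x"
  shows "h * (y \<bullet> of_int_vec e) \<le> delta_ext Y h e U x"
proof (cases "x + h *\<^sub>R of_int_vec e \<in> square")
  case True
  then show ?thesis using contact_cell_increment[OF x y True] by (simp add: delta_ext_def delta_def)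
next
  case False
  have "y \<in> closure Y" using y unfolding contact_cell_def by blast
  then show ?thesis using False inner_le_support_fun[OF Y_bounded, of y "h *\<^sub>R of_int_vec e"]
    by (simp add: delta_ext_def)
qed

end

section \<open>Estimates for solutions of the scheme\<close>

lemma of_int_vec_norm_axes:
  "e \<in> {vector [1, 0], vector [-1, 0], vector [0, 1], vector [0, -1]} \<Longrightarrow> norm (of_int_vec e) = 1"
  by (auto simp: of_int_vec_axes)

lemma int_vec_step_to_0:
  fixes z :: "int^2"
  assumes "z \<noteq> 0"
  shows "\<exists>e\<in>{vector [1, 0], vector [-1, 0], vector [0, 1], vector [0, -1]}.
    \<bar>(z + e) $ 1\<bar> \<le> \<bar>z $ 1\<bar> \<and> \<bar>(z + e) $ 2\<bar> \<le> \<bar>z $ 2\<bar> \<and> \<bar>(z + e) $ 1\<bar> + \<bar>(z + e) $ 2\<bar> = \<bar>z $ 1\<bar> + \<bar>z $ 2\<bar> - 1"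
proof -
  have "z $ 1 \<noteq> 0 \<or> z $ 2 \<noteq> 0" using assms by (auto simp: vec_eq_iff forall_2)
  then consider "z $ 1 > 0" | "z $ 1 < 0" | "z $ 2 > 0" | "z $ 2 < 0" by linarith
  then show ?thesis
  proof cases
    case 1 then show ?thesis by (intro bexI[of _ "vector [-1, 0]"]) auto
  next
    case 2 then show ?thesis by (intro bexI[of _ "vector [1, 0]"]) auto
  next
    case 3 then show ?thesis by (intro bexI[of _ "vector [0, -1]"]) auto
  next
    case 4 then show ?thesis by (intro bexI[of _ "vector [0, 1]"]) auto
  qed
qed

locale scheme_step = grid_potential Y R V h U
  for Y R V h U +
  fixes X :: "(real^2) set" and f g :: "real^2 \<Rightarrow> real" and m\<^sub>f m\<^sub>g :: real
    and nabla :: "(real^2 \<Rightarrow> real) \<Rightarrow> real^2 \<Rightarrow> real^2"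
  assumes X_open: "open X" and X_bounded: "bounded X" and X_square: "X \<subseteq> square"
    and Y_open: "open Y"
    and m_pos: "m\<^sub>f > 0" "m\<^sub>g > 0"
    and f_integrable: "integrable lebesgue f" and f_outside: "\<And>x. x \<notin> X \<Longrightarrow> f x = 0"
    and f_lower: "\<And>x. x \<in> X \<Longrightarrow> m\<^sub>f \<le> f x"
    and g_cont: "continuous_on UNIV g" and g_lower: "\<And>y. m\<^sub>g \<le> g y"
    and g_mass: "(LINT y:Y|lborel. g y) = 1"
    and V_finite: "finite V" and V_nonzero: "\<And>e. e \<in> V \<Longrightarrow> e \<noteq> 0"
    and V_stencil: "\<And>x e. x \<in> X \<Longrightarrow> e \<in> V \<Longrightarrow> x + h *\<^sub>R of_int_vec e \<in> square"
    and solution: "scheme_solution X f Y g h V nabla U"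
begin

abbreviation "\<mu> \<equiv> source_measure f"
abbreviation "\<nu> \<equiv> target_measure Y g"
abbreviation "cell x \<equiv> box (x - vec (h / 2)) (x + vec (h / 2)) :: (real^2) set"
abbreviation "axes \<equiv> {vector [1, 0], vector [-1, 0], vector [0, 1], vector [0, -1]} :: (int^2) set"

lemma f_nonneg: "0 \<le> f x"
  using f_outside[of x] f_lower[of x] m_pos by (cases "x \<in> X") auto

lemma g_nonneg: "0 \<le> g y"
  using g_lower[of y] m_pos by linarith

lemma finite_mu: "finite_measure \<mu>" by (rule finite_source[OF f_integrable f_nonneg])

lemma finite_nu: "finite_measure \<nu>" by (rule finite_target[OF g_cont g_nonneg Y_open g_mass])

lemma measure_cell: "measure \<mu> (cell x) = h\<^sup>2 * cell_average h f x"
  by (rule measure_source_cell[OF f_integrable f_nonneg h_pos])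

lemma source_pos:
  assumes "open A" "A \<noteq> {}" "A \<subseteq> X"
  shows "0 < measure \<mu> A"
  using assms f_lower X_bounded bounded_subset[of X A]
  by (intro measure_source_pos[OF f_integrable f_nonneg, where m = "m\<^sub>f"]) (auto intro: m_pos)

lemma cell_pos:
  assumes "x \<in> X"
  shows "0 < measure \<mu> (cell x)"
proof -
  interpret finite_measure \<mu> by (rule finite_mu)
  have "x \<in> cell x" using h_pos by (simp add: mem_box_cart vec_def)
  then have "0 < measure \<mu> (cell x \<inter> X)" using assms X_open by (intro source_pos) auto
  also have "\<dots> \<le> measure \<mu> (cell x)"
    using X_open by (intro finite_measure_mono) (auto simp: source_measure_def)
  finally show ?thesis .
qed

lemma MA_equation: "x \<in> grid h \<inter> X \<Longrightarrow> MA h U x = cell_average h f x / g (nabla U x)"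
  and MA0_equation: "x \<in> grid h \<inter> (square - X) \<Longrightarrow> MA0 Y V h U x = 0"
  and U_0: "U 0 = 0"
  using solution unfolding scheme_solution_def by blast+

definition MA_values :: "real^2 \<Rightarrow> real set" where
  "MA_values x = {H (Delta_plus h e U x) (Delta_plus h e' U x) (Delta_plus h e'' U x) | e e' e''.
            superbase e e' e'' \<and> in_stencil h x e \<and> in_stencil h x e' \<and> in_stencil h x e''}"

lemma finite_MA_values: "finite (MA_values x)"
proof -
  let ?F = "{e. x + h *\<^sub>R of_int_vec e \<in> square}"
  have "MA_values x \<subseteq> (\<lambda>(e, e', e''). H (Delta_plus h e U x) (Delta_plus h e' U x) (Delta_plus h e'' U x)) `
      (?F \<times> ?F \<times> ?F)"
    unfolding MA_values_def in_stencil_def by (force simp: image_iff)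
  then show ?thesis using finite_stencil[OF h_pos, of x] by (meson finite_SigmaI finite_imageI finite_subset)
qed

lemma standard_superbase:
  "superbase (vector [1, 0]) (vector [0, 1]) (vector [-1, -1])"
  by (simp add: superbase_def det_2 vec_eq_iff forall_2)

lemma standard_stencil:
  assumes "x \<in> X"
  shows "in_stencil h x (vector [1, 0])" "in_stencil h x (vector [0, 1])" "in_stencil h x (vector [-1, -1])"
proof -
  have *: "x + h *\<^sub>R of_int_vec e \<in> square" if "e \<in> axes" for e
    using V_stencil[OF assms] V_axes that by blast
  have "\<bar>x $ 1 + h\<bar> \<le> 1" "\<bar>x $ 1 - h\<bar> \<le> 1" "\<bar>x $ 2 + h\<bar> \<le> 1" "\<bar>x $ 2 - h\<bar> \<le> 1"
    using *[of "vector [1, 0]"] *[of "vector [-1, 0]"] *[of "vector [0, 1]"] *[of "vector [0, -1]"]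
    by (simp_all add: square_iff of_int_vec_def)
  moreover have "x \<in> square" using assms X_square by blast
  ultimately show "in_stencil h x (vector [1, 0])" "in_stencil h x (vector [0, 1])"
    "in_stencil h x (vector [-1, -1])"
    by (simp_all add: in_stencil_def square_iff of_int_vec_def)
qed

lemma MA_values_standard:
  assumes "x \<in> X"
  shows "H (Delta_plus h (vector [1, 0]) U x) (Delta_plus h (vector [0, 1]) U x)
      (Delta_plus h (vector [-1, -1]) U x) \<in> MA_values x"
  unfolding MA_values_def using standard_superbase standard_stencil[OF assms] by blast

lemma MA_eq: "h ^ 4 * MA h U x = Min (MA_values x)"
  unfolding MA_def MA_values_def using h_pos by simp

text \<open>Every superbase in the stencil bounds the area of the contact cell, hence so does the minimum in
  \<^const>\<open>MA\<close>: the operator overestimates the Monge-Ampere measure.\<close>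

lemma contact_cell_volume:
  assumes x: "x \<in> grid h \<inter> X"
  shows "measure lebesgue (contact_cell x) * g (nabla U x) \<le> measure \<mu> (cell x)"
proof -
  have node: "x \<in> nodes" using x X_square by blast
  have "h\<^sup>2 * measure lebesgue (contact_cell x) \<le> v" if v_value: "v \<in> MA_values x" for v
  proof -
    obtain e e' e'' where v: "v = H (Delta_plus h e U x) (Delta_plus h e' U x) (Delta_plus h e'' U x)"
      and sb: "superbase e e' e''" and st: "in_stencil h x e" "in_stencil h x e'" "in_stencil h x e''"
      using v_value unfolding MA_values_def by blast
    have bounds: "- delta h (- d) U x \<le> h * (y \<bullet> of_int_vec d) \<and> h * (y \<bullet> of_int_vec d) \<le> delta h d U x"
      if y: "y \<in> contact_cell x" and d: "d \<in> {e, e', e''}" for y d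
    proof -
      have "in_stencil h x d" using st d by blast
      then have "x + h *\<^sub>R of_int_vec d \<in> square" "x + h *\<^sub>R of_int_vec (- d) \<in> square"
        unfolding in_stencil_def by (simp_all add: of_int_vec_minus)
      from this[THEN contact_cell_increment[OF node y]] show ?thesis
        by (simp add: of_int_vec_minus)
    qed
    from measure_superbase_cell[OF sb contact_cell_compact bounds]
    show ?thesis unfolding v Delta_plus_def Delta_def .
  qed
  then have "h\<^sup>2 * measure lebesgue (contact_cell x) \<le> Min (MA_values x)"
    using MA_values_standard[of x] finite_MA_values[of x] x by (intro Min.boundedI) auto
  also have "\<dots> = h\<^sup>2 * (h\<^sup>2 * (cell_average h f x / g (nabla U x)))"
    unfolding MA_eq[symmetric] MA_equation[OF x] by (simp add: power2_eq_square power4_eq_xxxx)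
  finally have "measure lebesgue (contact_cell x) \<le> h\<^sup>2 * (cell_average h f x / g (nabla U x))"
    by (rule mult_left_le_imp_le) (use h_pos in simp)
  moreover have "g (nabla U x) > 0" using g_lower[of "nabla U x"] m_pos by linarith
  ultimately show ?thesis unfolding measure_cell by (simp add: field_simps)
qed

lemma MA0_range_finite: "finite ({e. e \<noteq> 0 \<and> irreducible_vec e \<and> in_stencil h x e} \<union> V)"
proof -
  have "{e. e \<noteq> 0 \<and> irreducible_vec e \<and> in_stencil h x e} \<subseteq> {e. x + h *\<^sub>R of_int_vec e \<in> square}"
    unfolding in_stencil_def by blast
  then show ?thesis using finite_stencil[OF h_pos, of x] V_finite finite_subset by blast
qed

text \<open>The minimum \<open>0\<close> is attained in some direction \<open>e\<close>. There the upper bounds for \<open>y \<bullet> e\<close> and for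
  \<open>- (y \<bullet> e)\<close> add up to \<open>0\<close>, so they determine \<open>y \<bullet> e\<close>. The bound by \<open>\<sigma>\<close> beyond the edge of the
  square holds because the contact slopes belong to the closure of \<open>Y\<close>.\<close>

lemma contact_cell_null:
  assumes x: "x \<in> grid h \<inter> (square - X)"
  shows "measure lebesgue (contact_cell x) = 0"
proof -
  let ?F = "{e. e \<noteq> 0 \<and> irreducible_vec e \<and> in_stencil h x e} \<union> V"
  have "MA0 Y V h U x \<in> (\<lambda>e. Delta_ext Y h e U x) ` ?F"
    unfolding MA0_def by (rule Min_in) (use MA0_range_finite V_axes in auto)
  then obtain e where e: "e \<in> ?F" "Delta_ext Y h e U x = 0"
    unfolding MA0_equation[OF x] by (metis (no_types, lifting) imageE)
  then have "e \<noteq> 0" using V_nonzero by blast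
  then have "of_int_vec e \<noteq> 0" by (simp add: of_int_vec_def vec_eq_iff)
  then have "negligible {y. of_int_vec e \<bullet> y = delta_ext Y h e U x / h}"
    by (intro negligible_hyperplane) simp
  moreover have "contact_cell x \<subseteq> {y. of_int_vec e \<bullet> y = delta_ext Y h e U x / h}"
  proof
    fix y assume y: "y \<in> contact_cell x"
    have node: "x \<in> nodes" using x by blast
    have "h * (y \<bullet> of_int_vec e) = delta_ext Y h e U x"
      using contact_cell_increment_ext[OF node y, of e] contact_cell_increment_ext[OF node y, of "- e"] e(2)
      unfolding Delta_ext_def by (simp add: of_int_vec_minus)
    then show "y \<in> {y. of_int_vec e \<bullet> y = delta_ext Y h e U x / h}"
      using h_pos by (simp add: field_simps inner_commute)
  qed
  ultimately have "negligible (contact_cell x)" by (rule negligible_subset)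
  then show ?thesis by (rule negligible_imp_measure0)
qed

lemma contact_cell_mass:
  assumes x: "x \<in> nodes" and \<epsilon>: "0 \<le> \<epsilon>"
    and near: "\<And>y. x \<in> X \<Longrightarrow> y \<in> contact_cell x \<Longrightarrow> g y \<le> (1 + \<epsilon>) * g (nabla U x)"
  shows "measure \<nu> (contact_cell x) \<le> (1 + \<epsilon>) * measure \<mu> (cell x)"
proof (cases "x \<in> X")
  case True
  have "measure \<nu> (contact_cell x) \<le> (1 + \<epsilon>) * g (nabla U x) * measure lebesgue (contact_cell x)"
    using near[OF True] \<epsilon> g_nonneg[of "nabla U x"]
    by (intro measure_target_le[OF g_cont Y_open contact_cell_compact]) auto
  also have "\<dots> \<le> (1 + \<epsilon>) * measure \<mu> (cell x)"
    using contact_cell_volume[of x] x True \<epsilon> by (simp add: mult.assoc mult.commute mult_left_mono)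
  finally show ?thesis .
next
  case False
  have "continuous_on (contact_cell x) g" using g_cont continuous_on_subset by blast
  then have "bounded (g ` contact_cell x)"
    using contact_cell_compact compact_continuous_image compact_imp_bounded by blast
  then obtain c where c: "c > 0" "\<forall>v\<in>g ` contact_cell x. norm v \<le> c" using bounded_pos by blast
  then have le: "g y \<le> c" if "y \<in> contact_cell x" for y using that by force
  have "measure \<nu> (contact_cell x) \<le> c * measure lebesgue (contact_cell x)"
    using c(1) by (intro measure_target_le[OF g_cont Y_open contact_cell_compact] le) auto
  also have "\<dots> = 0" using contact_cell_null[of x] x False by simp
  also have "0 \<le> (1 + \<epsilon>) * measure \<mu> (cell x)" using \<epsilon> by simp
  finally show ?thesis .
qed

lemma cells_disjoint: "disjoint_family_on cell (grid h)"
  unfolding disjoint_family_on_def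
proof (intro ballI impI)
  fix x x' assume x: "x \<in> grid h" "x' \<in> grid h" "x \<noteq> x'"
  obtain a a' where a: "x = h *\<^sub>R of_int_vec a" "x' = h *\<^sub>R of_int_vec a'"
    using x unfolding grid_def by blast
  show "cell x \<inter> cell x' = {}"
  proof (rule ccontr)
    assume "cell x \<inter> cell x' \<noteq> {}"
    then obtain z where z: "z \<in> cell x" "z \<in> cell x'" by blast
    have "a $ i = a' $ i" for i
    proof -
      have "\<bar>x $ i - x' $ i\<bar> < h" using z unfolding mem_box_cart by (auto simp: abs_less_iff dest!: spec[of _ i])
      also have "x $ i - x' $ i = h * of_int (a $ i - a' $ i)"
        unfolding a of_int_vec_def by (simp add: algebra_simps)
      finally have "\<bar>real_of_int (a $ i - a' $ i)\<bar> < 1" using h_pos by (simp add: abs_mult)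
      then show ?thesis by linarith
    qed
    then have "a = a'" by (simp add: vec_eq_iff)
    with a x(3) show False by simp
  qed
qed

definition contact_nodes :: "(real^2) set \<Rightarrow> (real^2) set" where
  "contact_nodes C = {x \<in> nodes. contact_cell x \<inter> C \<noteq> {}}"

text \<open>The contact cells may overlap, but an upper bound for \<open>\<nu> C\<close> only uses subadditivity over a cover; on the side
  of \<open>\<mu>\<close> the cells are disjoint.\<close>

lemma target_le_source:
  assumes \<epsilon>: "0 \<le> \<epsilon>"
    and near: "\<And>x y. x \<in> grid h \<inter> X \<Longrightarrow> y \<in> contact_cell x \<Longrightarrow> g y \<le> (1 + \<epsilon>) * g (nabla U x)"
    and C: "closed C"
  shows "measure \<nu> C \<le> (1 + \<epsilon>) * measure \<mu> (\<Union>x\<in>contact_nodes C. cell x)"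
proof -
  interpret mu: finite_measure \<mu> by (rule finite_mu)
  interpret nu: finite_measure \<nu> by (rule finite_nu)
  have sets_nu: "sets \<nu> = sets borel" by (simp add: target_measure_def)
  have fin: "finite (contact_nodes C)" unfolding contact_nodes_def by (rule finite_subset[OF _ finite_nodes]) blast
  have cc: "contact_cell x \<in> sets \<nu>" for x
    unfolding sets_nu using contact_cell_compact[of x] by (simp add: compact_imp_closed)
  have "(C - closure Y) \<inter> Y = {}" using closure_subset[of Y] by blast
  then have null: "measure \<nu> (C - closure Y) = 0"
    using emeasure_target[OF g_cont Y_open, of "C - closure Y"] C by (simp add: measure_def)
  have "measure \<nu> ((C \<inter> closure Y) \<union> (C - closure Y)) = measure \<nu> (C \<inter> closure Y) + measure \<nu> (C - closure Y)"
    using C by (intro nu.finite_measure_Union) (auto simp: sets_nu)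
  then have "measure \<nu> C = measure \<nu> (C \<inter> closure Y)" using null by (simp add: Int_Diff_Un)
  also have "\<dots> \<le> measure \<nu> (\<Union>x\<in>contact_nodes C. contact_cell x)"
  proof (rule nu.finite_measure_mono)
    show "C \<inter> closure Y \<subseteq> (\<Union>x\<in>contact_nodes C. contact_cell x)"
      unfolding contact_nodes_def using contact_cells_cover by blast
    show "(\<Union>x\<in>contact_nodes C. contact_cell x) \<in> sets \<nu>" using fin cc by auto
  qed
  also have "\<dots> \<le> (\<Sum>x\<in>contact_nodes C. measure \<nu> (contact_cell x))"
    using fin cc by (intro nu.finite_measure_subadditive_finite) auto
  also have "\<dots> \<le> (\<Sum>x\<in>contact_nodes C. (1 + \<epsilon>) * measure \<mu> (cell x))"
    using near \<epsilon> by (intro sum_mono contact_cell_mass) (auto simp: contact_nodes_def)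
  also have "\<dots> = (1 + \<epsilon>) * measure \<mu> (\<Union>x\<in>contact_nodes C. cell x)"
  proof -
    have "measure \<mu> (\<Union>x\<in>contact_nodes C. cell x) = (\<Sum>x\<in>contact_nodes C. measure \<mu> (cell x))"
      using fin disjoint_family_on_mono[OF _ cells_disjoint, of "contact_nodes C"]
      by (intro mu.finite_measure_finite_Union) (auto simp: source_measure_def contact_nodes_def)
    then show ?thesis by (simp add: sum_distrib_left)
  qed
  finally show ?thesis .
qed

text \<open>Discrete convexity along the axes. Off \<open>X\<close> it is part of the boundary equation. In \<open>X\<close> the
  right-hand side of the equation is positive, since a cell around a point of the open set \<open>X\<close> has positive
  mass; but \<^const>\<open>H\<close> vanishes as soon as one of its arguments does.\<close>

lemma Delta_ext_axes_nonneg: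
  assumes x: "x \<in> nodes" and e: "e \<in> axes"
  shows "0 \<le> Delta_ext Y h e U x"
proof (cases "x \<in> X")
  case False
  have "Min ((\<lambda>e. Delta_ext Y h e U x) ` ({e. e \<noteq> 0 \<and> irreducible_vec e \<and> in_stencil h x e} \<union> V))
      \<le> Delta_ext Y h e U x"
    using MA0_range_finite V_axes e by (intro Min_le finite_imageI imageI) auto
  then show ?thesis using MA0_equation[of x] x False unfolding MA0_def by simp
next
  case True
  have "0 < measure \<mu> (cell x) / g (nabla U x)"
    using cell_pos[OF True] g_lower[of "nabla U x"] m_pos by (intro divide_pos_pos) auto
  also have "\<dots> = h\<^sup>2 * MA h U x" using MA_equation[of x] x True unfolding measure_cell by simp
  finally have "0 < MA h U x" using h_pos by (simp add: zero_less_mult_iff)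
  then have "0 < Min (MA_values x)" unfolding MA_eq[symmetric] using h_pos by simp
  also have "\<dots> \<le> H (Delta_plus h (vector [1, 0]) U x) (Delta_plus h (vector [0, 1]) U x)
      (Delta_plus h (vector [-1, -1]) U x)"
    by (rule Min_le[OF finite_MA_values MA_values_standard[OF True]])
  finally have H: "0 < H (Delta_plus h (vector [1, 0]) U x) (Delta_plus h (vector [0, 1]) U x)
      (Delta_plus h (vector [-1, -1]) U x)" .
  have H0: "H a b c = 0" if "0 \<le> a" "0 \<le> b" "0 \<le> c" "a = 0 \<or> b = 0" for a b c
    using that(4)
  proof
    assume "a = 0"
    with that show ?thesis by (cases "b = 0 \<and> c = 0") (auto simp: H_def)
  next
    assume "b = 0"
    with that show ?thesis by (cases "a = 0 \<and> c = 0") (auto simp: H_def)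
  qed
  have "Delta_plus h (vector [1, 0]) U x \<noteq> 0" "Delta_plus h (vector [0, 1]) U x \<noteq> 0"
    using H H0[of "Delta_plus h (vector [1, 0]) U x" "Delta_plus h (vector [0, 1]) U x"
        "Delta_plus h (vector [-1, -1]) U x"] by (auto simp: Delta_plus_def)
  then have D: "0 < Delta h (vector [1, 0]) U x" "0 < Delta h (vector [0, 1]) U x"
    by (auto simp: Delta_plus_def max_def split: if_splits)
  have neg: "- vector [1, 0] = (vector [-1, 0] :: int^2)" "- vector [-1, 0] = (vector [1, 0] :: int^2)"
    "- vector [0, 1] = (vector [0, -1] :: int^2)" "- vector [0, -1] = (vector [0, 1] :: int^2)"
    by (simp_all add: vec_eq_iff forall_2)
  have "0 \<le> Delta h e U x" using D e neg unfolding Delta_def by auto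
  moreover have "x + h *\<^sub>R of_int_vec e \<in> square" "x + h *\<^sub>R of_int_vec (- e) \<in> square"
    using V_stencil[OF True] V_axes e neg by auto
  ultimately show ?thesis unfolding Delta_ext_def Delta_def delta_ext_def delta_def by simp
qed

text \<open>Along an axis the increments of \<open>U\<close> do not decrease, and the last one, across the edge of the square, is by
  definition the value of the support function. The induction counts the steps to the edge.\<close>

lemma delta_ext_axes_le:
  assumes x: "x \<in> nodes" and e: "e \<in> axes"
  shows "delta_ext Y h e U x \<le> support_fun Y (h *\<^sub>R of_int_vec e)"
proof -
  have "delta_ext Y h e U x \<le> support_fun Y (h *\<^sub>R of_int_vec e)"
    if "x \<in> nodes" "x + real k *\<^sub>R (h *\<^sub>R of_int_vec e) \<notin> square" for k x
    using that
  proof (induction k arbitrary: x)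
    case 0
    then show ?case by simp
  next
    case (Suc k)
    define x' where "x' = x + h *\<^sub>R of_int_vec e"
    show ?case
    proof (cases "x' \<in> square")
      case False
      then show ?thesis unfolding delta_ext_def x'_def by simp
    next
      case True
      have x': "x' \<in> nodes" using True Suc.prems(1) grid_shift unfolding x'_def by blast
      have "x' + real k *\<^sub>R (h *\<^sub>R of_int_vec e) = x + real (Suc k) *\<^sub>R (h *\<^sub>R of_int_vec e)"
        unfolding x'_def by (simp add: algebra_simps)
      then have "delta_ext Y h e U x' \<le> support_fun Y (h *\<^sub>R of_int_vec e)"
        using Suc.IH[OF x'] Suc.prems(2) by metis
      moreover have "0 \<le> Delta_ext Y h e U x'" by (rule Delta_ext_axes_nonneg[OF x' e])
      moreover have "x' + h *\<^sub>R of_int_vec (- e) = x"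
        unfolding x'_def by (simp add: of_int_vec_minus)
      then have "delta_ext Y h (- e) U x' = U x - U x'"
        using Suc.prems(1) by (simp add: delta_ext_def)
      moreover have "delta_ext Y h e U x = U x' - U x"
        using True by (simp add: delta_ext_def x'_def)
      ultimately show ?thesis unfolding Delta_ext_def by linarith
    qed
  qed
  moreover have "\<exists>k. x + real k *\<^sub>R (h *\<^sub>R of_int_vec e) \<notin> square"
  proof -
    have sq: "norm z \<le> 2" if "z \<in> square" for z :: "real^2"
      using that norm_le_l1_cart[of z] by (auto simp: sum_2 square_iff)
    \<comment> \<open>Points of the square have norm at most \<open>2\<close>, so a shift by more than \<open>4\<close> leaves it.\<close>
    obtain k :: nat where k: "4 / h < real k" using reals_Archimedean2 by blast
    have "4 < norm (real k *\<^sub>R (h *\<^sub>R of_int_vec e))"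
      using k h_pos of_int_vec_norm_axes[OF e] by (simp add: field_simps)
    also have "\<dots> \<le> norm (x + real k *\<^sub>R (h *\<^sub>R of_int_vec e)) + norm x"
      using norm_triangle_ineq4[of "x + real k *\<^sub>R (h *\<^sub>R of_int_vec e)" x] by simp
    finally show ?thesis using sq[of x] sq[of "x + real k *\<^sub>R (h *\<^sub>R of_int_vec e)"] x by force
  qed
  ultimately show ?thesis using x by blast
qed

text \<open>Unlike \<open>u\<close>, the grid function is not known to be convex, so its Lipschitz bound is obtained along
  a grid path to the origin that follows the axes. Together with \<open>contact\<close> it relates \<open>u\<close> near the
  origin to the normalisation \<open>U 0 = 0\<close>.\<close>

lemma U_lower:
  assumes "x \<in> nodes"
  shows "- (R * (\<bar>x $ 1\<bar> + \<bar>x $ 2\<bar>)) \<le> U x"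
proof -
  have "- (R * (\<bar>x $ 1\<bar> + \<bar>x $ 2\<bar>)) \<le> U x"
    if "x = h *\<^sub>R of_int_vec z" "x \<in> square" "nat (\<bar>z $ 1\<bar> + \<bar>z $ 2\<bar>) = k" for x z k
    using that
  proof (induction k arbitrary: x z)
    case 0
    then have "z = 0" by (auto simp: vec_eq_iff forall_2)
    then show ?case using 0 U_0 by (simp add: of_int_vec_0)
  next
    case (Suc k)
    then have "z \<noteq> 0" by auto
    then obtain e where e: "e \<in> axes" "\<bar>(z + e) $ 1\<bar> \<le> \<bar>z $ 1\<bar>" "\<bar>(z + e) $ 2\<bar> \<le> \<bar>z $ 2\<bar>"
        "\<bar>(z + e) $ 1\<bar> + \<bar>(z + e) $ 2\<bar> = \<bar>z $ 1\<bar> + \<bar>z $ 2\<bar> - 1"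
      using int_vec_step_to_0 by blast
    define x' where "x' = h *\<^sub>R of_int_vec (z + e)"
    have comp: "\<bar>(h *\<^sub>R of_int_vec w :: real^2) $ i\<bar> = h * of_int \<bar>w $ i\<bar>" for w i
      using h_pos by (simp add: of_int_vec_def abs_mult)
    have "\<bar>x' $ 1\<bar> \<le> \<bar>x $ 1\<bar>" "\<bar>x' $ 2\<bar> \<le> \<bar>x $ 2\<bar>"
      unfolding x'_def Suc.prems(1) comp using e(2,3) h_pos by (simp_all only: mult_le_cancel_left_pos of_int_le_iff)
    then have sq: "x' \<in> square" using Suc.prems(2) unfolding square_iff by linarith
    have IH: "- (R * (\<bar>x' $ 1\<bar> + \<bar>x' $ 2\<bar>)) \<le> U x'"
      by (rule Suc.IH[OF x'_def sq]) (use Suc.prems(3) e(4) in linarith)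
    have "\<bar>x' $ 1\<bar> + \<bar>x' $ 2\<bar> = h * of_int (\<bar>(z + e) $ 1\<bar> + \<bar>(z + e) $ 2\<bar>)"
      unfolding x'_def comp by (simp add: algebra_simps)
    also have "\<dots> = \<bar>x $ 1\<bar> + \<bar>x $ 2\<bar> - h"
      unfolding e(4) Suc.prems(1) comp by (simp add: algebra_simps)
    finally have len: "\<bar>x' $ 1\<bar> + \<bar>x' $ 2\<bar> = \<bar>x $ 1\<bar> + \<bar>x $ 2\<bar> - h" .
    have x': "x' = x + h *\<^sub>R of_int_vec e" unfolding x'_def Suc.prems(1) by (simp add: of_int_vec_add algebra_simps)
    have "x \<in> nodes" using Suc.prems(1,2) unfolding grid_def by blast
    from delta_ext_axes_le[OF this e(1)] sq have "U x' - U x \<le> support_fun Y (h *\<^sub>R of_int_vec e)"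
      unfolding delta_ext_def x' by simp
    also have "\<dots> \<le> R * norm (h *\<^sub>R of_int_vec e)" by (rule support_fun_le[OF Y_nonempty Y_ball])
    also have "\<dots> = R * h" using h_pos of_int_vec_norm_axes[OF e(1)] by simp
    finally show ?case using IH unfolding len by (simp add: algebra_simps)
  qed
  moreover obtain z where "x = h *\<^sub>R of_int_vec z" using assms unfolding grid_def by blast
  ultimately show ?thesis using assms by blast
qed

end

section \<open>Limits of the convex functions\<close>

text \<open>Convexity holds because a subgradient at the convex combination is an affine minorant.\<close>

lemma has_slopes_convex_lsc:
  fixes w :: "real^2 \<Rightarrow> real"
  assumes w: "has_slopes_in w K" "compact K"
  shows "convex_lsc (\<lambda>x. ereal (w x))"
  unfolding convex_lsc_def
proof (intro conjI allI)
  show "convex {(x, r). ereal (w x) \<le> ereal r}"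
  proof -
    have "convex {(x, r). w x \<le> r}"
    proof (rule convexI)
      fix P Q and a b :: real
      assume PQ: "P \<in> {(x, r). w x \<le> r}" "Q \<in> {(x, r). w x \<le> r}" and ab: "0 \<le> a" "0 \<le> b" "a + b = 1"
      obtain x r z s where P: "P = (x, r)" and Q: "Q = (z, s)" by (cases P, cases Q)
      let ?c = "a *\<^sub>R x + b *\<^sub>R z"
      obtain p where p: "p \<in> subgrads w ?c" using w(1) unfolding has_slopes_in_def by blast
      have "a * (w ?c + p \<bullet> (x - ?c)) \<le> a * r"
        using PQ(1) ab subgradsD[OF p, of x] unfolding P by (intro mult_left_mono) auto
      moreover have "b * (w ?c + p \<bullet> (z - ?c)) \<le> b * s"
        using PQ(2) ab subgradsD[OF p, of z] unfolding Q by (intro mult_left_mono) auto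
      moreover have "a * (w ?c + p \<bullet> (x - ?c)) + b * (w ?c + p \<bullet> (z - ?c)) =
          (a + b) * w ?c + p \<bullet> (?c - (a + b) *\<^sub>R ?c)"
        by (simp add: algebra_simps inner_simps)
      ultimately have "w ?c \<le> a * r + b * s" using ab(3) by simp
      then show "a *\<^sub>R P + b *\<^sub>R Q \<in> {(x, r). w x \<le> r}" unfolding P Q by simp
    qed
    then show ?thesis by simp
  qed
  fix x
  have "isCont w x" using has_slopes_in_continuous[OF w, of UNIV] by (simp add: continuous_on_eq_continuous_at)
  then have "((\<lambda>z. ereal (w z)) \<longlongrightarrow> ereal (w x)) (at x)" by (simp add: isCont_def)
  then have "Liminf (at x) (\<lambda>z. ereal (w z)) = ereal (w x)" by (intro lim_imp_Liminf) simp
  then show "ereal (w x) \<le> Liminf (at x) (\<lambda>z. ereal (w z))" by simp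
qed simp

lemma subgrads_limit_compact:
  fixes w :: "'a::euclidean_space \<Rightarrow> real"
  assumes lim: "\<And>z. (\<lambda>n. u n z) \<longlonglongrightarrow> w z"
    and slopes: "\<And>n. has_slopes_in (u n) (cball 0 B)"
    and s: "strict_mono s"
    and xs: "\<And>n. xs n \<in> Q" "compact Q" and ys: "\<And>n. ys n \<in> subgrads (u (s n)) (xs n)"
  shows "\<exists>x\<in>Q. \<exists>y\<in>subgrads w x. \<exists>r :: nat \<Rightarrow> nat. strict_mono r \<and> (xs \<circ> r) \<longlonglongrightarrow> x \<and> (ys \<circ> r) \<longlonglongrightarrow> y"
proof -
  have "(xs n, ys n) \<in> Q \<times> cball 0 B" for n
    using xs(1) ys[of n] slopes[of "s n"] unfolding has_slopes_in_def by blast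
  moreover have "compact (Q \<times> cball (0::'a) B)" using xs(2) by (intro compact_Times) auto
  ultimately obtain l r where l: "l \<in> Q \<times> cball 0 B" "strict_mono r" "((\<lambda>n. (xs n, ys n)) \<circ> r) \<longlonglongrightarrow> l"
    unfolding compact_def by meson
  have lx: "(xs \<circ> r) \<longlonglongrightarrow> fst l" using tendsto_fst[OF l(3)] by (simp add: o_def)
  have ly: "(ys \<circ> r) \<longlonglongrightarrow> snd l" using tendsto_snd[OF l(3)] by (simp add: o_def)
  have "snd l \<in> subgrads w (fst l)"
  proof (rule subgrads_limit[OF _ _ lx ly])
    fix z
    have "strict_mono (s \<circ> r)" using s l(2) by (rule strict_mono_o)
    from LIMSEQ_subseq_LIMSEQ[OF lim[of z] this] show "(\<lambda>n. u (s (r n)) z) \<longlonglongrightarrow> w z" by (simp add: o_def)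
  next
    show "\<bar>u (s (r n)) x - u (s (r n)) z\<bar> \<le> B * norm (x - z)" for n x z
      by (rule has_slopes_in_lipschitz[OF slopes order_refl])
  next
    show "(ys \<circ> r) n \<in> subgrads (u (s (r n))) ((xs \<circ> r) n)" for n using ys[of "r n"] by simp
  qed
  moreover have "fst l \<in> Q" using l(1) by auto
  ultimately show ?thesis using l(2) lx ly by blast
qed

lemma cell_norm:
  fixes z x :: "real^2"
  assumes "z \<in> box (x - vec (h / 2)) (x + vec (h / 2))"
  shows "norm (z - x) \<le> h"
proof -
  have "\<bar>(z - x) $ i\<bar> \<le> h / 2" for i
  proof -
    have "x $ i - h / 2 < z $ i" "z $ i < x $ i + h / 2" using assms unfolding mem_box_cart by auto
    then show ?thesis unfolding vector_minus_component by linarith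
  qed
  from this[of 1] this[of 2] show ?thesis
    using norm_le_l1_cart[of "z - x"] by (simp add: sum_2)
qed

lemma measure_compact_outer:
  fixes F :: "'a::euclidean_space set"
  assumes "finite_measure M" "sets borel \<subseteq> sets M" "compact F"
    and le: "\<And>\<delta>. \<delta> > 0 \<Longrightarrow> c \<le> measure M (\<Union>x\<in>F. ball x \<delta>)"
  shows "c \<le> measure M F"
proof -
  interpret finite_measure M by fact
  define B where "B k = (\<Union>x\<in>F. ball x (1 / real (Suc k)))" for k :: nat
  have "(\<lambda>k. measure M (B k)) \<longlonglongrightarrow> measure M (\<Inter>k. B k)"
  proof (rule finite_Lim_measure_decseq)
    show "range B \<subseteq> sets M" using assms(2) unfolding B_def by (auto intro!: borel_open open_UN)
    show "decseq B"
    proof (rule decseq_SucI)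
      show "B (Suc k) \<subseteq> B k" for k
        unfolding B_def by (intro UN_mono subset_ball) (auto simp: frac_le)
    qed
  qed
  moreover have "(\<Inter>k. B k) = F"
  proof
    show "F \<subseteq> (\<Inter>k. B k)" unfolding B_def by force
    show "(\<Inter>k. B k) \<subseteq> F"
    proof
      fix z assume z: "z \<in> (\<Inter>k. B k)"
      have "z \<in> closure F" unfolding closure_approachable
      proof (intro allI impI)
        fix e :: real assume "0 < e"
        then obtain k where k: "1 / real (Suc k) < e" by (rule nat_approx_posE)
        from z have "z \<in> B k" by blast
        then show "\<exists>y\<in>F. dist y z < e" unfolding B_def using k by force
      qed
      then show "z \<in> F" using assms(3) by (simp add: compact_imp_closed)
    qed
  qed
  ultimately show ?thesis
    using le unfolding B_def by (intro LIMSEQ_le_const) auto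
qed

text \<open>What the limit requires of the discrete solutions, stripped of the scheme. All assumptions are
  inherited by subsequences. The sets \<open>contact n C\<close> stand for the nodes where the function \<open>u n\<close>
  has a contact slope in \<open>C\<close>.\<close>

locale asymptotic_potentials =
  fixes \<mu> \<nu> :: "(real^2) measure" and Y :: "(real^2) set" and B :: real
    and h :: "nat \<Rightarrow> real" and V :: "nat \<Rightarrow> (int^2) set"
    and u :: "nat \<Rightarrow> real^2 \<Rightarrow> real" and contact :: "nat \<Rightarrow> (real^2) set \<Rightarrow> (real^2) set"
  assumes mu: "finite_measure \<mu>" "sets \<mu> = sets lebesgue" "measure \<mu> UNIV = 1"
      "\<And>P. (AE x in lebesgue. P x) \<Longrightarrow> (AE x in \<mu>. P x)"
    and nu: "finite_measure \<nu>" "sets \<nu> = sets borel" "measure \<nu> UNIV = 1"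
    and Y: "bounded Y"
    and h: "h \<longlonglongrightarrow> 0"
    and V_mono: "\<And>n n'. n \<le> n' \<Longrightarrow> V n \<subseteq> V n'"
    and V_exhausts: "(\<Inter>n. outer_polygon Y (V n)) = closure Y"
    and slopes: "\<And>n. has_slopes_in (u n) (cball 0 B)"
    and directional: "\<And>n x e. e \<in> V n \<Longrightarrow> u n (x + of_int_vec e) \<le> u n x + support_fun Y (of_int_vec e)"
    and covers: "\<And>n y. y \<in> closure Y \<Longrightarrow> \<exists>x\<in>square. y \<in> subgrads (u n) x"
    and contact: "\<And>n C x. x \<in> contact n C \<Longrightarrow> x \<in> square \<and> subgrads (u n) x \<inter> C \<noteq> {}"
    and mass: "\<And>\<epsilon>. \<epsilon> > 0 \<Longrightarrow> \<forall>\<^sub>F n in sequentially. \<forall>C. closed C \<longrightarrow>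
        measure \<nu> C \<le> (1 + \<epsilon>) * measure \<mu> (\<Union>x\<in>contact n C. box (x - vec (h n / 2)) (x + vec (h n / 2)))"
begin

lemma subsequence:
  assumes r: "strict_mono (r :: nat \<Rightarrow> nat)"
  shows "asymptotic_potentials \<mu> \<nu> Y B (h \<circ> r) (V \<circ> r) (u \<circ> r) (contact \<circ> r)"
proof (rule asymptotic_potentials.intro)
  show "(h \<circ> r) \<longlonglongrightarrow> 0" using h r by (rule LIMSEQ_subseq_LIMSEQ)
  show "(V \<circ> r) n \<subseteq> (V \<circ> r) n'" if "n \<le> n'" for n n'
    using V_mono[of "r n" "r n'"] strict_mono_leD[OF r that] by simp
  show "(\<Inter>n. outer_polygon Y ((V \<circ> r) n)) = closure Y"
  proof -
    have "outer_polygon Y (V (r n)) \<subseteq> outer_polygon Y (V n)" for n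
      using V_mono[OF seq_suble[OF r, of n]] unfolding outer_polygon_def by blast
    then have "(\<Inter>n. outer_polygon Y (V (r n))) = (\<Inter>n. outer_polygon Y (V n))" by blast
    then show ?thesis using V_exhausts by simp
  qed
  show "\<forall>\<^sub>F n in sequentially. \<forall>C. closed C \<longrightarrow> measure \<nu> C \<le> (1 + \<epsilon>) *
      measure \<mu> (\<Union>x\<in>(contact \<circ> r) n C. box (x - vec ((h \<circ> r) n / 2)) (x + vec ((h \<circ> r) n / 2)))"
    if "\<epsilon> > 0" for \<epsilon>
    using eventually_subseq[OF r mass[OF that]] by simp
  show "has_slopes_in ((u \<circ> r) n) (cball 0 B)" for n using slopes by simp
  show "(u \<circ> r) n (x + of_int_vec e) \<le> (u \<circ> r) n x + support_fun Y (of_int_vec e)"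
    if "e \<in> (V \<circ> r) n" for n x e using directional that by simp
  show "\<exists>x\<in>square. y \<in> subgrads ((u \<circ> r) n) x" if "y \<in> closure Y" for n y
    using covers[OF that, of "r n"] by simp
  show "x \<in> square \<and> subgrads ((u \<circ> r) n) x \<inter> C \<noteq> {}" if "x \<in> (contact \<circ> r) n C" for n C x
    using contact[of x "r n" C] that by simp
qed (fact mu nu Y)+

context
  fixes w :: "real^2 \<Rightarrow> real"
  assumes lim: "\<And>x. (\<lambda>n. u n x) \<longlonglongrightarrow> w x"
begin

text \<open>One inclusion passes the directional growth bound to the limit for every direction and uses that
  the polygons shrink to the closure of \<open>Y\<close>. The other uses compactness of the square: points
  with the slope \<open>y\<close> cannot escape to infinity.\<close>

lemma limit_range: "(\<Union>x. subgrads w x) = closure Y"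
proof
  show "(\<Union>x. subgrads w x) \<subseteq> closure Y"
  proof clarify
    fix x p assume p: "p \<in> subgrads w x"
    have "p \<bullet> of_int_vec e \<le> support_fun Y (of_int_vec e)" if e: "e \<in> V m" for m e
    proof -
      have "w (x + of_int_vec e) \<le> w x + support_fun Y (of_int_vec e)"
      proof (rule LIMSEQ_le[OF lim])
        show "(\<lambda>n. u n x + support_fun Y (of_int_vec e)) \<longlonglongrightarrow> w x + support_fun Y (of_int_vec e)"
          by (intro tendsto_intros lim)
        show "\<exists>N. \<forall>n\<ge>N. u n (x + of_int_vec e) \<le> u n x + support_fun Y (of_int_vec e)"
          using directional V_mono e by blast
      qed
      then show ?thesis using subgradsD[OF p, of "x + of_int_vec e"] by simp
    qed
    then show "p \<in> closure Y" unfolding V_exhausts[symmetric] outer_polygon_def by blast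
  qed
  show "closure Y \<subseteq> (\<Union>x. subgrads w x)"
  proof
    fix y assume y: "y \<in> closure Y"
    then obtain xs where xs: "\<And>n. xs n \<in> square" "\<And>n. y \<in> subgrads (u n) (xs n)"
      using covers by metis
    obtain x y' r where r: "((\<lambda>_ :: nat. y) \<circ> r) \<longlonglongrightarrow> y'" "y' \<in> subgrads w x"
      using subgrads_limit_compact[where xs = xs and ys = "\<lambda>_. y", OF lim slopes strict_mono_id xs(1) square_compact] xs(2)
      by (auto simp: id_def)
    then have "y' = y" by (simp add: o_def LIMSEQ_const_iff)
    with r(2) show "y \<in> (\<Union>x. subgrads w x)" by blast
  qed
qed

lemma limit_slopes: "has_slopes_in w (closure Y)"
  unfolding has_slopes_in_def
proof (intro allI conjI)
  fix x
  show "subgrads w x \<subseteq> closure Y" using limit_range by blast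
  have "\<exists>p. p \<in> subgrads (u n) x" for n using slopes unfolding has_slopes_in_def by blast
  then obtain ps where ps: "\<And>n. ps n \<in> subgrads (u n) x" by metis
  then have "\<exists>z\<in>{x}. \<exists>p\<in>subgrads w z. \<exists>r :: nat \<Rightarrow> nat. strict_mono r \<and>
      ((\<lambda>_ :: nat. x) \<circ> r) \<longlonglongrightarrow> z \<and> (ps \<circ> r) \<longlonglongrightarrow> p"
    by (intro subgrads_limit_compact[OF lim slopes strict_mono_id]) simp_all
  then show "subgrads w x \<noteq> {}" by blast
qed

lemma compact_closure_Y: "compact (closure Y)" using Y by (simp add: compact_closure)

text \<open>If \<open>n\<close> is large, then the cells around the contact nodes of \<open>C\<close> lie in any given neighbourhood of the limit set:
  otherwise contact nodes and their slopes would accumulate at a point with a slope in \<open>C\<close> away from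
  that set.\<close>

lemma mass_limit:
  assumes C: "closed C"
  shows "measure \<nu> C \<le> measure \<mu> {x \<in> square. subgrads w x \<inter> C \<noteq> {}}" (is "_ \<le> measure \<mu> ?F")
proof (rule measure_compact_outer[OF mu(1)])
  interpret finite_measure \<mu> by (rule mu(1))
  have F: "?F = square \<inter> {x. subgrads w x \<inter> C \<noteq> {}}" by blast
  show "compact ?F" unfolding F
    by (intro compact_Int_closed square_compact closed_subgrads_hit[OF limit_slopes compact_closure_Y C])
  show borel: "sets borel \<subseteq> sets \<mu>"
    unfolding mu(2) using sets_completionI_sub[of _ lborel] by auto
  fix \<delta> :: real assume \<delta>: "\<delta> > 0"
  define N where "N = (\<Union>x\<in>?F. ball x \<delta>)"
  define cells where "cells n = (\<Union>x\<in>contact n C. box (x - vec (h n / 2)) (x + vec (h n / 2)))" for n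
  have "open N" unfolding N_def by blast
  then have N: "N \<in> sets \<mu>" using borel by (meson borel_open subsetD)
  have near: "\<forall>\<^sub>F n in sequentially. cells n \<subseteq> N"
  proof (rule ccontr)
    assume "\<not> ?thesis"
    then obtain s :: "nat \<Rightarrow> nat" where s: "strict_mono s" "\<And>n. \<not> cells (s n) \<subseteq> N"
      using not_eventually_sequentiallyD by blast
    have "\<exists>x y z. x \<in> contact (s n) C \<and> y \<in> subgrads (u (s n)) x \<inter> C \<and>
        z \<in> box (x - vec (h (s n) / 2)) (x + vec (h (s n) / 2)) \<and> z \<notin> N" for n
      using s(2)[of n] contact[of _ "s n" C] unfolding cells_def by blast
    then obtain xs ys zs where xyz: "\<And>n. xs n \<in> contact (s n) C"
        "\<And>n. ys n \<in> subgrads (u (s n)) (xs n) \<inter> C"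
        "\<And>n. zs n \<in> box (xs n - vec (h (s n) / 2)) (xs n + vec (h (s n) / 2))" "\<And>n. zs n \<notin> N"
      by metis
    have xs: "xs n \<in> square" for n using contact xyz(1) by blast
    have sub: "ys n \<in> subgrads (u (s n)) (xs n)" for n using xyz(2) by blast
    obtain x y r where r: "strict_mono r" "x \<in> square" "(xs \<circ> r) \<longlonglongrightarrow> x" "(ys \<circ> r) \<longlonglongrightarrow> y" "y \<in> subgrads w x"
      using subgrads_limit_compact[where xs = xs and ys = ys, OF lim slopes s(1) xs square_compact sub]
      by blast
    have "(ys \<circ> r) n \<in> C" for n using xyz(2) by simp
    then have "y \<in> C" using r(4) by (rule closed_sequentially[OF C])
    with r(2,5) have x: "x \<in> ?F" by blast
    have "(\<lambda>n. zs (r n) - xs (r n)) \<longlonglongrightarrow> 0"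
    proof (rule Lim_null_comparison)
      show "\<forall>\<^sub>F n in sequentially. norm (zs (r n) - xs (r n)) \<le> h (s (r n))"
        using cell_norm[OF xyz(3)] by simp
      have "strict_mono (s \<circ> r)" using s(1) r(1) by (rule strict_mono_o)
      from LIMSEQ_subseq_LIMSEQ[OF h this] show "(\<lambda>n. h (s (r n))) \<longlonglongrightarrow> 0" by (simp add: o_def)
    qed
    from tendsto_add[OF this r(3)[unfolded o_def]] have "(\<lambda>n. zs (r n)) \<longlonglongrightarrow> x" by simp
    then have "\<forall>\<^sub>F n in sequentially. dist (zs (r n)) x < \<delta>" using \<delta> by (rule tendstoD)
    then obtain n where "dist (zs (r n)) x < \<delta>" using eventually_happens by fastforce
    then have "zs (r n) \<in> N" using x unfolding N_def by (auto simp: dist_commute)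
    with xyz(4) show False by blast
  qed
  have "measure \<nu> C \<le> (1 + \<epsilon>) * measure \<mu> N" if \<epsilon>: "\<epsilon> > 0" for \<epsilon>
  proof -
    obtain n where n: "cells n \<subseteq> N" "measure \<nu> C \<le> (1 + \<epsilon>) * measure \<mu> (cells n)"
      using eventually_happens[OF eventually_conj[OF near mass[OF \<epsilon>]]] C unfolding cells_def by auto
    have "measure \<mu> (cells n) \<le> measure \<mu> N" by (rule finite_measure_mono[OF n(1) N])
    then have "(1 + \<epsilon>) * measure \<mu> (cells n) \<le> (1 + \<epsilon>) * measure \<mu> N"
      using \<epsilon> by (intro mult_left_mono) auto
    with n(2) show ?thesis by linarith
  qed
  then have "0 \<le> (measure \<mu> N - measure \<nu> C) + \<epsilon> * measure \<mu> N" if "0 < \<epsilon>" for \<epsilon>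
    using that by (simp add: algebra_simps)
  from nonneg_if_affine_nonneg_near_0[OF this] show "measure \<nu> C \<le> measure \<mu> (\<Union>x\<in>?F. ball x \<delta>)"
    unfolding N_def by simp
qed

text \<open>Where \<open>w\<close> is differentiable, \<open>x\<close> has a slope in \<open>C\<close> only if the gradient at \<open>x\<close> lies in \<open>C\<close>; so
  \<open>mass_limit\<close> compares \<open>\<nu>\<close> with the image of \<open>\<mu>\<close> under the gradient.\<close>

theorem limit_minimal_brenier: "minimal_brenier \<mu> \<nu> Y (\<lambda>x. ereal (w x))"
proof -
  interpret finite_measure \<mu> by (rule mu(1))
  let ?G = "gradient (\<lambda>z. ereal (w z))"
  have AE: "AE x in \<mu>. \<exists>p. has_gradient (\<lambda>z. ereal (w z)) x p"
    by (rule mu(4)[OF AE_has_gradient[OF limit_slopes compact_closure_Y]])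
  have G: "?G \<in> borel_measurable \<mu>"
    using gradient_borel_measurable[OF limit_slopes compact_closure_Y]
    unfolding measurable_cong_sets[OF mu(2) refl] .
  have space: "space \<mu> = UNIV" using sets_eq_imp_space_eq[OF mu(2)] by simp
  have "\<nu> = distr \<mu> borel ?G"
  proof (rule measure_eq_if_le_on_compact)
    show "finite_measure (distr \<mu> borel ?G)" using G by (rule finite_measure_distr)
    show "measure \<nu> UNIV = measure (distr \<mu> borel ?G) UNIV"
      using G mu(3) nu(3) by (simp add: measure_distr space)
    fix C :: "(real^2) set" assume "compact C"
    then have C: "closed C" by (rule compact_imp_closed)
    let ?F = "{x \<in> square. subgrads w x \<inter> C \<noteq> {}}"
    have sets: "?G -` C \<inter> space \<mu> \<in> sets \<mu>" by (rule measurable_sets[OF G]) (use C in simp)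
    have "measure \<nu> C \<le> measure \<mu> ?F" by (rule mass_limit[OF C])
    also have "\<dots> \<le> measure \<mu> (?G -` C \<inter> space \<mu>)"
    proof (rule finite_measure_mono_AE[OF _ sets])
      show "AE x in \<mu>. x \<in> ?F \<longrightarrow> x \<in> ?G -` C \<inter> space \<mu>"
        using AE
      proof eventually_elim
        case (elim x)
        then obtain p where p: "has_gradient (\<lambda>z. ereal (w z)) x p" by blast
        show ?case using gradient_eq[OF limit_slopes p] by (auto simp: space)
      qed
    qed
    also have "\<dots> = measure (distr \<mu> borel ?G) C" using G C by (simp add: measure_distr)
    finally show "measure \<nu> C \<le> measure (distr \<mu> borel ?G) C" .
  qed (use nu in auto)
  from this[symmetric] show ?thesis
    unfolding minimal_brenier_def subdifferential_ereal
    using has_slopes_convex_lsc[OF limit_slopes compact_closure_Y] AE G limit_range by blast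
qed

end

end

section \<open>Compactness and convergence\<close>

lemma lipschitz_sequence_pointwise_subsequence:
  fixes u :: "nat \<Rightarrow> 'a::euclidean_space \<Rightarrow> real"
  assumes lip: "\<And>n x z. \<bar>u n x - u n z\<bar> \<le> B * norm (x - z)" and B: "B > 0"
    and bound: "\<And>n. \<bar>u n 0\<bar> \<le> M"
  obtains r w where "strict_mono (r :: nat \<Rightarrow> nat)" "\<And>x. (\<lambda>k. u (r k) x) \<longlonglongrightarrow> w x"
proof -
  obtain D :: "'a set" where D: "countable D" "\<And>A. open A \<Longrightarrow> A \<noteq> {} \<Longrightarrow> \<exists>d\<in>D. d \<in> A"
    using countable_dense_exists by blast
  \<comment> \<open>The division makes the bound independent of \<open>x\<close>.\<close>
  have le: "norm (u n x / (1 + norm x)) \<le> M + B" for n x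
  proof -
    have M: "0 \<le> M" using bound[of 0] by linarith
    have "\<bar>u n x\<bar> \<le> M + B * norm x" using lip[of n x 0] bound[of n] by simp
    also have "\<dots> \<le> (M + B) * (1 + norm x)" using M B by (simp add: algebra_simps)
    finally have "\<bar>u n x\<bar> / (1 + norm x) \<le> M + B"
      by (simp add: divide_le_eq add_pos_nonneg)
    then show ?thesis by (simp add: abs_of_nonneg)
  qed
  obtain r where r: "strict_mono (r :: nat \<Rightarrow> nat)"
      "\<And>x. x \<in> D \<Longrightarrow> \<exists>l. (\<lambda>k. u (r k) x / (1 + norm x)) \<longlonglongrightarrow> l"
    using function_convergent_subsequence[OF D(1), of "\<lambda>n x. u n x / (1 + norm x)" "M + B"] le by blast
  have dense: "convergent (\<lambda>k. u (r k) x)" if x: "x \<in> D" for x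
  proof -
    obtain l where "(\<lambda>k. u (r k) x / (1 + norm x)) \<longlonglongrightarrow> l" using r(2)[OF x] by blast
    then have "(\<lambda>k. (1 + norm x) * (u (r k) x / (1 + norm x))) \<longlonglongrightarrow> (1 + norm x) * l"
      by (rule tendsto_mult_left)
    moreover have "1 + norm x \<noteq> 0" using norm_ge_zero[of x] by linarith
    ultimately show ?thesis unfolding convergent_def by auto
  qed
  have "convergent (\<lambda>k. u (r k) x)" for x
  proof (rule Cauchy_convergent, rule metric_CauchyI)
    fix e :: real assume e: "0 < e"
    have "\<exists>d\<in>D. d \<in> ball x (e / (4 * B))" using divide_pos_pos[of e "4 * B"] e B by (intro D(2)) (auto simp: not_le)
    then obtain d where d: "d \<in> D" "norm (x - d) < e / (4 * B)" by (auto simp: dist_norm)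
    have Bd: "B * norm (x - d) < e / 4" using d(2) B by (simp add: field_simps)
    have "Cauchy (\<lambda>k. u (r k) d)" using dense[OF d(1)] by (rule convergent_Cauchy)
    then obtain N where N: "\<And>m n. m \<ge> N \<Longrightarrow> n \<ge> N \<Longrightarrow> dist (u (r m) d) (u (r n) d) < e / 4"
      using metric_CauchyD[of _ "e / 4"] e by (metis zero_less_divide_iff zero_less_numeral)
    have "dist (u (r m) x) (u (r n) x) < e" if "m \<ge> N" "n \<ge> N" for m n
      using N[OF that] lip[of "r m" x d] lip[of "r n" x d] Bd unfolding dist_real_def by linarith
    then show "\<exists>N. \<forall>m\<ge>N. \<forall>n\<ge>N. dist (u (r m) x) (u (r n) x) < e" by blast
  qed
  then have "(\<lambda>k. u (r k) x) \<longlonglongrightarrow> lim (\<lambda>k. u (r k) x)" for x by (simp add: convergent_LIMSEQ_iff)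
  then show thesis by (rule that[OF r(1)])
qed

lemma lipschitz_sequence_uniform_limit:
  fixes u :: "nat \<Rightarrow> 'a::euclidean_space \<Rightarrow> real"
  assumes lip: "\<And>n x z. \<bar>u n x - u n z\<bar> \<le> B * norm (x - z)" and B: "B > 0"
    and lim: "\<And>x. (\<lambda>n. u n x) \<longlonglongrightarrow> w x" and K: "compact K"
  shows "uniform_limit K u w sequentially"
proof (rule uniform_limitI)
  fix e :: real assume e: "0 < e"
  have lip_w: "\<bar>w x - w z\<bar> \<le> B * norm (x - z)" for x z
  proof (rule LIMSEQ_le_const2)
    show "(\<lambda>n. \<bar>u n x - u n z\<bar>) \<longlonglongrightarrow> \<bar>w x - w z\<bar>" by (intro tendsto_intros lim)
  qed (use lip in blast)
  define \<delta> where "\<delta> = e / (4 * B)"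
  have \<delta>: "\<delta> > 0" unfolding \<delta>_def using e B by simp
  have "\<forall>t\<in>K. open (ball t \<delta>)" "K \<subseteq> (\<Union>t\<in>K. ball t \<delta>)" using \<delta> by auto
  then obtain T where T: "T \<subseteq> K" "finite T" "K \<subseteq> (\<Union>t\<in>T. ball t \<delta>)"
    using compactE_image[OF K, of K "\<lambda>t. ball t \<delta>"] by blast
  have "\<forall>\<^sub>F n in sequentially. \<forall>t\<in>T. dist (u n t) (w t) < e / 4"
    using T(2) lim e by (intro eventually_ball_finite ballI tendstoD) auto
  then show "\<forall>\<^sub>F n in sequentially. \<forall>x\<in>K. dist (u n x) (w x) < e"
  proof eventually_elim
    case (elim n)
    show ?case
    proof
      fix x assume "x \<in> K"
      then obtain t where t: "t \<in> T" "norm (x - t) < \<delta>"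
        using T(3) by (auto simp: dist_norm norm_minus_commute)
      have "B * norm (x - t) < e / 4" using t(2) B unfolding \<delta>_def by (simp add: field_simps)
      then show "dist (u n x) (w x) < e"
        using bspec[OF elim t(1)] lip[of n x t] lip_w[of x t] unfolding dist_real_def by linarith
    qed
  qed
qed

text \<open>Every subsequence has a further subsequence that converges pointwise to a minimal Brenier solution
  with value \<open>0\<close> at the origin. Uniqueness identifies all these limits, and the Lipschitz bound
  makes the convergence locally uniform.\<close>

theorem (in asymptotic_potentials) converges_to_minimal_brenier:
  assumes Y': "open Y" "convex Y" "Y \<noteq> {}"
    and pos: "\<And>A. open A \<Longrightarrow> A \<noteq> {} \<Longrightarrow> A \<subseteq> Y \<Longrightarrow> emeasure \<nu> A \<noteq> 0"
    and bounded_source: "AE x in \<mu>. norm x \<le> B'" and B: "B > 0"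
    and at_0: "(\<lambda>n. u n 0) \<longlonglongrightarrow> 0"
  shows "\<exists>w :: real^2 \<Rightarrow> real. minimal_brenier \<mu> \<nu> Y (\<lambda>x. ereal (w x)) \<and> w 0 = 0 \<and>
      (\<forall>v. minimal_brenier \<mu> \<nu> Y v \<and> v 0 = 0 \<longrightarrow> v = (\<lambda>x. ereal (w x))) \<and>
      (\<forall>K. compact K \<longrightarrow> uniform_limit K u w sequentially)"
proof -
  have lip: "\<bar>u n x - u n z\<bar> \<le> B * norm (x - z)" for n x z
    by (rule has_slopes_in_lipschitz[OF slopes order_refl])
  have "Bseq (\<lambda>n. u n 0)" using at_0 by (intro convergent_imp_Bseq convergentI)
  then obtain M where M: "\<And>n. \<bar>u n 0\<bar> \<le> M" unfolding Bseq_def by auto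
  have sub_limit: "\<exists>r w. strict_mono (r :: nat \<Rightarrow> nat) \<and> (\<forall>x. (\<lambda>k. u (s (r k)) x) \<longlonglongrightarrow> w x) \<and>
      minimal_brenier \<mu> \<nu> Y (\<lambda>x. ereal (w x)) \<and> w 0 = 0" if s: "strict_mono s" for s :: "nat \<Rightarrow> nat"
  proof -
    obtain r w where r: "strict_mono (r :: nat \<Rightarrow> nat)" "\<And>x. (\<lambda>k. u (s (r k)) x) \<longlonglongrightarrow> w x"
      using lipschitz_sequence_pointwise_subsequence[of "\<lambda>n. u (s n)" B M] lip B M by blast
    have sr: "strict_mono (s \<circ> r)" using s r(1) by (rule strict_mono_o)
    interpret sub: asymptotic_potentials \<mu> \<nu> Y B "h \<circ> (s \<circ> r)" "V \<circ> (s \<circ> r)" "u \<circ> (s \<circ> r)" "contact \<circ> (s \<circ> r)"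
      by (rule subsequence[OF sr])
    have "minimal_brenier \<mu> \<nu> Y (\<lambda>x. ereal (w x))"
      by (rule sub.limit_minimal_brenier) (use r(2) in \<open>simp add: o_def\<close>)
    moreover have "w 0 = 0"
      using LIMSEQ_subseq_LIMSEQ[OF at_0 sr] r(2)[of 0] by (simp add: o_def LIMSEQ_unique)
    ultimately show ?thesis using r by blast
  qed
  obtain r w where w: "minimal_brenier \<mu> \<nu> Y (\<lambda>x. ereal (w x))" "w 0 = 0"
    using sub_limit[OF strict_mono_id] by blast
  have unique: "w' = w" if "minimal_brenier \<mu> \<nu> Y (\<lambda>x. ereal (w' x))" "w' 0 = 0" for w'
    by (rule minimal_brenier_unique[OF mu(1,2) bounded_source Y'(1) Y Y'(2,3) pos that(1) w(1), of 0])
      (use that(2) w(2) in auto)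
  have lim: "(\<lambda>n. u n x) \<longlonglongrightarrow> w x" for x
  proof (rule ccontr)
    assume "\<not> ?thesis"
    then obtain e where e: "e > 0" "\<not> (\<forall>\<^sub>F n in sequentially. dist (u n x) (w x) < e)"
      unfolding tendsto_iff by blast
    then obtain s :: "nat \<Rightarrow> nat" where s: "strict_mono s" "\<And>n. \<not> dist (u (s n) x) (w x) < e"
      using not_eventually_sequentiallyD by blast
    obtain r w' where w': "\<forall>x. (\<lambda>k. u (s (r k)) x) \<longlonglongrightarrow> w' x"
        "minimal_brenier \<mu> \<nu> Y (\<lambda>x. ereal (w' x))" "w' 0 = 0"
      using sub_limit[OF s(1)] by blast
    have "(\<lambda>k. u (s (r k)) x) \<longlonglongrightarrow> w x" using w'(1) unique[OF w'(2,3)] by blast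
    from tendstoD[OF this e(1)] obtain k where "dist (u (s (r k)) x) (w x) < e"
      using eventually_happens by fastforce
    with s(2) show False by blast
  qed
  have "v = (\<lambda>x. ereal (w x))" if v: "minimal_brenier \<mu> \<nu> Y v" "v 0 = 0" for v
  proof -
    obtain w' where w': "v = (\<lambda>x. ereal (w' x))"
      using minimal_brenier_has_slopes_in[OF v(1) Y Y'(3)] by blast
    then have "w' = w" using v unique[of w'] by simp
    with w' show ?thesis by simp
  qed
  moreover have "uniform_limit K u w sequentially" if "compact K" for K
    by (rule lipschitz_sequence_uniform_limit[OF lip B lim that])
  ultimately show ?thesis using w by blast
qed

context scheme_step begin

text \<open>If all contact nodes stayed outside \<open>ball 0 \<delta>\<close>, then their cells would miss the smaller ball, and
  the cells would be too light to carry the whole of \<open>\<nu>\<close>.\<close>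

lemma contact_node_near_0:
  assumes \<delta>: "ball 0 \<delta> \<subseteq> X" "h \<le> \<delta> / 2" and \<epsilon>: "0 \<le> \<epsilon>"
    and near: "\<And>x y. x \<in> grid h \<inter> X \<Longrightarrow> y \<in> contact_cell x \<Longrightarrow> g y \<le> (1 + \<epsilon>) * g (nabla U x)"
    and total: "measure \<mu> UNIV = 1" and small: "(1 + \<epsilon>) * (1 - measure \<mu> (ball 0 (\<delta> / 2))) < 1"
  shows "\<exists>x\<in>contact_nodes UNIV. norm x < \<delta>"
proof (rule ccontr)
  assume far: "\<not> ?thesis"
  interpret finite_measure \<mu> by (rule finite_mu)
  have space: "space \<mu> = UNIV" by (simp add: source_measure_def)
  have ball: "ball 0 (\<delta> / 2) \<in> sets \<mu>" by (simp add: source_measure_def)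
  let ?cells = "\<Union>x\<in>contact_nodes UNIV. cell x"
  have "?cells \<subseteq> UNIV - ball 0 (\<delta> / 2)"
  proof
    fix z assume "z \<in> ?cells"
    then obtain x where x: "x \<in> contact_nodes UNIV" and z: "z \<in> cell x" by blast
    have "\<delta> \<le> norm x" using far x by (meson not_le)
    moreover have "norm x \<le> norm (z - x) + norm z" by (metis norm_minus_commute norm_triangle_sub add.commute)
    ultimately show "z \<in> UNIV - ball 0 (\<delta> / 2)" using cell_norm[OF z] \<delta>(2) by simp
  qed
  then have "measure \<mu> ?cells \<le> measure \<mu> (UNIV - ball 0 (\<delta> / 2))"
    using sets.compl_sets[OF ball] by (intro finite_measure_mono) (simp_all add: space)
  also have "\<dots> = 1 - measure \<mu> (ball 0 (\<delta> / 2))"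
    using finite_measure_compl[OF ball] total by (simp add: space)
  finally have "(1 + \<epsilon>) * measure \<mu> ?cells \<le> (1 + \<epsilon>) * (1 - measure \<mu> (ball 0 (\<delta> / 2)))"
    using \<epsilon> by (intro mult_left_mono) auto
  moreover have "measure \<nu> UNIV \<le> (1 + \<epsilon>) * measure \<mu> ?cells"
    by (rule target_le_source[OF \<epsilon> near closed_UNIV])
  moreover have "measure \<nu> UNIV = 1"
    using emeasure_target_UNIV[OF g_cont g_nonneg Y_open g_mass] by (simp add: measure_def)
  ultimately show False using small by linarith
qed

lemma u_0_upper: "u 0 \<le> 0"
  using u_le_U[OF zero_in_grid] U_0 by simp

lemma u_0_lower:
  assumes "x \<in> contact_nodes UNIV"
  shows "- (4 * R * norm x) \<le> u 0"
proof -
  have x: "x \<in> nodes" and "\<exists>y. y \<in> contact_cell x" using assms unfolding contact_nodes_def by auto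
  then have "u x = U x" using contact(1) by blast
  obtain y where "y \<in> closure Y" using Y_nonempty by fastforce
  then have R: "0 \<le> R" using Y_ball by (meson mem_cball_0 norm_ge_zero order_trans subsetD)
  have "\<bar>x $ 1\<bar> + \<bar>x $ 2\<bar> \<le> 2 * norm x" using component_le_norm_cart[of x 1] component_le_norm_cart[of x 2] by linarith
  then have "R * (\<bar>x $ 1\<bar> + \<bar>x $ 2\<bar>) \<le> R * (2 * norm x)" using R by (rule mult_left_mono)
  moreover have "\<bar>u x - u 0\<bar> \<le> 2 * R * norm (x - 0)" by (rule has_slopes_in_lipschitz[OF u_slopes polygon_ball])
  ultimately show ?thesis using U_lower[OF x] \<open>u x = U x\<close> by simp
qed

end

section \<open>Convergence of the scheme\<close>

lemma has_slopes_in_mono: "has_slopes_in u K \<Longrightarrow> K \<subseteq> L \<Longrightarrow> has_slopes_in u L"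
  unfolding has_slopes_in_def by blast

lemma tendsto_SUP_SUP_ennreal_D:
  fixes F :: "nat \<Rightarrow> 'a \<Rightarrow> 'b \<Rightarrow> real"
  assumes "(\<lambda>n. SUP x\<in>A n. SUP y\<in>S n x. ennreal (F n x y)) \<longlonglongrightarrow> 0" and "0 < \<eta>"
  shows "\<forall>\<^sub>F n in sequentially. \<forall>x\<in>A n. \<forall>y\<in>S n x. F n x y < \<eta>"
proof -
  have "\<forall>\<^sub>F n in sequentially. (SUP x\<in>A n. SUP y\<in>S n x. ennreal (F n x y)) < ennreal \<eta>"
    using assms by (intro order_tendstoD(2)) auto
  then show ?thesis
  proof eventually_elim
    case (elim n)
    show ?case
    proof (intro ballI)
      fix x y assume "x \<in> A n" "y \<in> S n x"
      then have "ennreal (F n x y) \<le> (SUP x\<in>A n. SUP y\<in>S n x. ennreal (F n x y))"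
        by (meson SUP_upper SUP_upper2)
      then have "ennreal (F n x y) < ennreal \<eta>" using elim by (rule order_le_less_trans)
      then show "F n x y < \<eta>" by (metis ennreal_leI not_le)
    qed
  qed
qed

theorem theorem5p5:
  fixes X Y :: "(real^2) set" and f g :: "real^2 \<Rightarrow> real"
    and m\<^sub>f M\<^sub>f m\<^sub>g M\<^sub>g :: real
    and h :: "nat \<Rightarrow> real" and V :: "nat \<Rightarrow> (int^2) set"
    and nabla :: "nat \<Rightarrow> (real^2 \<Rightarrow> real) \<Rightarrow> real^2 \<Rightarrow> real^2"
    and U u :: "nat \<Rightarrow> real^2 \<Rightarrow> real"
  assumes X: "open X" "bounded X" "0 \<in> X" "closure X \<subseteq> interior square"
    and Y: "open Y" "bounded Y" "convex Y" "Y \<noteq> {}"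
    and bounds_pos: "m\<^sub>f > 0" "M\<^sub>f > 0" "m\<^sub>g > 0" "M\<^sub>g > 0"
    and f_density: "integrable lebesgue f" "(LINT x|lebesgue. f x) = 1"
    and f_outside: "\<And>x. x \<notin> X \<Longrightarrow> f x = 0"
    and f_bounds: "\<And>x. x \<in> X \<Longrightarrow> m\<^sub>f \<le> f x \<and> f x \<le> M\<^sub>f"
    and g_cont: "continuous_on UNIV g"
    and g_bounds: "\<And>y. m\<^sub>g \<le> g y \<and> g y \<le> M\<^sub>g"
    and g_mass: "(LINT y:Y|lborel. g y) = 1"
    and h: "\<And>n. h n > 0" "decseq h" "h \<longlonglongrightarrow> 0"
    and V_finite: "\<And>n. finite (V n)"
    and V_irreducible: "\<And>n e. e \<in> V n \<Longrightarrow> e \<noteq> 0 \<and> irreducible_vec e"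
    and V_axes: "\<And>n. {vector [1, 0], vector [-1, 0], vector [0, 1], vector [0, -1]} \<subseteq> V n"
    and V_mono: "\<And>n n'. n \<le> n' \<Longrightarrow> V n \<subseteq> V n'"
    and V_exhausts: "(\<Inter>n. outer_polygon Y (V n)) = closure Y"
    and V_stencil: "\<And>n x e. x \<in> closure X \<Longrightarrow> e \<in> V n \<Longrightarrow> x + h n *\<^sub>R of_int_vec e \<in> square"
    and U: "\<And>n. scheme_solution X f Y g (h n) (V n) (nabla n) (U n)"
    and u: "\<And>n x. u n x = convex_extension Y (V n) (h n) (U n) x"
    and gradient_consistent:
      "(\<lambda>n. SUP x\<in>closure X \<inter> grid (h n). SUP y\<in>subdifferential (\<lambda>z. ereal (u n z)) x.
          ennreal (norm (nabla n (U n) x - y))) \<longlonglongrightarrow> 0"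
  shows "\<exists>u' :: real^2 \<Rightarrow> real.
      minimal_brenier (source_measure f) (target_measure Y g) Y (\<lambda>x. ereal (u' x)) \<and> u' 0 = 0 \<and>
      (\<forall>v. minimal_brenier (source_measure f) (target_measure Y g) Y v \<and> v 0 = 0 \<longrightarrow>
           v = (\<lambda>x. ereal (u' x))) \<and>
      (\<forall>K. compact K \<longrightarrow> uniform_limit K u u' sequentially)"

proof -
  let ?\<mu> = "source_measure f" and ?\<nu> = "target_measure Y g"
  have f_nonneg: "0 \<le> f x" for x
    using f_outside[of x] f_bounds[of x] bounds_pos(1) by (cases "x \<in> X") auto
  have g_nonneg: "0 \<le> g y" for y using g_bounds[of y] bounds_pos(3) by linarith
  have "compact (closure Y)" using Y(2) by (simp add: compact_closure)
  then obtain R where R: "closure Y \<subseteq> cball 0 R" "R > 0" by (rule compact_norm_bound)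
  have X_square: "X \<subseteq> square" using closure_subset[of X] X(4) interior_subset by blast
  have step: "scheme_step Y R (V n) (h n) (U n) X f g m\<^sub>f m\<^sub>g (nabla n)" for n
  proof unfold_locales
    show "x + h n *\<^sub>R of_int_vec e \<in> square" if "x \<in> X" "e \<in> V n" for x e
      using V_stencil[OF _ that(2)] closure_subset that(1) by blast
    show "e \<noteq> 0" if "e \<in> V n" for e using V_irreducible[OF that] by blast
  qed (use X Y bounds_pos f_density f_outside f_bounds g_cont g_bounds g_mass h V_finite V_axes U R X_square
       in \<open>simp_all\<close>)
  have potential: "grid_potential Y R (V n) (h n)" for n using step[of n] by (simp add: scheme_step_def)
  have u_eq: "u n = convex_extension Y (V n) (h n) (U n)" for n using u by blast
  define contact where "contact n = scheme_step.contact_nodes Y (h n) (U n)" for n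
  have near: "\<forall>\<^sub>F n in sequentially. \<forall>x\<in>grid (h n) \<inter> X. \<forall>y\<in>grid_potential.contact_cell Y (h n) (U n) x.
      g y \<le> (1 + \<epsilon>) * g (nabla n (U n) x)" if \<epsilon>: "\<epsilon> > 0" for \<epsilon>
  proof -
    \<comment> \<open>The discrete gradient is only close to the closure of \<open>Y\<close>, hence the larger ball.\<close>
    have "uniformly_continuous_on (cball 0 (R + 1)) g"
      using continuous_on_subset[OF g_cont] by (intro compact_uniformly_continuous) auto
    moreover have "0 < \<epsilon> * m\<^sub>g" using \<epsilon> bounds_pos(3) by simp
    ultimately obtain \<eta> where \<eta>: "\<eta> > 0" "\<And>p q. p \<in> cball 0 (R + 1) \<Longrightarrow> q \<in> cball 0 (R + 1) \<Longrightarrow>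
        dist p q < \<eta> \<Longrightarrow> dist (g p) (g q) < \<epsilon> * m\<^sub>g"
      unfolding uniformly_continuous_on_def by metis
    have "\<forall>\<^sub>F n in sequentially. \<forall>x\<in>closure X \<inter> grid (h n). \<forall>y\<in>subdifferential (\<lambda>z. ereal (u n z)) x.
        norm (nabla n (U n) x - y) < min 1 \<eta>"
      using tendsto_SUP_SUP_ennreal_D[OF gradient_consistent, of "min 1 \<eta>"] \<eta>(1) by simp
    then show ?thesis
    proof eventually_elim
      case (elim n)
      show ?case
      proof (intro ballI)
        fix x y assume x: "x \<in> grid (h n) \<inter> X" and y: "y \<in> grid_potential.contact_cell Y (h n) (U n) x"
        have "y \<in> subgrads (u n) x"
          unfolding u_eq by (rule grid_potential.contact(2)[OF potential _ y]) (use x X_square in blast)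
        then have d: "norm (nabla n (U n) x - y) < min 1 \<eta>"
          using elim x closure_subset[of X] unfolding subdifferential_ereal by blast
        have "y \<in> closure Y" using y unfolding grid_potential.contact_cell_def[OF potential] by blast
        then have y_R: "norm y \<le> R" using R(1) by auto
        have "norm (nabla n (U n) x) \<le> norm (nabla n (U n) x - y) + norm y"
          by (metis diff_add_cancel norm_triangle_ineq)
        then have "dist (g y) (g (nabla n (U n) x)) < \<epsilon> * m\<^sub>g"
          using d y_R by (intro \<eta>(2)) (auto simp: dist_norm norm_minus_commute)
        moreover have "\<epsilon> * m\<^sub>g \<le> \<epsilon> * g (nabla n (U n) x)" using \<epsilon> g_bounds by (intro mult_left_mono) auto
        ultimately show "g y \<le> (1 + \<epsilon>) * g (nabla n (U n) x)"
          unfolding dist_real_def by (simp add: algebra_simps)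
      qed
    qed
  qed
  have total: "measure ?\<mu> UNIV = 1"
    using measure_source[OF f_density(1) f_nonneg, of UNIV] f_density(2) by (simp add: set_lebesgue_integral_def)
  have AE_source: "AE x in ?\<mu>. P x" if "AE x in lebesgue. P x" for P
    using that f_density(1) unfolding source_measure_def by (subst AE_density) (auto elim: eventually_mono)
  have limit: "asymptotic_potentials ?\<mu> ?\<nu> Y (2 * R) h V u contact"
  proof (rule asymptotic_potentials.intro)
    show "finite_measure ?\<mu>" by (rule finite_source[OF f_density(1) f_nonneg])
    show "sets ?\<mu> = sets lebesgue" by (simp add: source_measure_def)
    show "measure ?\<mu> UNIV = 1" by (rule total)
    show "AE x in ?\<mu>. P x" if "AE x in lebesgue. P x" for P by (rule AE_source[OF that])
    show "finite_measure ?\<nu>" by (rule finite_target[OF g_cont g_nonneg Y(1) g_mass])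
    show "sets ?\<nu> = sets borel" by (simp add: target_measure_def)
    show "measure ?\<nu> UNIV = 1"
      using emeasure_target_UNIV[OF g_cont g_nonneg Y(1) g_mass] by (simp add: measure_def)
    show "has_slopes_in (u n) (cball 0 (2 * R))" for n
      unfolding u_eq
      by (rule has_slopes_in_mono[OF grid_potential.u_slopes[OF potential] grid_potential.polygon_ball[OF potential]])
    show "u n (x + of_int_vec e) \<le> u n x + support_fun Y (of_int_vec e)" if "e \<in> V n" for n x e
      unfolding u_eq by (rule grid_potential.u_directional[OF potential that])
    show "\<exists>x\<in>square. y \<in> subgrads (u n) x" if y: "y \<in> closure Y" for n y
    proof -
      obtain x where "x \<in> grid (h n) \<inter> square" "y \<in> grid_potential.contact_cell Y (h n) (U n) x"
        using grid_potential.contact_cells_cover[OF potential y] by blast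
      then show ?thesis using grid_potential.contact(2)[OF potential] unfolding u_eq by blast
    qed
    show "x \<in> square \<and> subgrads (u n) x \<inter> C \<noteq> {}" if "x \<in> contact n C" for n C x
      using that grid_potential.contact(2)[OF potential, of x]
      unfolding contact_def scheme_step.contact_nodes_def[OF step] u_eq by blast
    show "\<forall>\<^sub>F n in sequentially. \<forall>C. closed C \<longrightarrow> measure ?\<nu> C \<le> (1 + \<epsilon>) *
        measure ?\<mu> (\<Union>x\<in>contact n C. box (x - vec (h n / 2)) (x + vec (h n / 2)))" if \<epsilon>: "\<epsilon> > 0" for \<epsilon>
      using near[OF \<epsilon>]
    proof eventually_elim
      case (elim n)
      then show ?case
        unfolding contact_def using \<epsilon> by (intro allI impI scheme_step.target_le_source[OF step]) auto
    qed
  qed (use Y h V_mono V_exhausts in blast)+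
  have at_0: "(\<lambda>n. u n 0) \<longlonglongrightarrow> 0"
  proof (rule tendstoI)
    fix e :: real assume e: "e > 0"
    obtain r where r: "r > 0" "ball 0 r \<subseteq> X" using X(1,3) open_contains_ball by blast
    define \<delta> where "\<delta> = min r (e / (4 * R))"
    have \<delta>: "\<delta> > 0" "ball 0 \<delta> \<subseteq> X" "\<delta> \<le> e / (4 * R)"
      using r e R(2) unfolding \<delta>_def by auto
    define c where "c = measure ?\<mu> (ball 0 (\<delta> / 2))"
    have "ball 0 (\<delta> / 2) \<subseteq> ball (0 :: real^2) \<delta>" using \<delta>(1) by (intro subset_ball) simp
    then have c: "c > 0"
      unfolding c_def using \<delta>(1,2) by (intro scheme_step.source_pos[OF step]) auto
    \<comment> \<open>The missing mass \<open>c\<close> itself serves as the tolerance \<open>\<epsilon>\<close>.\<close>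
    have small: "(1 + c) * (1 - c) < 1" using mult_pos_pos[OF c c] by (simp add: algebra_simps)
    have "\<forall>\<^sub>F n in sequentially. h n < \<delta> / 2" using h(3) \<delta>(1) by (intro order_tendstoD) auto
    with near[OF c] show "\<forall>\<^sub>F n in sequentially. dist (u n 0) 0 < e"
    proof eventually_elim
      case (elim n)
      have "\<exists>x\<in>scheme_step.contact_nodes Y (h n) (U n) UNIV. norm x < \<delta>"
        by (rule scheme_step.contact_node_near_0[OF step \<delta>(2) _ _ _ total small[unfolded c_def]])
          (use elim c in \<open>auto simp: c_def\<close>)
      then obtain x where x: "x \<in> scheme_step.contact_nodes Y (h n) (U n) UNIV" "norm x < \<delta>" by blast
      have "4 * R * norm x < 4 * R * \<delta>" using x(2) R(2) by simp
      also have "\<dots> \<le> e" using \<delta>(3) R(2) by (simp add: field_simps)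
      finally show ?case
        using scheme_step.u_0_lower[OF step x(1)] scheme_step.u_0_upper[OF step, of n]
        unfolding u_eq dist_real_def by linarith
    qed
  qed
  obtain B where B: "\<And>x. x \<in> X \<Longrightarrow> norm x \<le> B" using X(2) unfolding bounded_iff by blast
  have "AE x in ?\<mu>. norm x \<le> B"
  proof -
    have "x \<in> X" if "0 < ennreal (f x)" for x using that f_outside[of x] by (cases "x \<in> X") auto
    then show ?thesis
      using f_density(1) B unfolding source_measure_def by (subst AE_density) auto
  qed
  then show ?thesis
    using asymptotic_potentials.converges_to_minimal_brenier[OF limit Y(1,3,4) emeasure_target_pos[OF g_cont Y(1) bounds_pos(3)] _ _ at_0]
      g_bounds R(2) by auto
qed

end
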